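(* Let $K=\mathbb{Q}(\sqrt{D})$ be an imaginary quadratic field of discriminant $D<0$ with ring of integers $\mathcal{O}$, and for $1/2<s<1$ define \[ m_{s,K}(x)=\sum_{0\neq\mathfrak{a}\subset\mathcal{O}}\frac{e^{-2\pi i x N(\mathfrak{a})}}{N(\mathfrak{a})^s},\qquad x\in[0,1], \] where $\mathfrak{a}$ ranges over the nonzero integral ideals of $\mathcal{O}$ and $N(\mathfrak{a})=\#(\mathcal{O}/\mathfrak{a})$ is the ideal norm. Then $m_{s,K}$ belongs to weak-type $L^{1/(1-s)}[0,1]$; that is, there is a constant $c$ with $|\{x\in[0,1]:|m_{s,K}(x)|>\alpha\}|\le c\,\alpha^{-1/(1-s)}$ for all $\alpha>0$.
   Context: For $s>1/2$ the series defining $m_{s,K}$ (grouped by the value of $N(\mathfrak{a})$) converges in $L^2[0,1]$. A function $g$ on $[0,1]$ is of weak-type $L^r[0,1]$ ($r>0$) if $|\{x\in[0,1]:|g(x)|>\alpha\}|\le c\,\alpha^{-r}$ for all $\alpha>0$, with $c$ independent of $\alpha$. *)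

theory Defs
  imports "HOL-Analysis.Analysis" "HOL-Computational_Algebra.Squarefree"
begin

definition fund_disc :: "int \<Rightarrow> bool" where
  "fund_disc D \<longleftrightarrow> D \<noteq> 1 \<and>
     ((D mod 4 = 1 \<and> squarefree D) \<or>
      (\<exists>m. D = 4 * m \<and> (m mod 4 = 2 \<or> m mod 4 = 3) \<and> squarefree m))"

text \<open>For D < 0, sqrt D = i * sqrt |D|; the ring of integers of Q(sqrt D) is Z[(D + sqrt D)/2],
  realised as a subring of the complex numbers.\<close>
definition qomega :: "int \<Rightarrow> complex" where
  "qomega D = (of_int D + complex_of_real (sqrt (real_of_int (- D))) * \<i>) / 2"

definition ring_of_integers :: "int \<Rightarrow> complex set" where
  "ring_of_integers D = {of_int a + of_int b * qomega D | a b. True}"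

definition int_ideal :: "int \<Rightarrow> complex set \<Rightarrow> bool" where
  "int_ideal D I \<longleftrightarrow> I \<subseteq> ring_of_integers D \<and> 0 \<in> I \<and>
     (\<forall>x\<in>I. \<forall>y\<in>I. x + y \<in> I) \<and> (\<forall>x\<in>I. - x \<in> I) \<and>
     (\<forall>r\<in>ring_of_integers D. \<forall>x\<in>I. r * x \<in> I)"

definition ideal_norm :: "int \<Rightarrow> complex set \<Rightarrow> nat" where
  "ideal_norm D I = card {{x + y | y. y \<in> I} | x. x \<in> ring_of_integers D}"

definition ideal_count :: "int \<Rightarrow> nat \<Rightarrow> nat" where
  "ideal_count D n = card {I. int_ideal D I \<and> I \<noteq> {0} \<and> ideal_norm D I = n}"

text \<open>Partial sums of m_{s,K}, grouped by the value of the norm.\<close>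
definition m_partial :: "int \<Rightarrow> real \<Rightarrow> nat \<Rightarrow> real \<Rightarrow> complex" where
  "m_partial D s N x = (\<Sum>n=1..N. of_nat (ideal_count D n) *
       exp (- 2 * of_real pi * \<i> * of_real x * of_nat n) / of_real (real n powr s))"

end

theory Submission
  imports Defs
begin

text \<open>
  Write \<open>r(n)\<close> for the number of ideals of norm \<open>n\<close> and \<open>e(y) = exp(2 pi i y)\<close>.  By the Mellin
  transform, \<open>Gamma(s) m(x)\<close> is the integral of \<open>t^(s-1) Theta(t, x)\<close> over \<open>t > 0\<close>, where
  \<open>Theta(t, x) = sum r(n) exp(-n t) e(-n x)\<close>.

  Every nonzero ideal is \<open>\<alpha> L\<close> with \<open>L\<close> in a finite set of modules containing the ring of integers, and \<open>\<alpha>\<close>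
  ranges over a lattice modulo units.  Hence \<open>Theta\<close> is, up to a constant, a finite combination of products of two
  one-dimensional theta sums over arithmetic progressions.  Weyl differencing of each of them gives,
  for \<open>t \<approx> H^(-2)\<close>, the bound \<open>\<bar>Theta\<bar> \<lesssim> H + V_H(c x)\<close> with a fixed integer \<open>c\<close> and
  \<open>V_H(x) = sum_{h \<le> H} min(H, 1 / \<parallel>h x\<parallel>)\<close>, apart from rapidly decaying contributions of larger \<open>H\<close>.

  Dirichlet approximation \<open>\<bar>x - a/q\<bar> \<le> 1/(2 q H)\<close> bounds the terms of \<open>V_H\<close> with \<open>q\<close> not dividing \<open>h\<close> by
  \<open>O(H log H)\<close>, and summing over \<open>q\<close> the measure of the sets where the other terms are large shows that
  \<open>V_H > L\<close> on a set of measure \<open>O(H^2 / L^2)\<close> once \<open>L\<close> exceeds a multiple of \<open>H log H\<close>.  There is no logarithmic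
  loss in this estimate, and as \<open>1/(1-s) > 2\<close> it can be summed over dyadic \<open>H\<close>, whereas \<open>V_H \<le> H^2\<close> suffices for small \<open>H\<close>.
  This gives the weak-type bound for truncations of the Mellin integral, uniformly in the truncation.
  As \<open>1/(1-s) > 2\<close>, the weak-type bound contains an \<open>L^2\<close> bound; by Parseval it yields the
  square summability of \<open>r(n) / n^s\<close>, hence the \<open>L^2\<close> convergence of the series, and passes to the limit.
\<close>

section \<open>A truncated reciprocal distance to the integers\<close>

text \<open>With \<open>Q = 4 powr (1 - s)\<close> one has \<open>Q powr (1/(1-s)) = 4\<close>, so
  the claim is that the series exceeds a constant times \<open>Q^I\<close> only on a set of measure
  \<open>O(4^(-I))\<close>, for every natural \<open>I\<close>. The scale \<open>H = 2^i\<close>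
  enters with weight about \<open>4^(-s i)\<close>. At \<open>i = I\<close> everything is tight: the
  trivial bound \<open>V_H <= H^2 = 4^I\<close> contributes exactly \<open>Q^I\<close>, and the
  measure estimate \<open>H^2 / L^2\<close> at \<open>L = 4^I\<close> gives exactly
  \<open>4^(-I)\<close>. A logarithm lost at this one scale would be fatal, hence the care about
  logarithms in the distribution estimate for \<open>V_H\<close>. Away from \<open>i = I\<close>
  there is geometric room: below, the trivial bound is smaller than needed; above,
  \<open>s > 1/2\<close> lets the thresholds outgrow \<open>H log H\<close> and makes the measures
  summable.

  Differencing bounds the square of a one-dimensional theta sum. As Theta combines products of two
  such sums, the inequality of arithmetic and geometric means bounds it by the first power of
  \<open>H + V_H\<close>. No cancellation between classes, progressions or scales is used.\<close>

definition circ_gap :: "real \<Rightarrow> real" where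
  "circ_gap y = cmod (1 - cis (2 * pi * y))"

lemma circ_gap_nonneg [simp]: "0 \<le> circ_gap y"
  by (simp add: circ_gap_def)

lemma circ_gap_eq_sin: "circ_gap y = 2 * \<bar>sin (pi * y)\<bar>"
proof -
  have "(circ_gap y)\<^sup>2 = (1 - cos (2 * pi * y))\<^sup>2 + (sin (2 * pi * y))\<^sup>2"
    by (simp add: circ_gap_def cmod_power2)
  also have "\<dots> = 2 - 2 * cos (2 * pi * y)"
    using sin_cos_squared_add[of "2 * pi * y"] by (simp add: power2_eq_square algebra_simps)
  also have "cos (2 * pi * y) = 1 - 2 * (sin (pi * y))\<^sup>2"
    using cos_double_sin[of "pi * y"] by (simp add: mult.assoc)
  finally have "(circ_gap y)\<^sup>2 = (2 * \<bar>sin (pi * y)\<bar>)\<^sup>2"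
    by (simp add: power_mult_distrib)
  then show ?thesis
    by (rule power2_eq_imp_eq) simp_all
qed

lemma continuous_circ_gap [continuous_intros]:
  fixes f :: "real \<Rightarrow> real"
  shows "continuous_on S f \<Longrightarrow> continuous_on S (\<lambda>x. circ_gap (f x))"
  unfolding circ_gap_eq_sin by (intro continuous_intros)

lemma circ_gap_add_int: "circ_gap (y + of_int n) = circ_gap y"
proof -
  have "cis (2 * pi * (y + of_int n)) = cis (2 * pi * y) * cis (2 * pi * of_int n)"
    by (simp only: cis_mult distrib_left)
  also have "cis (2 * pi * of_int n) = 1"
    by (rule cis_multiple_2pi) simp
  finally show ?thesis
    by (simp add: circ_gap_def)
qed

lemma circ_gap_minus: "circ_gap (- y) = circ_gap y"
  by (simp add: circ_gap_eq_sin)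

text \<open>Jordan's inequality: the sine is concave on the half period, so it lies above its chord
  from 0 to \<open>pi / 2\<close>.\<close>

lemma sin_pi_ge:
  assumes "0 \<le> d" "d \<le> 1/2"
  shows "2 * d \<le> sin (pi * d)"
proof -
  have conc: "concave_on {0..pi} sin"
  proof (rule f''_le0_imp_concave)
    show "convex {0..pi}" by simp
    show "(sin has_real_derivative cos x) (at x)" for x
      by (auto intro!: derivative_eq_intros)
    show "(cos has_real_derivative - sin x) (at x)" for x
      by (auto intro!: derivative_eq_intros)
    show "- sin x \<le> 0" if "x \<in> {0..pi}" for x
      using that sin_ge_zero by simp
  qed
  have "(1 - 2 * d) * sin 0 + (2 * d) * sin (pi / 2) \<le> sin ((1 - 2 * d) *\<^sub>R 0 + (2 * d) *\<^sub>R (pi / 2))"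
    by (rule concave_onD[OF conc]) (use assms in auto)
  then show ?thesis
    by (simp add: mult.commute)
qed

text \<open>The chord \<open>circ_gap\<close> replaces the distance to the nearest integer: it is
  the modulus of \<open>1 - z\<close> that Abel summation produces, and it is continuous. Kernels
  are bounded from above, so the lower bound for the chord is the one that matters.\<close>

lemma circ_gap_ge_abs:
  assumes "\<bar>y - of_int n\<bar> \<le> 1/2"
  shows "2 * \<bar>y - of_int n\<bar> \<le> circ_gap y"
proof -
  have "circ_gap y = circ_gap (y - of_int n)"
    using circ_gap_add_int[of "y - of_int n" n] by simp
  also have "\<dots> = circ_gap \<bar>y - of_int n\<bar>"
    using circ_gap_minus[of "y - of_int n"] by (simp add: abs_if)
  finally have "circ_gap y = 2 * \<bar>sin (pi * \<bar>y - of_int n\<bar>)\<bar>"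
    by (simp add: circ_gap_eq_sin)
  with sin_pi_ge[of "\<bar>y - of_int n\<bar>"] assms show ?thesis
    by linarith
qed

lemma circ_gap_ge_between:
  assumes "of_int n + d \<le> y" "y \<le> of_int n + 1 - d"
  shows "2 * d \<le> circ_gap y"
proof (cases "y \<le> of_int n + 1/2 \<or> d < 0")
  case True
  then show ?thesis
    using circ_gap_ge_abs[of y n] assms circ_gap_nonneg[of y] by argo
next
  case False
  then show ?thesis
    using circ_gap_ge_abs[of y "n + 1"] assms by (simp only: of_int_add of_int_1) argo
qed

lemma circ_gap_mult_le: "circ_gap (real d * y) \<le> real d * circ_gap y"
proof -
  have "circ_gap (real d * y) = cmod (1 ^ d - cis (2 * pi * y) ^ d)"
    by (simp add: circ_gap_def Complex.DeMoivre mult_ac)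
  also have "\<dots> \<le> real d * cmod (1 - cis (2 * pi * y))"
    by (rule norm_power_diff) auto
  finally show ?thesis
    by (simp add: circ_gap_def)
qed

text \<open>This is \<open>min H (1 / circ_gap y)\<close>, written so that the case \<open>circ_gap y = 0\<close> gives \<open>H\<close>.\<close>
definition circ_kernel :: "real \<Rightarrow> real \<Rightarrow> real" where
  "circ_kernel H y = 1 / max (1 / H) (circ_gap y)"

definition kernel_sum :: "nat \<Rightarrow> real \<Rightarrow> real" where
  "kernel_sum H x = (\<Sum>h=1..H. circ_kernel H (real h * x))"

lemma circ_kernel_denom_pos: "H > 0 \<Longrightarrow> 0 < max (1 / H) (circ_gap y)"
  by (simp add: less_max_iff_disj)

lemma circ_kernel_nonneg: "H > 0 \<Longrightarrow> 0 \<le> circ_kernel H y"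
  using circ_kernel_denom_pos[of H y] by (simp add: circ_kernel_def)

lemma circ_kernel_le_inverse:
  assumes "0 < d" "d \<le> max (1 / H) (circ_gap y)"
  shows "circ_kernel H y \<le> 1 / d"
  unfolding circ_kernel_def using assms by (intro divide_left_mono) auto

lemma circ_kernel_le: "H > 0 \<Longrightarrow> circ_kernel H y \<le> H"
  using circ_kernel_le_inverse[of "1 / H" H y] by simp

lemma circ_kernel_mono:
  assumes "0 < H" "H \<le> H'"
  shows "circ_kernel H y \<le> circ_kernel H' y"
proof -
  have "1 / H' \<le> 1 / H" using assms by (simp add: frac_le)
  then have "max (1 / H') (circ_gap y) \<le> max (1 / H) (circ_gap y)" by auto
  then show ?thesis
    unfolding circ_kernel_def[of H'] using assms
    by (simp add: circ_kernel_def frac_le circ_kernel_denom_pos)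
qed

text \<open>Weyl differencing produces a cutoff that is a constant multiple of \<open>2 ^ j\<close>;
  this returns to the dyadic cutoff at the price of that constant.\<close>

lemma circ_kernel_scale_le:
  assumes "H > 0" "C \<ge> 1"
  shows "circ_kernel (C * H) y \<le> C * circ_kernel H y"
proof -
  have "max (1 / H) (circ_gap y) \<le> C * max (1 / (C * H)) (circ_gap y)"
  proof (rule max.boundedI)
    show "1 / H \<le> C * max (1 / (C * H)) (circ_gap y)"
      using mult_left_mono[of "1 / (C * H)" "max (1 / (C * H)) (circ_gap y)" C] assms by auto
    show "circ_gap y \<le> C * max (1 / (C * H)) (circ_gap y)"
      using mult_mono[of 1 C "circ_gap y" "max (1 / (C * H)) (circ_gap y)"] assms by auto
  qed
  then have "max (1 / H) (circ_gap y) / C \<le> max (1 / (C * H)) (circ_gap y)"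
    using assms by (simp add: field_simps)
  then have "circ_kernel (C * H) y \<le> 1 / (max (1 / H) (circ_gap y) / C)"
    using assms circ_kernel_denom_pos[of H y] by (intro circ_kernel_le_inverse) auto
  then show ?thesis
    by (simp add: circ_kernel_def)
qed

text \<open>The chord of \<open>d * y\<close> is at most \<open>d\<close> times the chord of
  \<open>y\<close>. This lets the different frequencies of the theta sums be moved to one common
  multiple.\<close>

lemma circ_kernel_mult_le:
  assumes "H > 0" "d > 0"
  shows "circ_kernel H y \<le> real d * circ_kernel H (real d * y)"
proof -
  have "max (1 / H) (circ_gap (real d * y)) \<le> real d * max (1 / H) (circ_gap y)"
  proof (rule max.boundedI)
    show "1 / H \<le> real d * max (1 / H) (circ_gap y)"
      using mult_mono[of 1 "real d" "1 / H" "max (1 / H) (circ_gap y)"] assms by auto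
    show "circ_gap (real d * y) \<le> real d * max (1 / H) (circ_gap y)"
      using circ_gap_mult_le[of d y] mult_left_mono[of "circ_gap y" "max (1 / H) (circ_gap y)" "real d"]
      by auto
  qed
  then have "max (1 / H) (circ_gap (real d * y)) / real d \<le> max (1 / H) (circ_gap y)"
    using assms by (simp add: field_simps)
  then have "circ_kernel H y \<le> 1 / (max (1 / H) (circ_gap (real d * y)) / real d)"
    using assms circ_kernel_denom_pos[of H "real d * y"] by (intro circ_kernel_le_inverse) auto
  then show ?thesis
    by (simp add: circ_kernel_def)
qed

lemma kernel_sum_nonneg: "0 \<le> kernel_sum H x"
  unfolding kernel_sum_def by (cases "H = 0") (auto intro!: sum_nonneg circ_kernel_nonneg)

lemma kernel_sum_le: "kernel_sum H x \<le> (real H)\<^sup>2"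
proof (cases "H = 0")
  case False
  then have "kernel_sum H x \<le> (\<Sum>h=1..H. real H)"
    unfolding kernel_sum_def by (intro sum_mono circ_kernel_le) auto
  then show ?thesis by (simp add: power2_eq_square)
qed (simp add: kernel_sum_def)

lemma continuous_kernel_sum: "continuous_on UNIV (\<lambda>x. kernel_sum H (c * x))"
proof (cases "H = 0")
  case False
  then have "max (1 / real H) (circ_gap y) \<noteq> 0" for y
    using circ_kernel_denom_pos[of "real H" y] by simp
  then show ?thesis
    unfolding kernel_sum_def circ_kernel_def by (intro continuous_intros) auto
qed (simp add: kernel_sum_def)

lemma superlevel_fmeasurable:
  fixes h :: "real \<Rightarrow> real"
  assumes "continuous_on UNIV h"
  shows "{x \<in> {0..1}. h x > a} \<in> fmeasurable lborel"
proof (rule fmeasurableI2)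
  show "{0..1::real} \<in> fmeasurable lborel" by (auto intro!: fmeasurable_compact)
  have "open {x. a < h x}" using assms by (intro open_Collect_less continuous_on_const)
  then have "{0..1} \<inter> {x. a < h x} \<in> sets borel" by (intro sets.Int) auto
  moreover have "{x \<in> {0..1}. h x > a} = {0..1} \<inter> {x. a < h x}" by blast
  ultimately show "{x \<in> {0..1}. h x > a} \<in> sets lborel" by (simp only: sets_lborel)
qed auto

text \<open>Comparison with an integral, term by term: by the mean value theorem each increment of
  \<open>n powr (1 - p)\<close> is at least \<open>1 - p\<close> times the corresponding term, and
  the increments telescope.\<close>

lemma sum_powr_le:
  assumes "0 \<le> p" "p < 1"
  shows "(\<Sum>k=1..n. real k powr (- p)) \<le> real n powr (1 - p) / (1 - p)"
proof (induction n)
  case (Suc n)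
  have "real (Suc n) powr (- p) * (1 - p) \<le> real (Suc n) powr (1 - p) - real n powr (1 - p)"
  proof (cases "n = 0")
    case True
    then show ?thesis using assms by simp
  next
    case False
    have "\<exists>z>real n. z < real (Suc n) \<and> real (Suc n) powr (1 - p) - real n powr (1 - p)
            = (real (Suc n) - real n) * ((1 - p) * z powr (1 - p - 1))"
      using False by (intro MVT2) (auto intro!: derivative_eq_intros)
    then obtain z where z: "real n < z" "z < real (Suc n)"
      "real (Suc n) powr (1 - p) - real n powr (1 - p) = (1 - p) * z powr (- p)"
      by auto
    have "real (Suc n) powr (- p) \<le> z powr (- p)"
      using z False assms by (intro powr_mono2') auto
    then show ?thesis using z assms by (simp add: mult.commute mult_left_mono)
  qed
  then have "real (Suc n) powr (- p) \<le> (real (Suc n) powr (1 - p) - real n powr (1 - p)) / (1 - p)"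
    using assms by (subst pos_le_divide_eq) auto
  then have "real (Suc n) powr (- p) \<le> real (Suc n) powr (1 - p) / (1 - p) - real n powr (1 - p) / (1 - p)"
    by (simp only: diff_divide_distrib)
  then show ?case using Suc by simp
qed (use assms in auto)

lemma harm_le_one_plus_ln:
  assumes "n > 0"
  shows "(\<Sum>k=1..n. 1 / real k) \<le> 1 + ln (real n)"
  using assms
proof (induction n rule: nat_induct_non_zero)
  case (Suc n)
  have "1 / real (Suc n) \<le> ln (real (Suc n)) - ln (real n)"
  proof -
    have "ln (real n / real (Suc n)) \<le> real n / real (Suc n) - 1"
      using Suc.hyps by (intro ln_le_minus_one) auto
    then show ?thesis
      using Suc.hyps by (simp add: ln_div field_simps)
  qed
  then show ?case using Suc by simp
qed simp

section \<open>Distribution of the kernel sums\<close>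

text \<open>As \<open>h * a\<close> is congruent to the nonzero \<open>r\<close> modulo
  \<open>q\<close>, the fraction \<open>h * a / q\<close> keeps a distance of at least
  \<open>min r (q - r) / q\<close> from the integers. Replacing \<open>a / q\<close> by
  \<open>x\<close> moves it by at most \<open>1 / (2 * q)\<close>, because \<open>h <= H\<close>,
  and so at most halves this distance.\<close>

lemma kernel_le_residue:
  fixes a m :: int and q r h H :: nat
  assumes q: "q > 0" and r: "0 < r" "r < q" and hH: "h \<le> H"
    and close: "\<bar>real q * x - of_int a\<bar> < 1 / (2 * real H)"
    and ha: "int h * a = int q * m + int r"
  shows "circ_kernel H (real h * x) \<le> real q / real r + real q / real (q - r)"
proof -
  have H: "H > 0" using close by (cases "H = 0") auto
  have eq: "real q * (real h * x) - (real q * of_int m + real r) = real h * (real q * x - of_int a)"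
  proof -
    have "real h * of_int a = real q * of_int m + real r"
      using arg_cong[OF ha, of real_of_int] by simp
    then show ?thesis by (simp add: algebra_simps)
  qed
  have "\<bar>real h * (real q * x - of_int a)\<bar> \<le> real H * (1 / (2 * real H))"
    unfolding abs_mult using close hH by (intro mult_mono) auto
  then have near: "\<bar>real q * (real h * x) - (real q * of_int m + real r)\<bar> \<le> 1/2"
    using H unfolding eq by simp
  define d where "d = min (real r) (real (q - r)) / (2 * real q)"
  have d: "d > 0" using r q by (simp add: d_def)
  have "real q * d \<le> real r / 2" "real q * d \<le> real (q - r) / 2"
    using q by (auto simp: d_def min_def field_simps)
  moreover have "real r \<ge> 1" "real (q - r) \<ge> 1" "real (q - r) = real q - real r"
    using r by auto
  ultimately have "real q * (of_int m + d) \<le> real q * (real h * x)"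
    "real q * (real h * x) \<le> real q * (of_int m + 1 - d)"
    using near by (simp_all add: algebra_simps abs_if split: if_splits)
  then have "of_int m + d \<le> real h * x" "real h * x \<le> of_int m + 1 - d"
    using q by simp_all
  then have "2 * d \<le> circ_gap (real h * x)"
    by (rule circ_gap_ge_between)
  then have "circ_kernel H (real h * x) \<le> 1 / (2 * d)"
    using d by (intro circ_kernel_le_inverse) auto
  also have "1 / (2 * d) = real q / min (real r) (real (q - r))"
    using q by (simp add: d_def field_simps)
  also have "\<dots> \<le> real q / real r + real q / real (q - r)"
    by (auto simp: min_def)
  finally show ?thesis .
qed

text \<open>In a block of \<open>q\<close> consecutive \<open>h\<close> each nonzero residue class
  occurs once among the \<open>h * a\<close>, as \<open>a\<close> is invertible modulo
  \<open>q\<close>. The pair of \<open>h div q\<close> and \<open>h mod q\<close> identifies block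
  and class, and \<open>{1..H}\<close> meets at most \<open>H div q + 1\<close> blocks.\<close>

lemma sum_residues_le:
  fixes F :: "nat \<Rightarrow> real" and a :: int and q H :: nat
  assumes q: "q > 0" and cop: "coprime a (int q)" and F: "\<And>r. 0 \<le> F r"
  shows "(\<Sum>h | h \<in> {1..H} \<and> \<not> q dvd h. F (nat (int h * a mod int q)))
           \<le> (real (H div q) + 1) * (\<Sum>r=1..<q. F r)"
proof -
  let ?g = "\<lambda>r. nat (int r * a mod int q)"
  have modq: "?g (h mod q) = ?g h" for h
    by (simp add: zmod_int mod_mult_left_eq)
  have perm: "(\<Sum>r=1..<q. F (?g r)) = (\<Sum>r=1..<q. F r)"
  proof -
    have inj: "inj_on ?g {1..<q}"
    proof (rule inj_onI)
      fix r r' assume r: "r \<in> {1..<q}" "r' \<in> {1..<q}" and eq: "?g r = ?g r'"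
      have "int r * a mod int q = int r' * a mod int q"
        using eq q by (metis nat_eq_iff2 pos_mod_sign of_nat_0_less_iff int_nat_eq)
      then have "int q dvd (int r - int r') * a"
        by (metis left_diff_distrib mod_eq_dvd_iff)
      then have "int q dvd int r - int r'"
        using cop by (metis coprime_commute coprime_dvd_mult_left_iff)
      then have "int r mod int q = int r' mod int q"
        by (simp add: mod_eq_dvd_iff)
      then show "r = r'" using r by simp
    qed
    have sub: "?g ` {1..<q} \<subseteq> {1..<q}"
    proof
      fix y assume "y \<in> ?g ` {1..<q}"
      then obtain r where r: "r \<in> {1..<q}" "y = ?g r" by auto
      have "int r * a mod int q \<noteq> 0"
      proof
        assume "int r * a mod int q = 0"
        then have "int q dvd int r * a" by auto
        then have "int q dvd int r"
          using cop by (metis coprime_commute coprime_dvd_mult_left_iff)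
        then show False using r by (auto dest: dvd_imp_le)
      qed
      moreover have "0 \<le> int r * a mod int q" "int r * a mod int q < int q" using q by auto
      ultimately show "y \<in> {1..<q}" using r(2) by auto
    qed
    have "?g ` {1..<q} = {1..<q}"
      using sub inj by (intro card_subset_eq) (auto simp: card_image)
    then show ?thesis
      using sum.reindex[OF inj, of F] by (simp add: o_def)
  qed
  have "(\<Sum>h | h \<in> {1..H} \<and> \<not> q dvd h. F (?g h))
      = (\<Sum>p\<in>(\<lambda>h. (h div q, h mod q)) ` {h. h \<in> {1..H} \<and> \<not> q dvd h}. F (?g (snd p)))"
  proof (subst sum.reindex)
    show "inj_on (\<lambda>h. (h div q, h mod q)) {h \<in> {1..H}. \<not> q dvd h}"
      by (rule inj_onI) (metis Pair_inject div_mult_mod_eq)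
  qed (auto simp: o_def modq)
  also have "\<dots> \<le> (\<Sum>p\<in>{..H div q} \<times> {1..<q}. F (?g (snd p)))"
  proof (rule sum_mono2)
    show "(\<lambda>h. (h div q, h mod q)) ` {h \<in> {1..H}. \<not> q dvd h} \<subseteq> {..H div q} \<times> {1..<q}"
      using q by (auto simp: div_le_mono Suc_le_eq mod_greater_zero_iff_not_dvd)
  qed (auto simp: F)
  also have "\<dots> = (\<Sum>b\<in>{..H div q}. \<Sum>r=1..<q. F (?g r))"
    by (subst sum.cartesian_product) (simp add: split_def)
  also have "\<dots> = (real (H div q) + 1) * (\<Sum>r=1..<q. F r)"
    by (simp only: perm) simp
  finally show ?thesis .
qed

text \<open>The multiples of the denominator \<open>q\<close> are kept as they stand, being the only
  source of very large values. Every other \<open>h\<close> sees a nonzero residue modulo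
  \<open>q\<close>, and together these cost only a harmonic sum.\<close>

lemma kernel_sum_le_major:
  fixes H :: nat and x :: real
  assumes H: "H > 0"
  obtains q :: nat and a :: int where "q > 0" "\<bar>real q * x - of_int a\<bar> < 1 / (2 * real H)"
    "kernel_sum H x \<le> 12 * real H * (1 + ln (real H)) + (\<Sum>k=1..H div q. circ_kernel H (real k * (real q * x)))"
proof -
  \<comment> \<open>Denominators up to \<open>2 * H\<close> buy the error
    \<open>1 / (2 * H)\<close>, which after multiplication by \<open>h <= H\<close> is at most half
    the unit gap between residues.\<close>
  obtain a k where ak: "coprime a k" "0 < k" "k \<le> int (2 * H)"
      "\<bar>of_int k * x - of_int a\<bar> < 1 / real (2 * H)"
    using Dirichlet_approx_coprime[of "2 * H" x] H by auto
  define q where "q = nat k"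
  have k: "k = int q" using ak(2) by (simp add: q_def)
  have q: "q > 0" "q \<le> 2 * H" "coprime a (int q)" and close: "\<bar>real q * x - of_int a\<bar> < 1 / (2 * real H)"
    using ak by (simp_all add: k)
  define F where "F r = real q / real r + real q / real (q - r)" for r
  have F: "0 \<le> F r" for r by (simp add: F_def)
  have res: "circ_kernel H (real h * x) \<le> F (nat (int h * a mod int q))"
    if h: "h \<in> {1..H}" "\<not> q dvd h" for h
    unfolding F_def
  proof (rule kernel_le_residue)
    let ?r = "int h * a mod int q"
    have "?r \<noteq> 0"
    proof
      assume "?r = 0"
      then have "int q dvd int h"
        using q(3) by (metis mod_0_imp_dvd coprime_commute coprime_dvd_mult_left_iff)
      then show False using h by simp
    qed
    moreover have "0 \<le> ?r" "?r < int q" using q by auto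
    ultimately show "0 < nat ?r" "nat ?r < q" by linarith+
    show "int h * a = int q * (int h * a div int q) + int (nat ?r)"
      using q by simp
  qed (use h q close in auto)
  have F_sum: "(\<Sum>r=1..<q. F r) \<le> 2 * real q * (1 + ln (real q))"
  proof -
    have refl: "(\<Sum>r=1..<q. real q / real (q - r)) = (\<Sum>r=1..<q. real q / real r)"
      by (rule sum.reindex_bij_witness[of _ "\<lambda>r. q - r" "\<lambda>r. q - r"]) auto
    have "(\<Sum>r=1..<q. real q / real r) \<le> (\<Sum>r=1..q. real q / real r)"
      by (intro sum_mono2) auto
    also have "\<dots> = real q * (\<Sum>r=1..q. 1 / real r)"
      by (simp add: sum_distrib_left)
    also have "\<dots> \<le> real q * (1 + ln (real q))"
      by (intro mult_left_mono harm_le_one_plus_ln) (use q in auto)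
    finally show ?thesis
      unfolding F_def sum.distrib refl by simp
  qed
  have "(\<Sum>h | h \<in> {1..H} \<and> \<not> q dvd h. circ_kernel H (real h * x))
      \<le> (\<Sum>h | h \<in> {1..H} \<and> \<not> q dvd h. F (nat (int h * a mod int q)))"
    by (intro sum_mono res) auto
  also have "\<dots> \<le> (real (H div q) + 1) * (\<Sum>r=1..<q. F r)"
    by (rule sum_residues_le) (use q F in auto)
  also have "\<dots> \<le> (real (H div q) + 1) * (2 * real q * (1 + ln (real q)))"
    by (intro mult_left_mono F_sum) auto
  also have "\<dots> = 2 * (real (H div q * q) + real q) * (1 + ln (real q))"
    by (simp add: algebra_simps)
  \<comment> \<open>From \<open>q <= 2 * H\<close>: the bracket is at most \<open>H + 2 * H\<close>,
    and \<open>ln 2 < 1\<close> gives the factor 2 on the logarithmic part. In total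
    \<open>12 = 2 * 3 * 2\<close>.\<close>
  also have "\<dots> \<le> 2 * (3 * real H) * (2 * (1 + ln (real H)))"
  proof (rule mult_mono)
    have "real (H div q * q) \<le> real H" by (simp add: div_times_less_eq_dividend del: of_nat_mult)
    moreover have "real q \<le> 2 * real H" using q by linarith
    ultimately show "2 * (real (H div q * q) + real q) \<le> 2 * (3 * real H)" by simp
    have "ln (real q) \<le> ln (2 * real H)"
      using q H by (subst ln_le_cancel_iff) linarith+
    also have "\<dots> = ln 2 + ln (real H)" using H by (simp add: ln_mult)
    also have "ln 2 \<le> (1::real)" using ln_2_less_1 by simp
    finally have "ln (real q) \<le> 1 + ln (real H)" by simp
    moreover have "0 \<le> ln (real H)" using H by simp
    ultimately show "1 + ln (real q) \<le> 2 * (1 + ln (real H))" by simp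
  qed (use q in auto)
  finally have nonmult: "(\<Sum>h | h \<in> {1..H} \<and> \<not> q dvd h. circ_kernel H (real h * x)) \<le> 12 * real H * (1 + ln (real H))"
    by (simp add: algebra_simps)
  have mult: "(\<Sum>h | h \<in> {1..H} \<and> q dvd h. circ_kernel H (real h * x))
      = (\<Sum>k=1..H div q. circ_kernel H (real k * (real q * x)))"
    by (rule sum.reindex_bij_witness[of _ "\<lambda>k. k * q" "\<lambda>h. h div q"])
       (use q in \<open>auto simp: div_le_mono less_eq_div_iff_mult_less_eq mult_ac elim!: dvdE\<close>)
  have "kernel_sum H x = (\<Sum>h | h \<in> {1..H} \<and> q dvd h. circ_kernel H (real h * x))
      + (\<Sum>h | h \<in> {1..H} \<and> \<not> q dvd h. circ_kernel H (real h * x))"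
    unfolding kernel_sum_def by (subst sum.union_disjoint[symmetric]) (auto intro!: sum.cong)
  with nonmult mult have "kernel_sum H x \<le> 12 * real H * (1 + ln (real H)) + (\<Sum>k=1..H div q. circ_kernel H (real k * (real q * x)))"
    by simp
  with q close that show ?thesis by blast
qed

text \<open>The set lies in \<open>q + 1 <= 2 * q\<close> intervals of length
  \<open>2 * \<eta> / q\<close>; from \<open>\<eta> = 1/4\<close> on, the whole unit interval will
  do. A measurable cover is all that the later union bound asks for.\<close>

lemma measure_near_multiple_le:
  fixes q :: nat and \<eta> :: real
  assumes q: "q > 0" and \<eta>: "\<eta> \<ge> 0"
  defines "A \<equiv> {x \<in> {0..1}. \<exists>a::int. \<bar>real q * x - of_int a\<bar> \<le> \<eta>}"
  shows "\<exists>B. A \<subseteq> B \<and> B \<in> fmeasurable lborel \<and> measure lborel B \<le> 4 * \<eta>"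
proof (cases "\<eta> < 1/4")
  case False
  have "{0..1::real} \<in> fmeasurable lborel" by (auto intro!: fmeasurable_compact)
  then show ?thesis using False by (intro exI[of _ "{0..1}"]) (auto simp: A_def)
next
  case True
  define I where "I a = {(real a - \<eta>) / real q .. (real a + \<eta>) / real q}" for a :: nat
  define B where "B = (\<Union>a\<in>{..q}. I a)"
  have I: "I a \<in> fmeasurable lborel" for a
    unfolding I_def by (auto intro!: fmeasurable_compact)
  have "A \<subseteq> B"
  proof
    fix x assume "x \<in> A"
    then obtain a :: int where x: "0 \<le> x" "x \<le> 1" and a: "\<bar>real q * x - of_int a\<bar> \<le> \<eta>"
      by (auto simp: A_def)
    have "real q * x \<le> real q" "0 \<le> real q * x" using x q by (auto simp: mult_left_le)
    then have "of_int a > (-1::real)" "of_int a < real q + 1"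
      using a True by linarith+
    then have a': "0 \<le> a" "a \<le> int q" by linarith+
    have "x \<in> I (nat a)"
      using a q a' by (auto simp: I_def field_simps abs_if split: if_splits)
    then show "x \<in> B" using a' by (auto simp: B_def intro!: bexI[of _ "nat a"])
  qed
  moreover have "B \<in> fmeasurable lborel"
    unfolding B_def using I by (intro fmeasurable.finite_UN) auto
  moreover have "measure lborel B \<le> 4 * \<eta>"
  proof -
    have "measure lborel B \<le> (\<Sum>a\<in>{..q}. measure lborel (I a))"
      unfolding B_def by (intro measure_UNION_le) (use I in \<open>auto simp: fmeasurable_def\<close>)
    also have "measure lborel (I a) = 2 * \<eta> / real q" for a
      unfolding I_def using q \<eta> by (subst measure_lborel_Icc) (auto simp: field_simps)
    then have "(\<Sum>a\<in>{..q}. measure lborel (I a)) = (real q + 1) * (2 * \<eta> / real q)" by simp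
    also have "\<dots> \<le> (2 * real q) * (2 * \<eta> / real q)"
      using q \<eta> by (intro mult_right_mono) auto
    also have "\<dots> = 4 * \<eta>" using q by simp
    finally show ?thesis .
  qed
  ultimately show ?thesis by blast
qed

text \<open>As \<open>L\<close> is at least twice the minor term \<open>12 * H * (1 + ln H)\<close>,
  the multiples of \<open>q\<close> must contribute more than \<open>L / 2\<close>, which forces
  \<open>q * c * x\<close> to be very near an integer. At a distance \<open>y > 0\<close> the kernel
  at the \<open>k\<close>-th multiple is at most \<open>H\<close> and at most
  \<open>1 / (k * y)\<close>; the geometric mean of these bounds with exponents 1/4 and 3/4 avoids
  the harmonic sum and its logarithm. Any second exponent strictly between 1/2 and 1 would give the
  same order \<open>H^2 / L^2\<close>: above 1/2 the measures summed over \<open>q\<close> are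
  governed by the largest \<open>q\<close>, again without a logarithm.\<close>

theorem measure_kernel_sum_gt_le:
  fixes H c :: nat and L :: real
  assumes H: "H > 0" and c: "c > 0" and L: "L \<ge> 24 * real H * (1 + ln (real H))"
  shows "measure lborel {x \<in> {0..1}. kernel_sum H (real c * x) > L} \<le> 200 * (real H)\<^sup>2 / L\<^sup>2"
proof -
  have "0 < 24 * real H * (1 + ln (real H))" using H by (simp add: add_pos_nonneg)
  then have L0: "L > 0" using L by linarith
  \<comment> \<open>With the trivial bound \<open>H\<close> for each kernel the multiples of
    \<open>q\<close> contribute at most \<open>H^2 / q\<close>; exceeding \<open>L / 2\<close>
    requires \<open>q < 2 * H^2 / L\<close>.\<close>
  define Q where "Q = nat \<lfloor>2 * (real H)\<^sup>2 / L\<rfloor>"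
  \<comment> \<open>The bound \<open>y <= E * q powr (-1/3)\<close> solves
    \<open>L / 2 < 4 * H^(1/4) * (H / q)^(1/4) * y^(-3/4)\<close>. Here
    \<open>4 = 1 / (1 - 3/4)\<close> comes from the power sum, and
    \<open>16 = 8 powr (4/3)\<close>.\<close>
  define E where "E = 16 * real H powr (2/3) * L powr (-4/3)"
  define \<eta> where "\<eta> q = E * real q powr (-1/3)" for q :: nat
  define A where "A q = {x \<in> {0..1}. \<exists>a::int. \<bar>real (q * c) * x - of_int a\<bar> \<le> \<eta> q}" for q :: nat
  have "\<exists>B. A q \<subseteq> B \<and> B \<in> fmeasurable lborel \<and> measure lborel B \<le> 4 * \<eta> q" if "q > 0" for q
    unfolding A_def by (rule measure_near_multiple_le) (use that c in \<open>auto simp: \<eta>_def E_def\<close>)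
  then obtain B where B: "\<And>q. q > 0 \<Longrightarrow> A q \<subseteq> B q" "\<And>q. q > 0 \<Longrightarrow> B q \<in> fmeasurable lborel"
    "\<And>q. q > 0 \<Longrightarrow> measure lborel (B q) \<le> 4 * \<eta> q"
    by metis
  have cover: "{x \<in> {0..1}. kernel_sum H (real c * x) > L} \<subseteq> (\<Union>q\<in>{1..Q}. B q)"
  proof
    fix x assume "x \<in> {x \<in> {0..1}. kernel_sum H (real c * x) > L}"
    then have x: "x \<in> {0..1}" and V: "kernel_sum H (real c * x) > L" by auto
    obtain q a where q: "q > 0" and close: "\<bar>real q * (real c * x) - of_int a\<bar> < 1 / (2 * real H)" and
      le: "kernel_sum H (real c * x) \<le> 12 * real H * (1 + ln (real H))
          + (\<Sum>k=1..H div q. circ_kernel H (real k * (real q * (real c * x))))"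
      using kernel_sum_le_major[OF H, of "real c * x"] by metis
    define P where "P = (\<Sum>k=1..H div q. circ_kernel H (real k * (real q * (real c * x))))"
    define y where "y = \<bar>real q * (real c * x) - of_int a\<bar>"
    have P: "P > L / 2" using le V L unfolding P_def by simp
    have div: "real (H div q) \<le> real H / real q"
      using q div_times_less_eq_dividend[of H q] by (simp add: le_divide_eq flip: of_nat_mult)
    have "P \<le> (\<Sum>k=1..H div q. real H)"
      unfolding P_def using H by (intro sum_mono circ_kernel_le) auto
    also have "\<dots> = real (H div q) * real H" by simp
    also have "\<dots> \<le> real H / real q * real H"
      using div by (rule mult_right_mono) auto
    finally have "P \<le> (real H)\<^sup>2 / real q" by (simp add: power2_eq_square)
    then have "L / 2 < (real H)\<^sup>2 / real q" using P by linarith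
    then have "real q < 2 * (real H)\<^sup>2 / L" using q L0 by (simp add: field_simps)
    then have qQ: "q \<in> {1..Q}" using q unfolding Q_def by (auto simp: le_nat_iff le_floor_iff)
    have "y \<le> \<eta> q"
    proof (cases "y = 0")
      case True
      then show ?thesis by (simp add: \<eta>_def E_def)
    next
      case False
      then have y: "y > 0" by (simp add: y_def)
      have kern: "circ_kernel H (real k * (real q * (real c * x)))
          \<le> real H powr (1/4) * y powr (-3/4) * real k powr (- (3/4))"
        if k: "k \<in> {1..H div q}" for k
      proof -
        have "k * q \<le> H" using k q by (simp add: less_eq_div_iff_mult_less_eq)
        then have "k \<le> H" using q by (metis le_trans mult.right_neutral mult_le_mono2 Suc_leI One_nat_def)
        have diff: "\<bar>real k * (real q * (real c * x)) - of_int (int k * a)\<bar> = real k * y"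
        proof -
          have "real k * (real q * (real c * x)) - of_int (int k * a) = real k * (real q * (real c * x) - of_int a)"
            by (simp add: algebra_simps)
          then show ?thesis by (simp only: abs_mult y_def abs_of_nat)
        qed
        have "real k * y \<le> real H * (1 / (2 * real H))"
          using close \<open>k \<le> H\<close> unfolding y_def by (intro mult_mono) auto
        then have "real k * y \<le> 1/2" using H by simp
        then have "2 * (real k * y) \<le> circ_gap (real k * (real q * (real c * x)))"
          using circ_gap_ge_abs[of "real k * (real q * (real c * x))" "int k * a"] diff by simp
        moreover have ky: "0 < real k * y" using k y by simp
        ultimately have "circ_kernel H (real k * (real q * (real c * x))) \<le> 1 / (real k * y)"
          by (intro circ_kernel_le_inverse) (auto simp: le_max_iff_disj)
        moreover have "circ_kernel H (real k * (real q * (real c * x))) \<le> real H"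
          using H by (intro circ_kernel_le) auto
        moreover define K where "K = circ_kernel H (real k * (real q * (real c * x)))"
        ultimately have K: "K \<le> 1 / (real k * y)" "K \<le> real H" "0 \<le> K"
          using H by (auto simp: circ_kernel_nonneg)
        have "K = K powr (1/4) * K powr (3/4)"
          using K by (simp flip: powr_add)
        also have "\<dots> \<le> real H powr (1/4) * (1 / (real k * y)) powr (3/4)"
          using K by (intro mult_mono powr_mono2) auto
        also have "(1 / (real k * y)) powr (3/4) = (real k * y) powr (-(3/4))"
          using ky by (simp add: powr_minus_divide powr_divide)
        also have "\<dots> = y powr (-(3/4)) * real k powr (-(3/4))"
          using y by (simp add: powr_mult)
        finally show ?thesis unfolding K_def by simp
      qed
      have "P \<le> (\<Sum>k=1..H div q. real H powr (1/4) * y powr (-3/4) * real k powr (- (3/4)))"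
        unfolding P_def by (intro sum_mono kern)
      also have "\<dots> = real H powr (1/4) * y powr (-3/4) * (\<Sum>k=1..H div q. real k powr (- (3/4)))"
        by (simp add: sum_distrib_left)
      also have "\<dots> \<le> real H powr (1/4) * y powr (-3/4) * (real (H div q) powr (1/4) / (1/4))"
        using sum_powr_le[of "3/4" "H div q"] by (intro mult_left_mono) auto
      also have "\<dots> \<le> real H powr (1/4) * y powr (-3/4) * ((real H / real q) powr (1/4) / (1/4))"
        using div by (intro mult_left_mono divide_right_mono powr_mono2) auto
      finally have "L / 2 < 4 * real H powr (1/4) * (real H / real q) powr (1/4) * y powr (-3/4)"
        using P by (simp add: mult_ac)
      also have "4 * real H powr (1/4) * (real H / real q) powr (1/4) = 4 * real H powr (1/2) * real q powr (-1/4)"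
        using H q by (simp add: powr_divide powr_minus_divide flip: powr_add)
      finally have "y powr (3/4) * L < 8 * real H powr (1/2) * real q powr (-1/4)"
      proof -
        assume "L / 2 < 4 * real H powr (1/2) * real q powr (-1/4) * y powr (-3/4)"
        then have "L < (8 * real H powr (1/2) * real q powr (-1/4)) * y powr (-3/4)" by simp
        then have "L * y powr (3/4) < (8 * real H powr (1/2) * real q powr (-1/4)) * y powr (-3/4) * y powr (3/4)"
          using y by (intro mult_strict_right_mono) auto
        also have "\<dots> = 8 * real H powr (1/2) * real q powr (-1/4)"
          using y by (simp add: mult.assoc flip: powr_add)
        finally show ?thesis by (simp add: mult.commute)
      qed
      then have "y powr (3/4) < 8 * real H powr (1/2) * real q powr (-1/4) / L"
        using L0 by (simp only: pos_less_divide_eq)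
      moreover have "L powr (-1) = 1 / L" using L0 by (simp add: powr_minus_divide)
      ultimately have "y powr (3/4) < 8 * real H powr (1/2) * real q powr (-1/4) * L powr (-1)"
        by simp
      then have "(y powr (3/4)) powr (4/3) \<le> (8 * real H powr (1/2) * real q powr (-1/4) * L powr (-1)) powr (4/3)"
        by (intro powr_mono2) auto
      also have "\<dots> = 8 powr (4/3) * real H powr (2/3) * real q powr (-1/3) * L powr (-4/3)"
        using H L0 q by (simp add: powr_mult powr_divide powr_powr powr_minus_divide)
      also have "(8::real) powr (4/3) = 16"
      proof -
        have "(8::real) powr (4/3) = (2 powr 3) powr (4/3)" by simp
        also have "\<dots> = 2 powr 4" by (simp only: powr_powr) simp
        finally show ?thesis by simp
      qed
      finally show ?thesis using y by (simp add: powr_powr \<eta>_def E_def mult_ac)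
    qed
    then have "x \<in> A q" using x unfolding A_def y_def by (auto simp: mult.assoc intro!: exI[of _ a])
    then show "x \<in> (\<Union>q\<in>{1..Q}. B q)" using B(1)[OF q] qQ by blast
  qed
  have meas: "{x \<in> {0..1}. kernel_sum H (real c * x) > L} \<in> sets lborel"
    by (intro fmeasurableD superlevel_fmeasurable continuous_kernel_sum)
  have "measure lborel {x \<in> {0..1}. kernel_sum H (real c * x) > L} \<le> measure lborel (\<Union>q\<in>{1..Q}. B q)"
    by (rule measure_mono_fmeasurable[OF cover meas]) (auto intro!: fmeasurable.finite_UN B)
  also have "\<dots> \<le> (\<Sum>q\<in>{1..Q}. measure lborel (B q))"
    using B(2) by (intro measure_UNION_le) (auto simp: fmeasurable_def)
  also have "\<dots> \<le> (\<Sum>q\<in>{1..Q}. 4 * \<eta> q)"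
    by (intro sum_mono B) auto
  also have "\<dots> = 4 * E * (\<Sum>q=1..Q. real q powr (- (1/3)))"
    by (simp add: \<eta>_def sum_distrib_left mult_ac)
  also have "\<dots> \<le> 4 * E * (real Q powr (2/3) / (2/3))"
    using sum_powr_le[of "1/3" Q] by (intro mult_left_mono) (auto simp: E_def)
  also have "\<dots> \<le> 4 * E * ((2 * (real H)\<^sup>2 / L) powr (2/3) / (2/3))"
  proof (intro mult_left_mono divide_right_mono powr_mono2)
    show "real Q \<le> 2 * (real H)\<^sup>2 / L" using L0 unfolding Q_def by simp
  qed (auto simp: E_def)
  also have "(2 * (real H)\<^sup>2 / L) powr (2/3) = 2 powr (2/3) * real H powr (4/3) * L powr (- 2/3)"
    using H L0 by (simp add: powr_divide powr_mult powr_powr powr_minus_divide flip: powr_numeral)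
  also have "4 * E * (2 powr (2/3) * real H powr (4/3) * L powr (- 2/3) / (2/3))
     = 96 * 2 powr (2/3) * (real H powr (2/3) * real H powr (4/3)) * (L powr (- 4/3) * L powr (- 2/3))"
    by (simp add: E_def)
  also have "real H powr (2/3) * real H powr (4/3) = (real H)\<^sup>2"
    using H by (simp flip: powr_add)
  also have "L powr (- 4/3) * L powr (- 2/3) = 1 / L\<^sup>2"
  proof -
    have "L powr (- 4/3) * L powr (- 2/3) = L powr (-2)" by (simp flip: powr_add)
    also have "\<dots> = 1 / L\<^sup>2" using L0 by (simp add: powr_minus_divide)
    finally show ?thesis .
  qed
  \<comment> \<open>Here \<open>96 = 4 * 16 / (2/3)\<close>, and \<open>2 powr (2/3)\<close> is
    estimated by 2.\<close>
  also have "96 * 2 powr (2/3) * (real H)\<^sup>2 * (1 / L\<^sup>2) \<le> 200 * (real H)\<^sup>2 * (1 / L\<^sup>2)"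
  proof (intro mult_right_mono)
    have "(2::real) powr (2/3) \<le> 2 powr 1" by (intro powr_mono) auto
    then show "96 * 2 powr (2/3) \<le> (200::real)" by simp
  qed auto
  finally show ?thesis by simp
qed

section \<open>Weyl differencing of Gaussian sums\<close>

text \<open>Abel summation: the factor \<open>1 - z\<close> leaves the differences of
  \<open>u\<close>, which are nonnegative and telescope. The product form avoids a division and
  stays meaningful at \<open>z = 1\<close>.\<close>

lemma abel_sum_bound:
  fixes u :: "nat \<Rightarrow> real" and z :: complex
  assumes dec: "antimono u" and nonneg: "\<And>k. 0 \<le> u k" and z: "cmod z = 1"
  shows "cmod (1 - z) * cmod (\<Sum>k<M. of_real (u k) * z ^ k) \<le> 2 * u 0"
proof (cases M)
  case (Suc m)
  have id: "(1 - z) * (\<Sum>k<Suc m. of_real (u k) * z ^ k)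
     = of_real (u 0) - (\<Sum>k<m. of_real (u k - u (Suc k)) * z ^ Suc k) - of_real (u m) * z ^ Suc m" for m
    by (induction m) (simp_all add: algebra_simps)
  have "cmod (\<Sum>k<m. of_real (u k - u (Suc k)) * z ^ Suc k) \<le> (\<Sum>k<m. u k - u (Suc k))"
  proof (rule sum_norm_le)
    fix k
    have "u (Suc k) \<le> u k" using dec by (simp add: antimonoD)
    then show "cmod (of_real (u k - u (Suc k)) * z ^ Suc k) \<le> u k - u (Suc k)"
      by (simp add: norm_mult norm_power z del: of_real_diff power_Suc)
  qed
  also have "\<dots> = u 0 - u m" by (rule sum_lessThan_telescope')
  finally have "cmod (\<Sum>k<m. of_real (u k - u (Suc k)) * z ^ Suc k) \<le> u 0 - u m" .
  moreover have "cmod (of_real (u m) * z ^ Suc m) = u m" "cmod (of_real (u 0)) = u 0"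
    using nonneg by (simp_all add: norm_mult norm_power z del: power_Suc)
  moreover have "cmod (of_real (u 0) - (\<Sum>k<m. of_real (u k - u (Suc k)) * z ^ Suc k) - of_real (u m) * z ^ Suc m)
     \<le> cmod (of_real (u 0)) + cmod (\<Sum>k<m. of_real (u k - u (Suc k)) * z ^ Suc k) + cmod (of_real (u m) * z ^ Suc m)"
    by (meson norm_triangle_ineq4 order_trans add_right_mono)
  ultimately show ?thesis
    unfolding Suc norm_mult[symmetric] id by linarith
qed (use nonneg in auto)

text \<open>The square is a double sum over pairs. \<open>E\<close> keeps the pairs with
  \<open>i <= k\<close>, diagonal included, so twice its real part exceeds the square by the
  diagonal sum; grouping by the difference \<open>h\<close> gives the correlations.\<close>

lemma weyl_differencing:
  fixes f :: "nat \<Rightarrow> complex"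
  shows "(cmod (\<Sum>k<N. f k))\<^sup>2 \<le> 2 * (\<Sum>h<N. cmod (\<Sum>k<N-h. f (k + h) * cnj (f k)))"
proof -
  define E where "E N = (\<Sum>k<N. \<Sum>i\<le>k. f k * cnj (f i))" for N
  have sq: "(cmod (S + z))\<^sup>2 = (cmod S)\<^sup>2 + 2 * Re (z * cnj S) + (cmod z)\<^sup>2" for S z
    unfolding cmod_power2 by (simp add: power2_eq_square algebra_simps)
  have re: "Re (z * cnj (S + z)) = Re (z * cnj S) + (cmod z)\<^sup>2" for S z
    unfolding cmod_power2 by (simp add: power2_eq_square algebra_simps)
  have "(cmod (\<Sum>k<N. f k))\<^sup>2 \<le> 2 * Re (E N)"
  proof (induction N)
    case (Suc N)
    let ?S = "\<Sum>k<N. f k"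
    have ar: "Q + 2 * r + z \<le> 2 * (e + (r + z))" if "Q \<le> 2 * e" "0 \<le> z" for Q r z e :: real
      using that by simp
    have "(cmod (?S + f N))\<^sup>2 = (cmod ?S)\<^sup>2 + 2 * Re (f N * cnj ?S) + (cmod (f N))\<^sup>2"
      by (rule sq)
    moreover have "E (Suc N) = E N + f N * cnj (?S + f N)"
      by (simp add: E_def sum_distrib_left algebra_simps lessThan_Suc_atMost[symmetric])
    moreover have "Re (f N * cnj (?S + f N)) = Re (f N * cnj ?S) + (cmod (f N))\<^sup>2"
      by (rule re)
    moreover have "(\<Sum>k<Suc N. f k) = ?S + f N" by simp
    ultimately show ?case using Suc zero_le_power2[of "cmod (f N)"] by (simp only: plus_complex.sel ar)
  qed (simp add: E_def)
  also have "Re (E N) \<le> cmod (E N)" by (rule complex_Re_le_cmod)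
  also have "E N = (\<Sum>(i,j)\<in>{(i,j). i + j < N}. f (i + j) * cnj (f i))"
    unfolding E_def by (subst sum.triangle_reindex) simp
  also have "\<dots> = (\<Sum>(h,k)\<in>Sigma {..<N} (\<lambda>h. {..<N-h}). f (k + h) * cnj (f k))"
    by (rule sum.reindex_bij_witness[of _ "\<lambda>(h,k). (k,h)" "\<lambda>(h,k). (k,h)"]) auto
  also have "\<dots> = (\<Sum>h<N. \<Sum>k<N-h. f (k + h) * cnj (f k))"
    by (rule sum.Sigma[symmetric]) auto
  also have "cmod \<dots> \<le> (\<Sum>h<N. cmod (\<Sum>k<N-h. f (k + h) * cnj (f k)))"
    by (rule norm_sum)
  finally show ?thesis by simp
qed

text \<open>A shift by \<open>h\<close> turns the quadratic phase into a linear one of frequency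
  \<open>h * y\<close>, to which Abel summation applies, while the total mass \<open>S\<close> gives
  the trivial bound; together they make the kernel with cutoff \<open>S\<close>. The shifted weight
  starts at \<open>g h * g 0\<close>, so the decay of \<open>g\<close> survives as a weight in
  \<open>h\<close> and later tames the large \<open>h\<close>.\<close>

lemma weyl_quadratic_sum:
  fixes g :: "nat \<Rightarrow> real" and y v S :: real
  assumes dec: "antimono g" and nonneg: "\<And>k. 0 \<le> g k" and g0: "g 0 \<le> 1"
    and S: "S > 0" "\<And>N. (\<Sum>k<N. g k) \<le> S"
  shows "(cmod (\<Sum>k<N. of_real (g k) * cis (- (pi * y * (real k)\<^sup>2 + v * real k))))\<^sup>2
           \<le> 4 * (\<Sum>h<N. g h * circ_kernel S (real h * y))"
proof -
  define f where "f k = of_real (g k) * cis (- (pi * y * (real k)\<^sup>2 + v * real k))" for k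
  have corr: "cmod (\<Sum>k<N-h. f (k + h) * cnj (f k)) \<le> 2 * (g h * circ_kernel S (real h * y))" for h
  proof -
    define u where "u k = g (k + h) * g k" for k
    define z where "z = cis (2 * pi * (- (real h * y)))"
    have trm: "f (k + h) * cnj (f k) = cis (- (pi * y * (real h)\<^sup>2 + v * real h)) * (of_real (u k) * z ^ k)" for k
    proof -
      have "f (k + h) * cnj (f k) = of_real (u k) * cis (- (pi * y * (real (k + h))\<^sup>2 + v * real (k + h)) + (pi * y * (real k)\<^sup>2 + v * real k))"
        unfolding f_def u_def by (simp only: complex_cnj_mult complex_cnj_complex_of_real cis_cnj minus_minus of_real_mult cis_mult[symmetric] mult_ac)
      also have "- (pi * y * (real (k + h))\<^sup>2 + v * real (k + h)) + (pi * y * (real k)\<^sup>2 + v * real k)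
           = - (pi * y * (real h)\<^sup>2 + v * real h) + real k * (2 * pi * (- (real h * y)))"
        by (simp add: power2_eq_square algebra_simps)
      also have "cis \<dots> = cis (- (pi * y * (real h)\<^sup>2 + v * real h)) * z ^ k"
        unfolding z_def Complex.DeMoivre cis_mult by simp
      finally show ?thesis by (simp only: mult_ac)
    qed
    have decu: "antimono u"
      unfolding u_def using dec nonneg by (intro antimonoI mult_mono) (auto simp: antimonoD)
    have "cmod (\<Sum>k<N-h. f (k + h) * cnj (f k)) = cmod (\<Sum>k<N-h. of_real (u k) * z ^ k)" (is "?c = _")
      unfolding trm sum_distrib_left[symmetric] by (simp add: norm_mult)
    also have "circ_gap (real h * y) * \<dots> \<le> 2 * u 0"
      using abel_sum_bound[OF decu, of z "N - h"] nonneg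
      by (simp add: u_def z_def circ_gap_minus[symmetric, of "real h * y"]) (simp add: circ_gap_def)
    also have "2 * u 0 \<le> 2 * g h"
      using g0 nonneg[of h] by (simp add: u_def mult_left_le)
    finally have gap: "circ_gap (real h * y) * ?c \<le> 2 * g h" .
    have "?c = cmod (\<Sum>k<N-h. of_real (u k) * z ^ k)" by fact
    also have "\<dots> \<le> (\<Sum>k<N-h. u k)"
      by (rule sum_norm_le) (use nonneg in \<open>simp add: norm_mult norm_power z_def u_def\<close>)
    also have "\<dots> \<le> (\<Sum>k<N-h. g h * g k)"
      unfolding u_def using dec nonneg by (intro sum_mono mult_right_mono) (auto simp: antimonoD)
    also have "\<dots> = g h * (\<Sum>k<N-h. g k)" by (simp add: sum_distrib_left)
    also have "\<dots> \<le> g h * S" using S nonneg by (intro mult_left_mono) auto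
    finally have "?c / S \<le> g h" using S(1) by (subst pos_divide_le_eq)
    then have "1 / S * ?c \<le> 2 * g h" using nonneg[of h] by simp
    with gap have "max (1 / S) (circ_gap (real h * y)) * ?c \<le> 2 * g h" by (auto simp: max_def)
    then show ?thesis
      using circ_kernel_denom_pos[OF S(1), of "real h * y"] unfolding circ_kernel_def by (simp add: field_simps)
  qed
  have "(cmod (\<Sum>k<N. f k))\<^sup>2 \<le> 2 * (\<Sum>h<N. cmod (\<Sum>k<N-h. f (k + h) * cnj (f k)))"
    by (rule weyl_differencing)
  also have "\<dots> \<le> 2 * (\<Sum>h<N. 2 * (g h * circ_kernel S (real h * y)))"
    by (intro mult_left_mono sum_mono corr) auto
  finally show ?thesis by (simp add: f_def sum_distrib_left mult_ac)
qed

text \<open>Gaussian weights do not stop at \<open>h = 2 ^ j\<close>. Each \<open>h\<close> is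
  assigned to the first \<open>l\<close> with \<open>h <= 2 ^ (j + l)\<close>, where quadratic decay
  gives a factor \<open>(1/4) ^ l\<close>, and the cutoff is raised to \<open>2 ^ (j + l)\<close> so
  that complete kernel sums appear.\<close>

lemma sum_dyadic_kernel_le:
  fixes g :: "nat \<Rightarrow> real" and C y :: real
  assumes C: "C \<ge> 0" and g: "\<And>h. g h \<le> C" "\<And>h. g h \<le> C * (2 ^ j / real h)\<^sup>2"
  shows "(\<Sum>h=1..<N. g h * circ_kernel (2 ^ j) (real h * y))
     \<le> 4 * C * (\<Sum>l\<le>N. (1/4) ^ l * kernel_sum (2 ^ (j + l)) y)"
proof -
  have gl: "g h \<le> (\<Sum>l\<in>{l. l \<le> N \<and> h \<le> 2 ^ (j + l)}. 4 * C * (1/4) ^ l)" if h: "h \<in> {1..<N}" for h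
  proof -
    define l where "l = (LEAST l. h \<le> 2 ^ (j + l))"
    have "h \<le> 2 ^ h" by (simp add: less_imp_le)
    also have "(2::nat) ^ h \<le> 2 ^ (j + h)" by (rule power_increasing) auto
    finally have ex: "h \<le> 2 ^ (j + h)" .
    have l: "h \<le> 2 ^ (j + l)" "l \<le> h"
      unfolding l_def using ex by (auto intro: LeastI Least_le)
    \<comment> \<open>For \<open>l > 0\<close> minimality gives only
      \<open>h > 2 ^ (j + l - 1)\<close>; the factor 4 pays for this one step.\<close>
    have "g h \<le> 4 * C * (1/4) ^ l"
    proof (cases l)
      case 0
      then show ?thesis using g(1)[of h] C by simp
    next
      case (Suc m)
      have "\<not> h \<le> 2 ^ (j + m)"
        using not_less_Least[of m "\<lambda>l. h \<le> 2 ^ (j + l)"] Suc by (simp add: l_def)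
      then have "real (2 ^ (j + m)) < real h" by (simp only: of_nat_less_iff not_le)
      then have less: "2 ^ j * 2 ^ m < real h" by (simp add: power_add)
      have "2 ^ j / real h \<le> 2 ^ j / (2 ^ j * 2 ^ m)"
        using less by (intro divide_left_mono mult_pos_pos le_less_trans[OF _ less]) auto
      then have "2 ^ j / real h \<le> (1/2) ^ m" by (simp add: power_one_over)
      then have "(2 ^ j / real h)\<^sup>2 \<le> ((1/2) ^ m)\<^sup>2" by (rule power_mono) auto
      also have "\<dots> = (1/4) ^ m" by (simp only: power2_eq_square power_mult_distrib[symmetric]) simp
      finally have "C * (2 ^ j / real h)\<^sup>2 \<le> C * (1/4) ^ m" using C by (rule mult_left_mono)
      then show ?thesis using g(2)[of h] Suc by simp
    qed
    also have "\<dots> \<le> (\<Sum>l\<in>{l. l \<le> N \<and> h \<le> 2 ^ (j + l)}. 4 * C * (1/4) ^ l)"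
      by (rule member_le_sum) (use l h C in auto)
    finally show ?thesis .
  qed
  have "(\<Sum>h=1..<N. g h * circ_kernel (2 ^ j) (real h * y))
      \<le> (\<Sum>h=1..<N. \<Sum>l\<in>{l. l \<le> N \<and> h \<le> 2 ^ (j + l)}. 4 * C * (1/4) ^ l * circ_kernel (2 ^ (j + l)) (real h * y))"
  proof (rule sum_mono)
    fix h assume h: "h \<in> {1..<N}"
    have "g h * circ_kernel (2 ^ j) (real h * y)
       \<le> (\<Sum>l\<in>{l. l \<le> N \<and> h \<le> 2 ^ (j + l)}. 4 * C * (1/4) ^ l) * circ_kernel (2 ^ j) (real h * y)"
      using gl[OF h] by (intro mult_right_mono circ_kernel_nonneg) auto
    also have "\<dots> \<le> (\<Sum>l\<in>{l. l \<le> N \<and> h \<le> 2 ^ (j + l)}. 4 * C * (1/4) ^ l * circ_kernel (2 ^ (j + l)) (real h * y))"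
      unfolding sum_distrib_right using C by (intro sum_mono mult_left_mono circ_kernel_mono) auto
    finally show "g h * circ_kernel (2 ^ j) (real h * y) \<le> \<dots>" .
  qed
  also have "\<dots> = (\<Sum>l\<le>N. \<Sum>h\<in>{h. h \<in> {1..<N} \<and> h \<le> 2 ^ (j + l)}. 4 * C * (1/4) ^ l * circ_kernel (2 ^ (j + l)) (real h * y))"
    using sum.swap_restrict[of "{1..<N}" "{..N}" "\<lambda>h l. 4 * C * (1/4) ^ l * circ_kernel (2 ^ (j + l)) (real h * y)" "\<lambda>h l. h \<le> 2 ^ (j + l)"]
    by simp
  also have "\<dots> \<le> (\<Sum>l\<le>N. \<Sum>h=1..2 ^ (j + l). 4 * C * (1/4) ^ l * circ_kernel (2 ^ (j + l)) (real h * y))"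
    using C by (intro sum_mono sum_mono2) (auto intro!: mult_nonneg_nonneg circ_kernel_nonneg)
  also have "\<dots> = 4 * C * (\<Sum>l\<le>N. (1/4) ^ l * kernel_sum (2 ^ (j + l)) y)"
    by (simp add: kernel_sum_def sum_distrib_left mult_ac)
  finally show ?thesis .
qed

text \<open>On the \<open>m\<close>-th block of \<open>H\<close> consecutive indices
  \<open>(k / H)^2 >= m^2 >= m\<close>, so the blocks are dominated by a geometric series whose
  ratio depends on \<open>w\<close> only.\<close>

lemma sum_exp_square_le:
  fixes w :: real and H :: nat
  assumes w: "w > 0" and H: "H > 0"
  shows "(\<Sum>k<N. exp (- w * (real k / real H)\<^sup>2)) \<le> real H / (1 - exp (- w))"
proof -
  have "(\<Sum>k<N. exp (- w * (real k / real H)\<^sup>2)) \<le> (\<Sum>k<N*H. exp (- w * (real k / real H)\<^sup>2))"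
    using H by (intro sum_mono2) auto
  also have "\<dots> = (\<Sum>m<N. \<Sum>k\<in>{m*H..<m*H+H}. exp (- w * (real k / real H)\<^sup>2))"
    by (rule sum.nat_group[symmetric])
  also have "\<dots> \<le> (\<Sum>m<N. \<Sum>k\<in>{m*H..<m*H+H}. exp (- w) ^ m)"
  proof (intro sum_mono)
    fix m k assume "k \<in> {m*H..<m*H+H}"
    then have "m * H \<le> k" by simp
    then have "real m * real H \<le> real k" by (simp flip: of_nat_mult)
    then have "real m \<le> real k / real H" using H by (simp add: field_simps)
    then have "(real m)\<^sup>2 \<le> (real k / real H)\<^sup>2" by (intro power_mono) auto
    moreover have "real m \<le> (real m)\<^sup>2"
      by (metis of_nat_le_iff of_nat_power le_square power2_eq_square)
    ultimately have "real m \<le> (real k / real H)\<^sup>2" by (rule order_trans[rotated])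
    then have "w * real m \<le> w * (real k / real H)\<^sup>2" using w by (intro mult_left_mono) auto
    then show "exp (- w * (real k / real H)\<^sup>2) \<le> exp (- w) ^ m"
      by (simp add: exp_of_nat_mult[symmetric] mult.commute)
  qed
  also have "\<dots> = real H * (\<Sum>m<N. exp (- w) ^ m)"
    by (simp add: sum_distrib_left)
  also have "\<dots> \<le> real H * (1 / (1 - exp (- w)))"
  proof (intro mult_left_mono)
    have "norm (exp (- w)) < 1" using w by simp
    then have "(\<lambda>m. exp (- w) ^ m) sums (1 / (1 - exp (- w)))" by (rule geometric_sums)
    then show "(\<Sum>m<N. exp (- w) ^ m) \<le> 1 / (1 - exp (- w))"
      by (metis sums_unique sums_summable sum_le_suminf finite_lessThan exp_ge_zero zero_le_power)
  qed auto
  finally show ?thesis by simp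
qed

text \<open>With \<open>n = a + A * k\<close> this is \<open>exp (- w * n^2 * t)\<close> times
  \<open>e(- w * n^2 * x)\<close>: the complex number \<open>t + 2 pi i x\<close> carries damping
  and frequency together.\<close>

definition theta_term :: "real \<Rightarrow> real \<Rightarrow> real \<Rightarrow> real \<Rightarrow> real \<Rightarrow> nat \<Rightarrow> complex" where
  "theta_term w a A t x k = exp (- of_real (w * (a + A * real k)\<^sup>2) * Complex t (2 * pi * x))"

lemma norm_theta_term: "cmod (theta_term w a A t x k) = exp (- (w * (a + A * real k)\<^sup>2 * t))"
  by (simp add: theta_term_def)

lemma norm_theta_term_le:
  assumes "w > 0" "a \<ge> 0" "A \<ge> 1" "t \<ge> (1/4) ^ j"
  shows "cmod (theta_term w a A t x k) \<le> exp (- w * (real k / real (2 ^ j))\<^sup>2)"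
proof -
  have "1 * real k \<le> A * real k" using assms by (intro mult_right_mono) auto
  then have "real k \<le> a + A * real k" using assms by linarith
  then have "(real k)\<^sup>2 \<le> (a + A * real k)\<^sup>2" by (intro power_mono) auto
  then have "w * (real k)\<^sup>2 * (1/4) ^ j \<le> w * (a + A * real k)\<^sup>2 * t"
    using assms by (intro mult_mono) auto
  moreover have "(real k / real (2 ^ j))\<^sup>2 = (real k)\<^sup>2 * (1/4) ^ j"
    by (simp add: power_divide power2_eq_square flip: power_mult_distrib)
  ultimately show ?thesis
    by (simp add: norm_theta_term mult.assoc)
qed

text \<open>What matters is the uniformity: \<open>C\<close> depends on the weight \<open>w\<close>
  alone. For \<open>t >= 4^(-j)\<close> the moduli of the terms form a bump of width
  \<open>2 ^ j\<close>, so that their total mass is \<open>O(2 ^ j)\<close>.\<close>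

lemma theta_sum_bound:
  fixes w :: real
  assumes w: "w > 0"
  obtains C where "C > 0" "\<And>a A j t x N. a \<ge> 0 \<Longrightarrow> A \<ge> 1 \<Longrightarrow> t \<ge> (1/4) ^ j \<Longrightarrow>
    (cmod (\<Sum>k<N. theta_term w a A t x k))\<^sup>2
      \<le> C * (2 ^ j + (\<Sum>l\<le>N. (1/4) ^ l * kernel_sum (2 ^ (j + l)) (2 * w * A\<^sup>2 * x)))"
proof -
  define C1 where "C1 = 1 / (1 - exp (- w))"
  define C2 where "C2 = 1 + 1 / w"
  have C1: "C1 \<ge> 1" using w by (simp add: C1_def)
  have C2: "C2 \<ge> 1" using w by (simp add: C2_def)
  have main: "(cmod (\<Sum>k<N. theta_term w a A t x k))\<^sup>2
      \<le> (16 * C1 * C2) * (2 ^ j + (\<Sum>l\<le>N. (1/4) ^ l * kernel_sum (2 ^ (j + l)) (2 * w * A\<^sup>2 * x)))"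
    if a: "a \<ge> 0" and A: "A \<ge> 1" and t: "t \<ge> (1/4) ^ j" for a A j t x N
  proof -
    define g where "g k = cmod (theta_term w a A t x k)" for k
    \<comment> \<open>The phase has the \<open>k^2\<close> coefficient
      \<open>2 * pi * w * A^2 * x = pi * y\<close>; differencing doubles it, which explains the
      normalisation by \<open>pi\<close> alone.\<close>
    define y where "y = 2 * w * A\<^sup>2 * x"
    have t0: "t > 0" using t by (smt (verit) zero_less_power zero_less_divide_iff)
    have g_exp: "g k \<le> exp (- w * (real k / real (2 ^ j))\<^sup>2)" for k
      unfolding g_def using w a A t by (rule norm_theta_term_le)
    have g0: "0 \<le> g k" for k by (simp add: g_def)
    have g1: "g k \<le> 1" for k
      unfolding g_def norm_theta_term using w t0 by simp
    have dec: "antimono g"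
      unfolding g_def norm_theta_term using w t0 a A
      by (intro antimonoI) (auto intro!: mult_left_mono mult_right_mono power_mono add_nonneg_nonneg)
    have sum: "(\<Sum>k<N. g k) \<le> C1 * 2 ^ j" for N
    proof -
      have "(\<Sum>k<N. g k) \<le> (\<Sum>k<N. exp (- w * (real k / real (2 ^ j))\<^sup>2))"
        by (intro sum_mono g_exp)
      also have "\<dots> \<le> real (2 ^ j) / (1 - exp (- w))" using w by (intro sum_exp_square_le) auto
      finally show ?thesis by (simp add: C1_def)
    qed
    have g2: "g h \<le> C2 * (2 ^ j / real h)\<^sup>2" if "h > 0" for h
    proof -
      let ?z = "w * (real h / real (2 ^ j))\<^sup>2"
      have z: "?z > 0" using w that by simp
      have "?z \<le> exp ?z" using exp_ge_add_one_self[of ?z] by linarith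
      then have "exp (- ?z) \<le> 1 / ?z" using z by (simp add: exp_minus field_simps)
      also have "1 / ?z = 1 / w * (2 ^ j / real h)\<^sup>2" by (simp add: power_divide field_simps)
      also have "\<dots> \<le> C2 * (2 ^ j / real h)\<^sup>2" by (intro mult_right_mono) (auto simp: C2_def)
      finally show ?thesis using g_exp[of h] by simp
    qed
    have trm: "theta_term w a A t x k = cis (- (2 * pi * w * x * a\<^sup>2))
       * (of_real (g k) * cis (- (pi * y * (real k)\<^sup>2 + (4 * pi * w * x * a * A) * real k)))" for k
    proof -
      have "theta_term w a A t x k = of_real (g k) * cis (- (w * (a + A * real k)\<^sup>2 * (2 * pi * x)))"
        unfolding g_def norm_theta_term by (simp add: theta_term_def exp_eq_polar)
      also have "- (w * (a + A * real k)\<^sup>2 * (2 * pi * x))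
           = - (2 * pi * w * x * a\<^sup>2) + (- (pi * y * (real k)\<^sup>2 + (4 * pi * w * x * a * A) * real k))"
        by (simp add: y_def power2_eq_square algebra_simps)
      finally show ?thesis by (simp only: cis_mult[symmetric] mult_ac)
    qed
    have "(cmod (\<Sum>k<N. theta_term w a A t x k))\<^sup>2
        = (cmod (\<Sum>k<N. of_real (g k) * cis (- (pi * y * (real k)\<^sup>2 + (4 * pi * w * x * a * A) * real k))))\<^sup>2"
      unfolding trm sum_distrib_left[symmetric] by (simp add: norm_mult)
    also have "\<dots> \<le> 4 * (\<Sum>h<N. g h * circ_kernel (C1 * 2 ^ j) (real h * y))"
      by (rule weyl_quadratic_sum) (use dec g1 sum C1 in \<open>auto simp: g0\<close>)
    also have "(\<Sum>h<N. g h * circ_kernel (C1 * 2 ^ j) (real h * y))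
        \<le> (\<Sum>h<N. g h * (C1 * circ_kernel (2 ^ j) (real h * y)))"
      using C1 by (intro sum_mono mult_left_mono circ_kernel_scale_le) (auto simp: g_def)
    also have "\<dots> = C1 * (\<Sum>h<N. g h * circ_kernel (2 ^ j) (real h * y))"
      by (simp add: sum_distrib_left mult_ac)
    also have "(\<Sum>h<N. g h * circ_kernel (2 ^ j) (real h * y))
        \<le> (\<Sum>h\<in>insert 0 {1..<N}. g h * circ_kernel (2 ^ j) (real h * y))"
      by (rule sum_mono2) (auto simp: g_def intro!: mult_nonneg_nonneg circ_kernel_nonneg)
    also have "\<dots> = g 0 * circ_kernel (2 ^ j) 0 + (\<Sum>h=1..<N. g h * circ_kernel (2 ^ j) (real h * y))"
      by simp
    also have "\<dots> \<le> 1 * 2 ^ j + 4 * C2 * (\<Sum>l\<le>N. (1/4) ^ l * kernel_sum (2 ^ (j + l)) y)"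
    proof (rule add_mono)
      show "g 0 * circ_kernel (2 ^ j) 0 \<le> 1 * 2 ^ j"
        using g1 by (intro mult_mono circ_kernel_le circ_kernel_nonneg) auto
      \<comment> \<open>At \<open>h = 0\<close> the quotient \<open>2 ^ j / real h\<close> is 0 by
        convention, so the second hypothesis of \<open>sum_dyadic_kernel_le\<close> would force a
        nonpositive weight there. The weight is set to 0 at this index, which lies outside the
        sum.\<close>
      have "(\<Sum>h=1..<N. g h * circ_kernel (2 ^ j) (real h * y))
          = (\<Sum>h=1..<N. (if h = 0 then 0 else g h) * circ_kernel (2 ^ j) (real h * y))"
        by (intro sum.cong) auto
      also have "\<dots> \<le> 4 * C2 * (\<Sum>l\<le>N. (1/4) ^ l * kernel_sum (2 ^ (j + l)) y)"
        by (rule sum_dyadic_kernel_le) (use g1 g2 C2 in \<open>auto intro: order_trans\<close>)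
      finally show "(\<Sum>h=1..<N. g h * circ_kernel (2 ^ j) (real h * y)) \<le> \<dots>" .
    qed
    also have "\<dots> \<le> 4 * C2 * 2 ^ j + 4 * C2 * (\<Sum>l\<le>N. (1/4) ^ l * kernel_sum (2 ^ (j + l)) y)"
      using C2 by (intro add_right_mono mult_right_mono) auto
    finally show ?thesis using C1 by (simp add: y_def distrib_left mult_ac)
  qed
  show ?thesis
    by (rule that[of "16 * C1 * C2"]) (use C1 C2 main in auto)
qed

section \<open>Ideals of an imaginary quadratic order\<close>

definition add_subgroup :: "complex set \<Rightarrow> bool" where
  "add_subgroup G \<longleftrightarrow> 0 \<in> G \<and> (\<forall>x\<in>G. \<forall>y\<in>G. x + y \<in> G) \<and> (\<forall>x\<in>G. - x \<in> G)"

definition add_coset :: "complex set \<Rightarrow> complex \<Rightarrow> complex set" where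
  "add_coset T x = {x + y | y. y \<in> T}"

text \<open>An infinite index has the value 0 by the convention for \<open>card\<close>; for
  nonempty \<open>S\<close>, positivity therefore expresses finiteness.\<close>

definition add_index :: "complex set \<Rightarrow> complex set \<Rightarrow> nat" where
  "add_index S T = card (add_coset T ` S)"

lemma add_subgroup_diff: "add_subgroup G \<Longrightarrow> x \<in> G \<Longrightarrow> y \<in> G \<Longrightarrow> x - y \<in> G"
  unfolding add_subgroup_def by (metis add_uminus_conv_diff)

lemma add_coset_eq_iff:
  assumes "add_subgroup T"
  shows "add_coset T x = add_coset T x' \<longleftrightarrow> x - x' \<in> T"
proof
  assume "add_coset T x = add_coset T x'"
  moreover have "x + 0 \<in> add_coset T x"
    using assms unfolding add_coset_def add_subgroup_def by blast
  ultimately obtain y where "x = x' + y" "y \<in> T" by (auto simp: add_coset_def)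
  then show "x - x' \<in> T" by simp
next
  assume diff: "x - x' \<in> T"
  have "add_coset T u \<subseteq> add_coset T u'" if "u - u' \<in> T" for u u'
  proof
    fix z assume "z \<in> add_coset T u"
    then obtain y where "y \<in> T" "z = u + y" by (auto simp: add_coset_def)
    then have "z = u' + ((u - u') + y)" "(u - u') + y \<in> T"
      using assms that unfolding add_subgroup_def by auto
    then show "z \<in> add_coset T u'" unfolding add_coset_def by blast
  qed
  moreover have "x' - x \<in> T" using diff assms unfolding add_subgroup_def by (metis minus_diff_eq)
  ultimately show "add_coset T x = add_coset T x'" using diff by blast
qed

text \<open>The tower law by an explicit bijection: a coset of \<open>U\<close> in \<open>S\<close>
  is a chosen representative of a coset of \<open>T\<close> plus a coset of \<open>U\<close> in
  \<open>T\<close>. With infinite indices counted as 0 the product formula remains true.\<close>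

lemma add_index_mult:
  assumes S: "add_subgroup S" and T: "add_subgroup T" and U: "add_subgroup U" and sub: "U \<subseteq> T" "T \<subseteq> S"
  shows "add_index S U = add_index S T * add_index T U"
proof -
  define r where "r C = (SOME x. x \<in> S \<and> add_coset T x = C)" for C
  have r: "r C \<in> S \<and> add_coset T (r C) = C" if "C \<in> add_coset T ` S" for C
    unfolding r_def by (rule someI_ex) (use that in auto)
  define f where "f = (\<lambda>(C, B). (\<lambda>y. r C + y) ` B)"
  have f: "f (C, add_coset U t) = add_coset U (r C + t)" for C t
    unfolding f_def add_coset_def by (auto simp: image_iff add.assoc)
  have "bij_betw f (add_coset T ` S \<times> add_coset U ` T) (add_coset U ` S)"
  proof (rule bij_betw_imageI)
    show "inj_on f (add_coset T ` S \<times> add_coset U ` T)"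
    proof (rule inj_onI)
      fix p p' assume p: "p \<in> add_coset T ` S \<times> add_coset U ` T"
        and p': "p' \<in> add_coset T ` S \<times> add_coset U ` T" and eq: "f p = f p'"
      obtain C t where C: "p = (C, add_coset U t)" "C \<in> add_coset T ` S" "t \<in> T" using p by auto
      obtain C' t' where C': "p' = (C', add_coset U t')" "C' \<in> add_coset T ` S" "t' \<in> T" using p' by auto
      have d: "r C + t - (r C' + t') \<in> U"
        using eq add_coset_eq_iff[OF U] by (simp add: C C' f)
      have "r C - r C' = (r C + t - (r C' + t')) + (t' - t)" by simp
      also have "\<dots> \<in> T" using d sub(1) add_subgroup_diff[OF T C'(3) C(3)] T
        unfolding add_subgroup_def by blast
      finally have "C = C'" using add_coset_eq_iff[OF T] r[OF C(2)] r[OF C'(2)] by metis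
      moreover from this d have "t - t' \<in> U" by simp
      ultimately show "p = p'" using add_coset_eq_iff[OF U] C C' by simp
    qed
    show "f ` (add_coset T ` S \<times> add_coset U ` T) = add_coset U ` S"
    proof (intro equalityI subsetI)
      fix B assume "B \<in> f ` (add_coset T ` S \<times> add_coset U ` T)"
      then obtain C t where C: "B = f (C, add_coset U t)" "C \<in> add_coset T ` S" "t \<in> T" by auto
      have "r C + t \<in> S" using r[OF C(2)] C(3) sub S unfolding add_subgroup_def by blast
      then show "B \<in> add_coset U ` S" by (simp add: C f)
    next
      fix B assume "B \<in> add_coset U ` S"
      then obtain x where x: "x \<in> S" "B = add_coset U x" by auto
      let ?C = "add_coset T x"
      have C: "?C \<in> add_coset T ` S" using x by blast
      have "x - r ?C \<in> T" using r[OF C] add_coset_eq_iff[OF T] by metis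
      moreover have "B = f (?C, add_coset U (x - r ?C))" by (simp add: f x)
      ultimately show "B \<in> f ` (add_coset T ` S \<times> add_coset U ` T)" using C by blast
    qed
  qed
  then have "card (add_coset T ` S \<times> add_coset U ` T) = card (add_coset U ` S)"
    by (rule bij_betw_same_card)
  then show ?thesis by (simp add: add_index_def card_cartesian_product)
qed

lemma add_index_image:
  assumes add: "\<And>x y. \<phi> (x + y) = \<phi> x + \<phi> y" and inj: "inj \<phi>"
  shows "add_index (\<phi> ` S) (\<phi> ` T) = add_index S T"
proof -
  have "add_coset (\<phi> ` T) (\<phi> x) = \<phi> ` add_coset T x" for x
    unfolding add_coset_def by (force simp: add image_iff)
  then have "add_coset (\<phi> ` T) ` \<phi> ` S = (`) \<phi> ` (add_coset T ` S)"
    by (simp add: image_image)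
  moreover have "inj_on ((`) \<phi>) (add_coset T ` S)"
    using inj by (meson inj_image_eq_iff inj_onI)
  ultimately show ?thesis by (simp add: add_index_def card_image)
qed

lemma add_index_scale: "\<alpha> \<noteq> 0 \<Longrightarrow> add_index ((*) \<alpha> ` S) ((*) \<alpha> ` T) = add_index S T"
  by (rule add_index_image) (auto simp: algebra_simps inj_on_def)

lemma add_subgroup_scale:
  assumes "add_subgroup G"
  shows "add_subgroup ((*) \<alpha> ` G)"
  unfolding add_subgroup_def
proof (intro conjI ballI)
  show "0 \<in> (*) \<alpha> ` G" using assms by (auto simp: add_subgroup_def image_iff intro!: bexI[of _ 0])
next
  fix x y assume "x \<in> (*) \<alpha> ` G" "y \<in> (*) \<alpha> ` G"
  then obtain u v where "u \<in> G" "v \<in> G" "x = \<alpha> * u" "y = \<alpha> * v" by blast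
  then have "x + y = \<alpha> * (u + v)" "u + v \<in> G"
    using assms by (auto simp: add_subgroup_def distrib_left)
  then show "x + y \<in> (*) \<alpha> ` G" by blast
next
  fix x assume "x \<in> (*) \<alpha> ` G"
  then obtain u where "u \<in> G" "x = \<alpha> * u" by blast
  then have "- x = \<alpha> * (- u)" "- u \<in> G" using assms by (auto simp: add_subgroup_def)
  then show "- x \<in> (*) \<alpha> ` G" by blast
qed

lemma scale_scale: "(*) \<alpha> ` (*) \<beta> ` S = (*) (\<alpha> * \<beta>) ` (S :: complex set)"
  by (simp add: image_image mult.assoc)

section \<open>The quadratic order, its norm and its principal ideals\<close>

locale imag_quad_order =
  fixes D :: int
  assumes D_neg: "D < 0" and D_mod: "D mod 4 = 0 \<or> D mod 4 = 1"
begin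

abbreviation \<omega> :: complex where "\<omega> \<equiv> qomega D"
abbreviation OK :: "complex set" where "OK \<equiv> ring_of_integers D"

text \<open>The norm of \<omega>, the constant term of its minimal equation with trace
  \<open>D\<close>. The residue of \<open>D\<close> modulo 4 makes the division exact.\<close>

definition \<omega>norm :: int where "\<omega>norm = (D * D - D) div 4"

lemma \<omega>norm: "4 * \<omega>norm = D * D - D"
proof -
  have "4 dvd D * (D - 1)"
  proof (cases "D mod 4 = 0")
    case False
    then have "D mod 4 = 1 mod 4" using D_mod by simp
    then have "4 dvd D - 1" by (simp only: mod_eq_dvd_iff)
    then show ?thesis by (rule dvd_mult)
  qed (auto intro: dvd_mult2)
  then show ?thesis by (simp add: \<omega>norm_def algebra_simps)
qed

lemma Re_\<omega>: "Re \<omega> = of_int D / 2" and Im_\<omega>: "Im \<omega> = sqrt (of_int (- D)) / 2"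
  by (simp_all add: qomega_def)

lemma Im_\<omega>_pos: "Im \<omega> > 0"
  using D_neg by (simp add: Im_\<omega>)

lemma \<omega>_square: "\<omega> * \<omega> = of_int D * \<omega> - of_int \<omega>norm"
proof -
  have s: "sqrt (of_int (- D)) * sqrt (of_int (- D)) = - of_int D"
    using D_neg by simp
  have n: "real_of_int \<omega>norm = (of_int D * of_int D - of_int D) / 4"
    using arg_cong[OF \<omega>norm, of real_of_int] by simp
  show ?thesis
    by (rule complex_eqI) (use s in \<open>simp_all add: Re_\<omega> Im_\<omega> n field_simps\<close>)
qed

lemma cnj_\<omega>: "cnj \<omega> = of_int D - \<omega>"
  by (rule complex_eqI) (simp_all add: Re_\<omega>)

lemma OK_iff: "z \<in> OK \<longleftrightarrow> (\<exists>a b::int. z = of_int a + of_int b * \<omega>)"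
  by (auto simp: ring_of_integers_def)

lemma OK_I [intro]: "of_int a + of_int b * \<omega> \<in> OK"
  by (auto simp: OK_iff)

lemma OK_coords_unique:
  assumes "of_int a + of_int b * \<omega> = of_int a' + of_int b' * \<omega>"
  shows "a = a' \<and> b = b'"
proof -
  have "of_int b * Im \<omega> = of_int b' * Im \<omega>"
    using arg_cong[OF assms, of Im] by simp
  then have "b = b'" using Im_\<omega>_pos by simp
  with assms show ?thesis by simp
qed

lemma OK_of_int [simp]: "of_int n \<in> OK"
  using OK_I[of n 0] by simp

lemma OK_of_nat [simp]: "of_nat n \<in> OK"
  using OK_of_int[of "int n"] by simp

lemma OK_0 [simp]: "0 \<in> OK" and OK_1 [simp]: "1 \<in> OK"
  using OK_of_int[of 0] OK_of_int[of 1] by simp_all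

lemma OK_add: "x \<in> OK \<Longrightarrow> y \<in> OK \<Longrightarrow> x + y \<in> OK"
proof -
  assume "x \<in> OK" "y \<in> OK"
  then obtain a b a' b' where "x = of_int a + of_int b * \<omega>" "y = of_int a' + of_int b' * \<omega>"
    unfolding OK_iff by blast
  then have "x + y = of_int (a + a') + of_int (b + b') * \<omega>" by (simp add: algebra_simps)
  then show ?thesis by (simp only: OK_I)
qed

lemma OK_mult: "x \<in> OK \<Longrightarrow> y \<in> OK \<Longrightarrow> x * y \<in> OK"
proof -
  assume "x \<in> OK" "y \<in> OK"
  then obtain a b a' b' where "x = of_int a + of_int b * \<omega>" "y = of_int a' + of_int b' * \<omega>"
    unfolding OK_iff by blast
  then have "x * y = of_int a * of_int a' + (of_int a * of_int b' + of_int b * of_int a') * \<omega> + of_int b * of_int b' * (\<omega> * \<omega>)"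
    by (simp add: algebra_simps)
  also have "\<dots> = of_int (a * a' - b * b' * \<omega>norm) + of_int (a * b' + b * a' + b * b' * D) * \<omega>"
    unfolding \<omega>_square by (simp add: algebra_simps)
  finally show ?thesis by (simp only: OK_I)
qed

lemma OK_minus: "x \<in> OK \<Longrightarrow> - x \<in> OK"
  using OK_mult[of "of_int (-1)" x] OK_of_int[of "-1"] by simp

lemma add_subgroup_OK: "add_subgroup OK"
  by (simp add: add_subgroup_def OK_add OK_minus)

lemma OK_cnj: "x \<in> OK \<Longrightarrow> cnj x \<in> OK"
proof -
  assume "x \<in> OK"
  then obtain a b where "x = of_int a + of_int b * \<omega>" unfolding OK_iff by blast
  then have "cnj x = of_int (a + b * D) + of_int (- b) * \<omega>"
    by (simp add: cnj_\<omega> algebra_simps)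
  then show ?thesis by (simp only: OK_I)
qed

lemma cnj_image_OK: "cnj ` OK = OK"
proof (intro equalityI subsetI)
  fix x assume "x \<in> OK"
  then have "cnj (cnj x) \<in> cnj ` OK" by (intro imageI OK_cnj)
  then show "x \<in> cnj ` OK" by simp
qed (auto simp: OK_cnj)

lemma OK_norm_nat:
  assumes "x \<in> OK"
  obtains n :: nat where "x * cnj x = of_nat n" "(cmod x)\<^sup>2 = real n"
proof -
  obtain a b where x: "x = of_int a + of_int b * \<omega>" using assms unfolding OK_iff by blast
  have "x * cnj x = of_int a * of_int a + of_int a * of_int b * of_int D + of_int b * of_int b * (of_int D * \<omega> - \<omega> * \<omega>)"
    by (simp add: x cnj_\<omega> algebra_simps)
  also have "\<dots> = of_int (a * a + a * b * D + b * b * \<omega>norm)"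
    unfolding \<omega>_square by simp
  finally have eq: "x * cnj x = of_int (a * a + a * b * D + b * b * \<omega>norm)" (is "_ = of_int ?n") .
  then have "complex_of_real ((cmod x)\<^sup>2) = of_int ?n" by (simp only: complex_norm_square)
  then have r: "(cmod x)\<^sup>2 = of_int ?n" by (metis of_real_eq_iff of_real_of_int_eq)
  then have "?n \<ge> 0" by (metis of_int_0_le_iff zero_le_power2)
  then show ?thesis
    by (intro that[of "nat ?n"]) (use eq r in auto)
qed

lemma finite_OK_bounded: "finite {z \<in> OK. cmod z \<le> r}"
proof -
  define B where "B = nat \<lceil>r / Im \<omega>\<rceil>"
  define A where "A = nat \<lceil>r + real B * cmod \<omega>\<rceil>"
  have "{z \<in> OK. cmod z \<le> r} \<subseteq> (\<lambda>(a,b). of_int a + of_int b * \<omega>) ` ({- int A..int A} \<times> {- int B..int B})"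
  proof
    fix z assume "z \<in> {z \<in> OK. cmod z \<le> r}"
    then obtain a b where z: "z = of_int a + of_int b * \<omega>" and r: "cmod z \<le> r" unfolding OK_iff by blast
    have "\<bar>Im z\<bar> \<le> r" using r abs_Im_le_cmod[of z] by linarith
    then have "\<bar>of_int b\<bar> * Im \<omega> \<le> r" using Im_\<omega>_pos by (simp add: z abs_mult)
    then have "\<bar>of_int b\<bar> \<le> r / Im \<omega>" using Im_\<omega>_pos by (simp add: field_simps)
    then have "\<bar>real_of_int b\<bar> \<le> real B" unfolding B_def by linarith
    then have b: "\<bar>b\<bar> \<le> int B" by linarith
    have "of_int a = z - of_int b * \<omega>" by (simp add: z)
    then have "cmod (of_int a) \<le> cmod z + cmod (of_int b * \<omega>)" by (metis norm_triangle_ineq4)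
    also have "\<dots> \<le> r + real B * cmod \<omega>"
      using r \<open>\<bar>real_of_int b\<bar> \<le> real B\<close> by (intro add_mono) (auto simp: norm_mult intro!: mult_right_mono)
    finally have "\<bar>real_of_int a\<bar> \<le> real A" unfolding A_def by simp linarith
    then have "\<bar>a\<bar> \<le> int A" by linarith
    with b show "z \<in> (\<lambda>(a,b). of_int a + of_int b * \<omega>) ` ({- int A..int A} \<times> {- int B..int B})"
      by (intro image_eqI[of _ _ "(a, b)"]) (auto simp: z)
  qed
  then show ?thesis by (rule finite_subset) auto
qed

lemma add_index_nat:
  assumes n: "n > 0"
  shows "add_index OK ((*) (of_nat n) ` OK) = n\<^sup>2"
proof -
  let ?T = "(*) (of_nat n) ` OK"
  define f where "f = (\<lambda>(a, b). add_coset ?T (of_int a + of_int b * \<omega>))"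
  have T: "add_subgroup ?T" by (intro add_subgroup_scale add_subgroup_OK)
  have mem: "of_int a + of_int b * \<omega> \<in> ?T \<longleftrightarrow> int n dvd a \<and> int n dvd b" for a b
  proof
    assume "of_int a + of_int b * \<omega> \<in> ?T"
    then obtain x where "x \<in> OK" "of_int a + of_int b * \<omega> = of_nat n * x" by auto
    then obtain c d where "of_int a + of_int b * \<omega> = of_nat n * (of_int c + of_int d * \<omega>)"
      by (auto simp: OK_iff)
    then have "of_int a + of_int b * \<omega> = of_int (int n * c) + of_int (int n * d) * \<omega>"
      by (simp add: algebra_simps)
    from OK_coords_unique[OF this] show "int n dvd a \<and> int n dvd b" by simp
  next
    assume "int n dvd a \<and> int n dvd b"
    then obtain c d where "a = int n * c" "b = int n * d" by (auto elim!: dvdE)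
    then have "of_int a + of_int b * \<omega> = of_nat n * (of_int c + of_int d * \<omega>)"
      by (simp add: algebra_simps)
    then show "of_int a + of_int b * \<omega> \<in> ?T" by (simp only:) (intro imageI OK_I)
  qed
  have f_eq: "f (a, b) = f (a', b') \<longleftrightarrow> int n dvd a - a' \<and> int n dvd b - b'" for a b a' b'
  proof -
    have "of_int a + of_int b * \<omega> - (of_int a' + of_int b' * \<omega>) = of_int (a - a') + of_int (b - b') * \<omega>"
      by (simp add: algebra_simps)
    then show ?thesis unfolding f_def prod.case add_coset_eq_iff[OF T] by (simp only: mem)
  qed
  have "bij_betw f ({0..<int n} \<times> {0..<int n}) (add_coset ?T ` OK)"
  proof (rule bij_betw_imageI)
    show "inj_on f ({0..<int n} \<times> {0..<int n})"
      by (rule inj_onI) (auto simp: f_eq mod_eq_dvd_iff[symmetric])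
    show "f ` ({0..<int n} \<times> {0..<int n}) = add_coset ?T ` OK"
    proof (intro equalityI subsetI)
      fix B assume "B \<in> add_coset ?T ` OK"
      then obtain a b where "B = f (a, b)" unfolding f_def by (auto simp: OK_iff)
      also have "\<dots> = f (a mod int n, b mod int n)"
        by (simp add: f_eq mod_eq_dvd_iff[symmetric])
      finally show "B \<in> f ` ({0..<int n} \<times> {0..<int n})" using n by auto
    qed (auto simp: f_def)
  qed
  then have "card ({0..<int n} \<times> {0..<int n}) = card (add_coset ?T ` OK)"
    by (rule bij_betw_same_card)
  then show ?thesis by (simp add: add_index_def card_cartesian_product power2_eq_square)
qed

text \<open>Multiplicativity of the index and complex conjugation give \<open>[OK : z OK]\<^sup>2 = [OK : z z' OK] = \<bar>z\<bar>\<^sup>4\<close>,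
  where \<open>z'\<close> is the conjugate of \<open>z\<close>.\<close>
lemma add_index_principal:
  assumes z: "z \<in> OK" "z \<noteq> 0"
  shows "real (add_index OK ((*) z ` OK)) = (cmod z)\<^sup>2"
proof -
  obtain n where n: "z * cnj z = of_nat n" "(cmod z)\<^sup>2 = real n" using OK_norm_nat[OF z(1)] .
  have n0: "n > 0" using n z by (metis gr0I of_nat_0 zero_eq_power2 norm_eq_zero)
  have scale_sub: "(*) u ` OK \<subseteq> OK" if "u \<in> OK" for u using that OK_mult by auto
  have zn: "(*) z ` (*) (cnj z) ` OK = (*) (of_nat n) ` OK" by (simp add: scale_scale n)
  have "n\<^sup>2 = add_index OK ((*) z ` (*) (cnj z) ` OK)"
    unfolding zn add_index_nat[OF n0] ..
  also have "\<dots> = add_index OK ((*) z ` OK) * add_index ((*) z ` OK) ((*) z ` (*) (cnj z) ` OK)"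
    by (intro add_index_mult add_subgroup_scale add_subgroup_OK image_mono scale_sub OK_cnj z)
  also have "add_index ((*) z ` OK) ((*) z ` (*) (cnj z) ` OK) = add_index OK ((*) (cnj z) ` OK)"
    by (rule add_index_scale[OF z(2)])
  also have "\<dots> = add_index (cnj ` OK) (cnj ` (*) z ` OK)"
  proof -
    have "cnj ` (*) z ` OK = (*) (cnj z) ` cnj ` OK" by (simp add: image_image)
    then show ?thesis by (simp add: cnj_image_OK)
  qed
  also have "\<dots> = add_index OK ((*) z ` OK)"
    by (rule add_index_image) (auto simp: inj_on_def)
  finally have "n\<^sup>2 = (add_index OK ((*) z ` OK))\<^sup>2" by (simp add: power2_eq_square)
  then have "n = add_index OK ((*) z ` OK)" by simp
  then show ?thesis using n by simp
qed

section \<open>Ideals as multiples of finitely many modules\<close>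

definition OK_module :: "complex set \<Rightarrow> bool" where
  "OK_module L \<longleftrightarrow> add_subgroup L \<and> (\<forall>r\<in>OK. \<forall>x\<in>L. r * x \<in> L)"

lemma int_ideal_iff: "int_ideal D I \<longleftrightarrow> OK_module I \<and> I \<subseteq> OK"
  by (auto simp: int_ideal_def OK_module_def add_subgroup_def)

lemma ideal_norm_eq: "ideal_norm D I = add_index OK I"
  unfolding ideal_norm_def add_index_def add_coset_def by (rule arg_cong[of _ _ card]) auto

lemma OK_module_scale: "OK_module L \<Longrightarrow> OK_module ((*) \<alpha> ` L)"
  unfolding OK_module_def by (auto simp: add_subgroup_scale mult.left_commute)

lemma scale_OK_subset: "OK_module L \<Longrightarrow> x \<in> L \<Longrightarrow> (*) x ` OK \<subseteq> L"
  by (auto simp: OK_module_def mult.commute)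

lemma ideal_index_eq:
  assumes I: "int_ideal D I" and z: "z \<in> I" "z \<noteq> 0"
  shows "real (ideal_norm D I) * real (add_index I ((*) z ` OK)) = (cmod z)\<^sup>2"
proof -
  have m: "OK_module I" "I \<subseteq> OK" using I by (auto simp: int_ideal_iff)
  have "add_index OK ((*) z ` OK) = add_index OK I * add_index I ((*) z ` OK)"
    by (intro add_index_mult add_subgroup_scale add_subgroup_OK scale_OK_subset m z)
       (use m in \<open>auto simp: OK_module_def\<close>)
  then show ?thesis
    using add_index_principal[of z] m z by (auto simp: ideal_norm_eq)
qed

text \<open>An infinite quotient would have norm 0, so this says that nonzero ideals have finite
  index.\<close>

lemma ideal_norm_pos:
  assumes I: "int_ideal D I" "I \<noteq> {0}"
  shows "ideal_norm D I > 0"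
proof -
  obtain z where "z \<in> I" "z \<noteq> 0" using I by (auto simp: int_ideal_def)
  then show ?thesis using ideal_index_eq[OF I(1), of z] by (auto intro!: gr0I)
qed

text \<open>Pigeonhole in place of Minkowski's theorem: with \<open>K\<close> the integer part of
  the root of the norm there are more than \<open>ideal_norm D I\<close> points
  \<open>a + b * \<omega>\<close> with coordinates in \<open>0..K\<close>. Two of them agree modulo
  \<open>I\<close>, and their difference has coordinates bounded by \<open>K\<close>.\<close>

lemma ideal_small_element:
  assumes I: "int_ideal D I" "I \<noteq> {0}"
  obtains \<alpha> where "\<alpha> \<in> I" "\<alpha> \<noteq> 0" "(cmod \<alpha>)\<^sup>2 \<le> (1 + cmod \<omega>)\<^sup>2 * real (ideal_norm D I)"
proof -
  let ?N = "ideal_norm D I"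
  have sg: "add_subgroup I" using I by (auto simp: int_ideal_iff OK_module_def)
  define K where "K = nat \<lfloor>sqrt (real ?N)\<rfloor>"
  have K1: "real K \<le> sqrt (real ?N)" unfolding K_def by simp
  have K2: "sqrt (real ?N) < real K + 1" unfolding K_def by linarith
  have "real ?N < (real K + 1)\<^sup>2"
    using K2 by (metis real_sqrt_ge_zero of_nat_0_le_iff power_strict_mono real_sqrt_pow2 zero_less_numeral)
  also have "\<dots> = real ((K + 1)\<^sup>2)" by simp
  finally have NK: "?N < (K + 1)\<^sup>2" by (simp only: of_nat_less_iff)
  define f where "f = (\<lambda>(a, b). add_coset I (of_int a + of_int b * \<omega>))"
  have fin: "finite (add_coset I ` OK)"
    using ideal_norm_pos[OF I] unfolding ideal_norm_eq add_index_def by (rule card_ge_0_finite)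
  have "\<not> inj_on f ({0..int K} \<times> {0..int K})"
  proof
    assume "inj_on f ({0..int K} \<times> {0..int K})"
    moreover have "f ` ({0..int K} \<times> {0..int K}) \<subseteq> add_coset I ` OK" unfolding f_def by auto
    ultimately have "card ({0..int K} \<times> {0..int K}) \<le> card (add_coset I ` OK)"
      using fin by (rule card_inj_on_le)
    then show False using NK by (simp add: card_cartesian_product ideal_norm_eq add_index_def power2_eq_square nat_add_distrib)
  qed
  then obtain a b a' b' where ab: "a \<in> {0..int K}" "b \<in> {0..int K}" "a' \<in> {0..int K}" "b' \<in> {0..int K}"
     and ne: "(a, b) \<noteq> (a', b')" and eq: "f (a, b) = f (a', b')"
    unfolding inj_on_def by blast
  define \<alpha> where "\<alpha> = of_int (a - a') + of_int (b - b') * \<omega>"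
  have "\<alpha> \<in> I" using eq unfolding f_def prod.case add_coset_eq_iff[OF sg] \<alpha>_def by (simp add: algebra_simps)
  moreover have "\<alpha> \<noteq> 0" using OK_coords_unique[of "a - a'" "b - b'" 0 0] ne by (auto simp: \<alpha>_def)
  moreover have "(cmod \<alpha>)\<^sup>2 \<le> (1 + cmod \<omega>)\<^sup>2 * real ?N"
  proof -
    have "cmod \<alpha> \<le> cmod (of_int (a - a')) + cmod (of_int (b - b') * \<omega>)"
      unfolding \<alpha>_def by (rule norm_triangle_ineq)
    also have "\<dots> = \<bar>of_int (a - a')\<bar> + \<bar>of_int (b - b')\<bar> * cmod \<omega>"
      by (simp add: norm_mult del: of_int_diff)
    also have "\<dots> \<le> real K + real K * cmod \<omega>"
    proof (intro add_mono mult_right_mono)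
      show "\<bar>real_of_int (a - a')\<bar> \<le> real K" "\<bar>real_of_int (b - b')\<bar> \<le> real K" using ab by auto
    qed auto
    also have "\<dots> = (1 + cmod \<omega>) * real K" by (simp add: algebra_simps)
    also have "\<dots> \<le> (1 + cmod \<omega>) * sqrt (real ?N)" using K1 by (intro mult_left_mono) auto
    finally have "(cmod \<alpha>)\<^sup>2 \<le> ((1 + cmod \<omega>) * sqrt (real ?N))\<^sup>2" by (rule power_mono) auto
    then show ?thesis by (simp add: power_mult_distrib)
  qed
  ultimately show ?thesis by (rule that)
qed

definition index_bound :: nat where "index_bound = nat \<lfloor>(1 + cmod \<omega>)\<^sup>2\<rfloor>"

text \<open>The quotients of ideals by an element of nearly minimal norm.\<close>
definition overmodules :: "complex set set" where
  "overmodules = {L. OK_module L \<and> OK \<subseteq> L \<and> 0 < add_index L OK \<and> add_index L OK \<le> index_bound}"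

text \<open>Division of \<open>I\<close> by a short element \<alpha> gives a module that contains
  \<open>OK\<close> because \<alpha> lies in \<open>I\<close>. Its index over \<open>OK\<close> is
  the squared modulus of \<alpha> divided by the norm of \<open>I\<close>, which shortness bounds
  independently of \<open>I\<close>.\<close>

lemma ideal_eq_scaled_overmodule:
  assumes I: "int_ideal D I" "I \<noteq> {0}"
  obtains \<alpha> L where "\<alpha> \<noteq> 0" "L \<in> overmodules" "I = (*) \<alpha> ` L"
proof -
  obtain \<alpha> where \<alpha>: "\<alpha> \<in> I" "\<alpha> \<noteq> 0" and le: "(cmod \<alpha>)\<^sup>2 \<le> (1 + cmod \<omega>)\<^sup>2 * real (ideal_norm D I)"
    using ideal_small_element[OF I] .
  have m: "OK_module I" using I by (auto simp: int_ideal_iff)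
  define L where "L = (*) (inverse \<alpha>) ` I"
  have I_eq: "I = (*) \<alpha> ` L" using \<alpha> by (simp add: L_def scale_scale)
  have "(*) (inverse \<alpha>) ` (*) \<alpha> ` OK \<subseteq> L"
    unfolding L_def by (intro image_mono scale_OK_subset m \<alpha>)
  then have "OK \<subseteq> L" using \<alpha> by (simp add: scale_scale)
  moreover have "OK_module L" unfolding L_def by (intro OK_module_scale m)
  moreover have idx: "add_index I ((*) \<alpha> ` OK) = add_index L OK"
    unfolding I_eq by (rule add_index_scale[OF \<alpha>(2)])
  have N: "real (ideal_norm D I) * real (add_index L OK) = (cmod \<alpha>)\<^sup>2"
    using ideal_index_eq[OF I(1) \<alpha>] idx by simp
  then have "add_index L OK > 0" using \<alpha> by (auto intro!: gr0I)
  moreover have "add_index L OK \<le> index_bound"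
  proof -
    have "real (ideal_norm D I) * real (add_index L OK) \<le> real (ideal_norm D I) * (1 + cmod \<omega>)\<^sup>2"
      using N le by (simp add: mult.commute)
    then have "real (add_index L OK) \<le> (1 + cmod \<omega>)\<^sup>2"
      using ideal_norm_pos[OF I] by simp
    then show ?thesis unfolding index_bound_def by (simp add: le_nat_iff le_floor_iff)
  qed
  ultimately have "L \<in> overmodules" by (simp add: overmodules_def)
  then show ?thesis using that \<alpha>(2) I_eq by blast
qed

definition denom :: nat where "denom = fact index_bound"

lemma denom_pos [simp]: "denom > 0" and denom_nonzero [simp]: "denom \<noteq> 0"
  by (simp_all add: denom_def)

text \<open>There are more multiples \<open>j * x\<close> with \<open>j <= index_bound\<close> than
  cosets of \<open>OK\<close>, so two of them agree modulo \<open>OK\<close>. The difference of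
  their indices divides the factorial \<open>denom\<close>.\<close>

lemma overmodule_denom:
  assumes L: "L \<in> overmodules" and x: "x \<in> L"
  shows "of_nat denom * x \<in> OK"
proof -
  have m: "OK_module L" "OK \<subseteq> L" using L by (auto simp: overmodules_def)
  have fin: "finite (add_coset OK ` L)"
    using L unfolding overmodules_def add_index_def by (auto intro: card_ge_0_finite)
  define f where "f j = add_coset OK (of_nat j * x)" for j :: nat
  have "\<not> inj_on f {..index_bound}"
  proof
    assume "inj_on f {..index_bound}"
    moreover have "f ` {..index_bound} \<subseteq> add_coset OK ` L"
      using m x by (auto simp: f_def OK_module_def)
    ultimately have "card {..index_bound} \<le> card (add_coset OK ` L)"
      using fin by (rule card_inj_on_le)
    then show False using L by (simp add: overmodules_def add_index_def)
  qed
  then obtain i j where ij: "i \<le> index_bound" "j \<le> index_bound" "i \<noteq> j" "f i = f j"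
    unfolding inj_on_def by auto
  have "\<exists>i j. i < j \<and> j \<le> index_bound \<and> f i = f j"
  proof (cases "i < j")
    case False
    then have "j < i" using ij by simp
    then show ?thesis using ij by metis
  qed (use ij in metis)
  then obtain i j where ij: "i < j" "j \<le> index_bound" "f i = f j" by blast
  have "of_nat j * x - of_nat i * x \<in> OK"
    using ij(3)[symmetric] unfolding f_def add_coset_eq_iff[OF add_subgroup_OK] .
  then have d: "of_nat (j - i) * x \<in> OK" using ij(1) by (simp add: of_nat_diff algebra_simps)
  have "j - i dvd denom" unfolding denom_def using ij by (intro dvd_fact) auto
  then obtain c where "denom = c * (j - i)" by (metis dvdE mult.commute)
  then have "of_nat denom * x = of_nat c * (of_nat (j - i) * x)" by (simp add: mult.assoc)
  then show ?thesis using OK_mult[OF OK_of_nat[of c] d] by (simp only:)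
qed

text \<open>Multiplied by \<open>denom\<close>, every overmodule lies between
  \<open>denom * OK\<close> and \<open>OK\<close>, hence is a union of cosets out of a finite
  quotient.\<close>

lemma finite_overmodules: "finite overmodules"
proof -
  let ?B = "of_nat denom :: complex"
  let ?Q = "add_coset ((*) ?B ` OK) ` OK"
  have "finite ?Q"
    using add_index_nat[OF denom_pos] unfolding add_index_def by (intro card_ge_0_finite) simp
  have inj: "inj_on (\<lambda>L. (*) ?B ` L) overmodules"
  proof (rule inj_onI)
    fix L L' :: "complex set" assume "(*) ?B ` L = (*) ?B ` L'"
    moreover have "inj ((*) ?B)" by (simp add: inj_on_def)
    ultimately show "L = L'" by (simp add: inj_image_eq_iff)
  qed
  have "(\<lambda>L. (*) ?B ` L) ` overmodules \<subseteq> Union ` Pow ?Q"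
  proof
    fix M assume "M \<in> (\<lambda>L. (*) ?B ` L) ` overmodules"
    then obtain L where L: "L \<in> overmodules" "M = (*) ?B ` L" by auto
    have M: "add_subgroup M" "(*) ?B ` OK \<subseteq> M" "M \<subseteq> OK"
      using L overmodule_denom by (auto simp: overmodules_def OK_module_def add_subgroup_scale)
    have "M = \<Union> (add_coset ((*) ?B ` OK) ` M)"
    proof (intro equalityI subsetI)
      fix x assume "x \<in> M"
      moreover have "x + ?B * 0 \<in> add_coset ((*) ?B ` OK) x"
        unfolding add_coset_def using OK_0 by blast
      ultimately show "x \<in> \<Union> (add_coset ((*) ?B ` OK) ` M)" by auto
    next
      fix x assume "x \<in> \<Union> (add_coset ((*) ?B ` OK) ` M)"
      then show "x \<in> M" using M unfolding add_coset_def add_subgroup_def by blast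
    qed
    moreover have "add_coset ((*) ?B ` OK) ` M \<in> Pow ?Q" using M by blast
    ultimately show "M \<in> Union ` Pow ?Q" by blast
  qed
  then have "finite ((\<lambda>L. (*) ?B ` L) ` overmodules)"
    by (rule finite_subset) (simp add: \<open>finite ?Q\<close>)
  then show ?thesis using inj by (rule finite_imageD)
qed

section \<open>Homothety classes and the count of ideals by multipliers\<close>

definition homothetic :: "complex set \<Rightarrow> complex set \<Rightarrow> bool" where
  "homothetic L L' \<longleftrightarrow> (\<exists>\<beta>. \<beta> \<noteq> 0 \<and> L' = (*) \<beta> ` L)"

lemma homothetic_refl: "homothetic L L"
  unfolding homothetic_def by (rule exI[of _ 1]) simp

lemma homothetic_sym: "homothetic L L' \<Longrightarrow> homothetic L' L"
  unfolding homothetic_def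
proof (elim exE conjE)
  fix \<beta> :: complex assume "\<beta> \<noteq> 0" "L' = (*) \<beta> ` L"
  then have "inverse \<beta> \<noteq> 0" "L = (*) (inverse \<beta>) ` L'" by (auto simp: scale_scale)
  then show "\<exists>\<beta>. \<beta> \<noteq> 0 \<and> L = (*) \<beta> ` L'" by blast
qed

lemma homothetic_trans: "homothetic L L' \<Longrightarrow> homothetic L' L'' \<Longrightarrow> homothetic L L''"
  unfolding homothetic_def by (metis mult_eq_0_iff scale_scale)

definition class_rep :: "complex set \<Rightarrow> complex set" where
  "class_rep L = (SOME L'. L' \<in> overmodules \<and> homothetic L L')"

definition class_reps :: "complex set set" where "class_reps = class_rep ` overmodules"

lemma class_rep: "L \<in> overmodules \<Longrightarrow> class_rep L \<in> overmodules \<and> homothetic L (class_rep L)"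
  unfolding class_rep_def by (rule someI[of _ L]) (simp add: homothetic_refl)

lemma class_reps_overmodules: "L \<in> class_reps \<Longrightarrow> L \<in> overmodules"
  using class_rep by (auto simp: class_reps_def)

lemma finite_class_reps: "finite class_reps"
  by (simp add: class_reps_def finite_overmodules)

text \<open>The description inside the choice operator depends on the module only through its class,
  so homothetic modules receive the same representative.\<close>

lemma class_reps_unique:
  assumes "L \<in> class_reps" "L' \<in> class_reps" "homothetic L L'"
  shows "L = L'"
proof -
  obtain A A' where A: "A \<in> overmodules" "L = class_rep A" "A' \<in> overmodules" "L' = class_rep A'"
    using assms by (auto simp: class_reps_def)
  then have "homothetic A A'"
    using class_rep assms(3) by (meson homothetic_sym homothetic_trans)
  then have "homothetic A M \<longleftrightarrow> homothetic A' M" for M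
    by (meson homothetic_sym homothetic_trans)
  then show ?thesis by (simp add: A class_rep_def)
qed

lemma ideal_eq_scaled_class_rep:
  assumes I: "int_ideal D I" "I \<noteq> {0}"
  obtains \<alpha> L where "\<alpha> \<noteq> 0" "L \<in> class_reps" "I = (*) \<alpha> ` L"
proof -
  obtain \<alpha> L where L: "\<alpha> \<noteq> 0" "L \<in> overmodules" "I = (*) \<alpha> ` L"
    using ideal_eq_scaled_overmodule[OF I] .
  have "homothetic (class_rep L) L" using class_rep[OF L(2)] homothetic_sym by blast
  then obtain \<beta> where "\<beta> \<noteq> 0" "L = (*) \<beta> ` class_rep L" by (auto simp: homothetic_def)
  then have "\<alpha> * \<beta> \<noteq> 0" "class_rep L \<in> class_reps" "I = (*) (\<alpha> * \<beta>) ` class_rep L"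
    using L by (simp_all add: class_reps_def flip: scale_scale)
  then show ?thesis by (rule that)
qed

text \<open>The colon module \<open>(OK : L)\<close>. For an overmodule \<open>L\<close>, its
  nonzero elements are the scalars that turn \<open>L\<close> into a nonzero integral ideal.\<close>

definition multipliers :: "complex set \<Rightarrow> complex set" where
  "multipliers L = {\<alpha>. (*) \<alpha> ` L \<subseteq> OK}"

definition unit_count :: "complex set \<Rightarrow> nat" where
  "unit_count L = card {u. u \<noteq> 0 \<and> (*) u ` L = L}"

lemma multipliers_subset_OK: "L \<in> overmodules \<Longrightarrow> multipliers L \<subseteq> OK"
proof
  fix \<alpha> assume "L \<in> overmodules" "\<alpha> \<in> multipliers L"
  then have "1 \<in> L" "(*) \<alpha> ` L \<subseteq> OK" using OK_1 by (auto simp: overmodules_def multipliers_def)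
  then have "\<alpha> * 1 \<in> OK" by blast
  then show "\<alpha> \<in> OK" by simp
qed

lemma multipliers_add: "\<alpha> \<in> multipliers L \<Longrightarrow> \<beta> \<in> multipliers L \<Longrightarrow> \<alpha> + \<beta> \<in> multipliers L"
  unfolding multipliers_def by (auto simp: distrib_right image_subset_iff intro!: OK_add)

lemma denom_multiplier:
  assumes "L \<in> overmodules" "r \<in> OK"
  shows "of_nat denom * r \<in> multipliers L"
  unfolding multipliers_def
proof safe
  fix x assume "x \<in> L"
  then have "r * (of_nat denom * x) \<in> OK" using overmodule_denom assms OK_mult by blast
  then show "of_nat denom * r * x \<in> OK" by (simp add: mult_ac)
qed

lemma ideal_scale_multiplier:
  assumes L: "L \<in> overmodules" and \<alpha>: "\<alpha> \<in> multipliers L" "\<alpha> \<noteq> 0"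
  shows "int_ideal D ((*) \<alpha> ` L)" "(*) \<alpha> ` L \<noteq> {0}"
    and "real (ideal_norm D ((*) \<alpha> ` L)) * real (add_index L OK) = (cmod \<alpha>)\<^sup>2"
proof -
  show I: "int_ideal D ((*) \<alpha> ` L)"
    using L \<alpha> unfolding int_ideal_iff by (auto simp: overmodules_def multipliers_def OK_module_scale)
  have "1 \<in> L" using L by (auto simp: overmodules_def)
  then have \<alpha>I: "\<alpha> \<in> (*) \<alpha> ` L" by (metis image_eqI mult.right_neutral)
  then show "(*) \<alpha> ` L \<noteq> {0}" using \<alpha> by blast
  show "real (ideal_norm D ((*) \<alpha> ` L)) * real (add_index L OK) = (cmod \<alpha>)\<^sup>2"
    using ideal_index_eq[OF I \<alpha>I \<alpha>(2)] add_index_scale[OF \<alpha>(2), of L OK] by simp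
qed

lemma finite_multipliers_norm:
  "L \<in> overmodules \<Longrightarrow> finite {\<alpha> \<in> multipliers L. (cmod \<alpha>)\<^sup>2 = r}"
  by (rule finite_subset[OF _ finite_OK_bounded[of "sqrt r"]])
     (use multipliers_subset_OK in \<open>auto simp: real_le_rsqrt\<close>)

text \<open>The content is finiteness of the group of \<open>u\<close> with \<open>u L = L\<close>:
  multiplied by \<open>denom\<close>, its elements are multipliers that produce the same ideal as
  \<open>denom\<close> does, so they lie in \<open>OK\<close> and all have the modulus of
  \<open>denom\<close>.\<close>

lemma unit_count_pos:
  assumes L: "L \<in> overmodules"
  shows "unit_count L > 0"
proof -
  let ?B = "of_nat denom :: complex"
  let ?U = "{u. u \<noteq> 0 \<and> (*) u ` L = L}"
  have "(*) ?B ` ?U \<subseteq> {z \<in> OK. cmod z \<le> cmod ?B}"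
  proof
    fix z assume "z \<in> (*) ?B ` ?U"
    then obtain u where u: "z = ?B * u" "u \<noteq> 0" "(*) u ` L = L" by auto
    have B: "?B \<in> multipliers L" using denom_multiplier[OF L OK_1] by simp
    have zL: "(*) z ` L = (*) ?B ` L" unfolding u(1) scale_scale[symmetric] u(3) ..
    then have z: "z \<in> multipliers L" using B by (simp add: multipliers_def)
    have "(cmod z)\<^sup>2 = (cmod ?B)\<^sup>2"
      using ideal_scale_multiplier(3)[OF L z] ideal_scale_multiplier(3)[OF L B] u zL by simp
    then have "cmod z = cmod ?B" by (simp add: power2_eq_iff_nonneg)
    then show "z \<in> {z \<in> OK. cmod z \<le> cmod ?B}" using multipliers_subset_OK[OF L] z by auto
  qed
  then have "finite ((*) ?B ` ?U)" by (rule finite_subset) (rule finite_OK_bounded)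
  then have "finite ?U" by (rule finite_imageD) (auto simp: inj_on_def)
  moreover have "1 \<in> ?U" by simp
  ultimately show ?thesis unfolding unit_count_def by (subst card_gt_0_iff) blast
qed

text \<open>The map sending \<alpha> to the ideal \<alpha> L carries the multipliers of the
  prescribed norm onto the ideals of norm \<open>n\<close> in the class of \<open>L\<close>. Its
  fibres are cosets of the group counted by \<open>unit_count L\<close>.\<close>

lemma card_multipliers_norm:
  assumes L: "L \<in> overmodules" and n: "n > 0"
  defines "X \<equiv> {\<alpha> \<in> multipliers L. (cmod \<alpha>)\<^sup>2 = real (add_index L OK * n)}"
  defines "Y \<equiv> {I. int_ideal D I \<and> I \<noteq> {0} \<and> ideal_norm D I = n \<and> homothetic L I}"
  shows "finite Y" "card X = unit_count L * card Y"
proof -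
  have k: "add_index L OK > 0" using L by (simp add: overmodules_def)
  have finX: "finite X" unfolding X_def by (rule finite_multipliers_norm[OF L])
  have X0: "\<alpha> \<noteq> 0" if "\<alpha> \<in> X" for \<alpha> using that k n by (auto simp: X_def)
  have im: "(\<lambda>\<alpha>. (*) \<alpha> ` L) ` X = Y"
  proof (intro equalityI subsetI)
    fix I assume "I \<in> (\<lambda>\<alpha>. (*) \<alpha> ` L) ` X"
    then obtain \<alpha> where \<alpha>: "\<alpha> \<in> X" "I = (*) \<alpha> ` L" by auto
    have m: "\<alpha> \<in> multipliers L" using \<alpha> by (simp add: X_def)
    have "real (ideal_norm D I) * real (add_index L OK) = real (add_index L OK) * real n"
      using ideal_scale_multiplier(3)[OF L m X0[OF \<alpha>(1)]] \<alpha> by (simp add: X_def)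
    then have "ideal_norm D I = n" using k by simp
    then show "I \<in> Y" using ideal_scale_multiplier[OF L m X0[OF \<alpha>(1)]] \<alpha> X0
      unfolding Y_def homothetic_def by blast
  next
    fix I assume "I \<in> Y"
    then obtain \<alpha> where \<alpha>: "\<alpha> \<noteq> 0" "I = (*) \<alpha> ` L" and I: "int_ideal D I" "ideal_norm D I = n"
      by (auto simp: Y_def homothetic_def)
    then have m: "\<alpha> \<in> multipliers L" by (auto simp: multipliers_def int_ideal_def)
    then have "\<alpha> \<in> X" using ideal_scale_multiplier(3)[OF L m \<alpha>(1)] \<alpha> I by (simp add: X_def mult.commute)
    then show "I \<in> (\<lambda>\<alpha>. (*) \<alpha> ` L) ` X" using \<alpha> by blast
  qed
  show "finite Y" using finX im by blast
  have fibre: "card {\<alpha> \<in> X. (*) \<alpha> ` L = I} = unit_count L" if IY: "I \<in> Y" for I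
  proof -
    obtain \<alpha>0 where \<alpha>0: "\<alpha>0 \<in> X" "I = (*) \<alpha>0 ` L" using IY im by blast
    have ne: "\<alpha>0 \<noteq> 0" using X0 \<alpha>0 by blast
    have "{\<alpha> \<in> X. (*) \<alpha> ` L = I} = (*) \<alpha>0 ` {u. u \<noteq> 0 \<and> (*) u ` L = L}"
    proof (intro equalityI subsetI)
      fix \<alpha> assume "\<alpha> \<in> {\<alpha> \<in> X. (*) \<alpha> ` L = I}"
      then have \<alpha>: "\<alpha> \<in> X" "(*) \<alpha> ` L = (*) \<alpha>0 ` L" using \<alpha>0 by auto
      have "(*) (\<alpha> / \<alpha>0) ` L = (*) (inverse \<alpha>0) ` (*) \<alpha> ` L" unfolding scale_scale by (simp add: divide_inverse mult.commute)
      also have "\<dots> = L" using ne unfolding \<alpha>(2) by (simp add: scale_scale)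
      finally have "\<alpha> / \<alpha>0 \<in> {u. u \<noteq> 0 \<and> (*) u ` L = L}" using X0[OF \<alpha>(1)] ne by simp
      moreover have "\<alpha> = \<alpha>0 * (\<alpha> / \<alpha>0)" using ne by simp
      ultimately show "\<alpha> \<in> (*) \<alpha>0 ` {u. u \<noteq> 0 \<and> (*) u ` L = L}" by (rule rev_image_eqI)
    next
      fix \<alpha> assume "\<alpha> \<in> (*) \<alpha>0 ` {u. u \<noteq> 0 \<and> (*) u ` L = L}"
      then obtain u where u: "\<alpha> = \<alpha>0 * u" "u \<noteq> 0" "(*) u ` L = L" by auto
      have \<alpha>I: "(*) \<alpha> ` L = I" unfolding u(1) scale_scale[symmetric] u(3) \<alpha>0(2) ..
      have \<alpha>ne: "\<alpha> \<noteq> 0" using u ne by simp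
      have m0: "\<alpha>0 \<in> multipliers L" using \<alpha>0 by (simp add: X_def)
      then have m: "\<alpha> \<in> multipliers L" using \<alpha>I \<alpha>0 by (simp add: multipliers_def)
      have "(cmod \<alpha>)\<^sup>2 = (cmod \<alpha>0)\<^sup>2"
        using ideal_scale_multiplier(3)[OF L m \<alpha>ne] ideal_scale_multiplier(3)[OF L m0 ne] \<alpha>I \<alpha>0(2) by simp
      then show "\<alpha> \<in> {\<alpha> \<in> X. (*) \<alpha> ` L = I}" using m \<alpha>I \<alpha>0 by (simp add: X_def)
    qed
    then show ?thesis
      unfolding unit_count_def using ne by (simp add: card_image inj_on_def)
  qed
  have "card X = (\<Sum>\<alpha>\<in>X. 1)" by simp
  also have "\<dots> = (\<Sum>I\<in>(\<lambda>\<alpha>. (*) \<alpha> ` L) ` X. \<Sum>\<alpha>\<in>{\<alpha> \<in> X. (*) \<alpha> ` L = I}. 1)"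
    by (rule sum.image_gen[OF finX])
  also have "\<dots> = (\<Sum>I\<in>Y. unit_count L)"
    unfolding im by (intro sum.cong refl) (simp add: fibre)
  finally show "card X = unit_count L * card Y" by simp
qed

text \<open>Ideals are sorted by homothety class. Each class contributes the number of
  representations of \<open>n\<close> by the norm form of a lattice, divided by a number of units;
  such representation numbers are what theta series generate.\<close>

theorem ideal_count_eq:
  assumes n: "n > 0"
  shows "real (ideal_count D n) = (\<Sum>L\<in>class_reps.
     real (card {\<alpha> \<in> multipliers L. (cmod \<alpha>)\<^sup>2 = real (add_index L OK * n)}) / real (unit_count L))"
proof -
  define Y where "Y L = {I. int_ideal D I \<and> I \<noteq> {0} \<and> ideal_norm D I = n \<and> homothetic L I}" for L
  have "{I. int_ideal D I \<and> I \<noteq> {0} \<and> ideal_norm D I = n} = (\<Union>L\<in>class_reps. Y L)"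
  proof (intro equalityI subsetI)
    fix I assume "I \<in> {I. int_ideal D I \<and> I \<noteq> {0} \<and> ideal_norm D I = n}"
    then have I: "int_ideal D I" "I \<noteq> {0}" "ideal_norm D I = n" by auto
    obtain \<alpha> L where "\<alpha> \<noteq> 0" "L \<in> class_reps" "I = (*) \<alpha> ` L"
      using ideal_eq_scaled_class_rep[OF I(1,2)] .
    then show "I \<in> (\<Union>L\<in>class_reps. Y L)" using I unfolding Y_def homothetic_def by blast
  qed (auto simp: Y_def)
  moreover have "Y L \<inter> Y L' = {}" if "L \<in> class_reps" "L' \<in> class_reps" "L \<noteq> L'" for L L'
    using that class_reps_unique homothetic_sym homothetic_trans unfolding Y_def by blast
  moreover have "finite (Y L)" if "L \<in> class_reps" for L
    unfolding Y_def by (rule card_multipliers_norm(1)[OF class_reps_overmodules[OF that] n])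
  ultimately have "ideal_count D n = (\<Sum>L\<in>class_reps. card (Y L))"
    unfolding ideal_count_def using finite_class_reps by (simp add: card_UN_disjoint)
  also have "real \<dots> = (\<Sum>L\<in>class_reps.
     real (card {\<alpha> \<in> multipliers L. (cmod \<alpha>)\<^sup>2 = real (add_index L OK * n)}) / real (unit_count L))"
    unfolding of_nat_sum
  proof (rule sum.cong[OF refl])
    fix L assume "L \<in> class_reps"
    then have L: "L \<in> overmodules" by (rule class_reps_overmodules)
    show "real (card (Y L)) = real (card {\<alpha> \<in> multipliers L. (cmod \<alpha>)\<^sup>2 = real (add_index L OK * n)}) / real (unit_count L)"
      unfolding card_multipliers_norm(2)[OF L n] Y_def[symmetric] using unit_count_pos[OF L] by simp
  qed
  finally show ?thesis .
qed

end

section \<open>The theta function of the ideals\<close>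

lemma kernel_sum_mult_le:
  assumes d: "d > 0"
  shows "kernel_sum H y \<le> real d * kernel_sum H (real d * y)"
proof (cases "H = 0")
  case False
  have "kernel_sum H y \<le> (\<Sum>h=1..H. real d * circ_kernel H (real d * (real h * y)))"
    unfolding kernel_sum_def using False d by (intro sum_mono circ_kernel_mult_le) auto
  also have "\<dots> = real d * kernel_sum H (real d * y)"
    unfolding kernel_sum_def sum_distrib_left by (simp add: mult_ac)
  finally show ?thesis .
qed (simp add: kernel_sum_def)

lemma has_sum_product_complex:
  fixes f :: "'a \<Rightarrow> complex" and g :: "'b \<Rightarrow> complex"
  assumes f: "(\<lambda>x. norm (f x)) summable_on A" "(f has_sum S) A" and g: "(\<lambda>x. norm (g x)) summable_on B" "(g has_sum S') B"
  shows "(\<lambda>p. norm (case p of (x, y) \<Rightarrow> f x * g y)) summable_on (A \<times> B)" "((\<lambda>(x, y). f x * g y) has_sum (S * S')) (A \<times> B)"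
proof -
  have "(\<lambda>y. norm (f x * g y)) summable_on B" for x
    unfolding norm_mult by (rule summable_on_cmult_right[OF g(1)])
  moreover have "infsum (\<lambda>y. norm (f x * g y)) B = norm (f x) * infsum (\<lambda>y. norm (g y)) B" for x
    unfolding norm_mult by (rule infsum_cmult_right) (use g in auto)
  ultimately show abs: "(\<lambda>p. norm (case p of (x, y) \<Rightarrow> f x * g y)) summable_on (A \<times> B)"
    unfolding Infinite_Sum.abs_summable_on_Sigma_iff using f(1)
    by (auto simp: abs_mult infsum_nonneg intro!: summable_on_cmult_left)
  show "((\<lambda>(x, y). f x * g y) has_sum (S * S')) (A \<times> B)"
  proof (rule has_sum_SigmaI[where g = "\<lambda>x. f x * S'"])
    show "((\<lambda>y. case (x, y) of (x, y) \<Rightarrow> f x * g y) has_sum (f x * S')) B" for x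
      unfolding prod.case using g(2) by (rule has_sum_cmult_right)
    show "((\<lambda>x. f x * S') has_sum (S * S')) A"
      using f(2) by (rule has_sum_cmult_left)
    show "(\<lambda>(x, y). f x * g y) summable_on (A \<times> B)"
      using abs by (rule abs_summable_summable)
  qed
qed

lemma exists_quarter_power_le:
  fixes t :: real
  assumes "t > 0"
  obtains j where "t \<ge> (1/4) ^ j"
  using real_arch_pow_inv[OF assms, of "1/4"] by (auto intro: less_imp_le)

lemma summable_norm_theta_term:
  assumes "w > 0" "a \<ge> 0" "A \<ge> 1" "t > 0"
  shows "summable (\<lambda>k. cmod (theta_term w a A t x k))"
proof -
  obtain j where j: "t \<ge> (1/4) ^ j" using exists_quarter_power_le[OF assms(4)] .
  show ?thesis
  proof (rule bounded_imp_summable)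
    fix n
    have "(\<Sum>k\<le>n. cmod (theta_term w a A t x k)) = (\<Sum>k<Suc n. cmod (theta_term w a A t x k))"
      by (simp only: lessThan_Suc_atMost)
    also have "\<dots> \<le> (\<Sum>k<Suc n. exp (- w * (real k / real (2 ^ j))\<^sup>2))"
      by (intro sum_mono norm_theta_term_le assms j)
    also have "\<dots> \<le> real (2 ^ j) / (1 - exp (- w))"
      using assms by (intro sum_exp_square_le) auto
    finally show "(\<Sum>k\<le>n. cmod (theta_term w a A t x k)) \<le> real (2 ^ j) / (1 - exp (- w))" .
  qed auto
qed

text \<open>The finite bound passes to the limit. An arbitrary summable majorant \<open>v\<close> is
  allowed, so that thresholds valid outside an exceptional set can be inserted for each
  \<open>x\<close>; the factor \<open>d\<close> moves the frequency to a common multiple.\<close>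

lemma theta_suminf_bound:
  fixes w :: real
  assumes w: "w > 0"
  obtains C where "C > 0" "\<And>a A j t x d c v. a \<ge> 0 \<Longrightarrow> A \<ge> 1 \<Longrightarrow> t \<ge> (1/4) ^ j \<Longrightarrow> d > 0 \<Longrightarrow>
    c = 2 * w * A\<^sup>2 * real d \<Longrightarrow>
    (\<And>l. kernel_sum (2 ^ (j + l)) (c * x) \<le> v l) \<Longrightarrow> summable (\<lambda>l. (1/4) ^ l * v l) \<Longrightarrow>
    (cmod (suminf (theta_term w a A t x)))\<^sup>2 \<le> C * real d * (2 ^ j + (\<Sum>l. (1/4) ^ l * v l))"
proof -
  obtain C where C: "C > 0" "\<And>a A j t x N. a \<ge> 0 \<Longrightarrow> A \<ge> 1 \<Longrightarrow> t \<ge> (1/4) ^ j \<Longrightarrow>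
    (cmod (\<Sum>k<N. theta_term w a A t x k))\<^sup>2
      \<le> C * (2 ^ j + (\<Sum>l\<le>N. (1/4) ^ l * kernel_sum (2 ^ (j + l)) (2 * w * A\<^sup>2 * x)))"
    by (rule theta_sum_bound[OF w]) (blast intro: that)
  have main: "(cmod (suminf (theta_term w a A t x)))\<^sup>2 \<le> C * real d * (2 ^ j + (\<Sum>l. (1/4) ^ l * v l))"
    if a: "a \<ge> 0" and A: "A \<ge> 1" and t: "t \<ge> (1/4) ^ j" and d: "d > 0" and c: "c = 2 * w * A\<^sup>2 * real d" and
    v: "\<And>l. kernel_sum (2 ^ (j + l)) (c * x) \<le> v l" and sm: "summable (\<lambda>l. (1/4) ^ l * v l)"
    for a A j t x d c v
  proof -
    have t0: "t > 0" using t by (smt (verit) zero_less_power zero_less_divide_iff)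
    have v0: "v l \<ge> 0" for l using v[of l] kernel_sum_nonneg[of "2 ^ (j + l)" "c * x"] by linarith
    have "(\<lambda>N. \<Sum>k<N. theta_term w a A t x k) \<longlonglongrightarrow> suminf (theta_term w a A t x)"
      by (rule summable_LIMSEQ[OF summable_norm_cancel[OF summable_norm_theta_term[OF w a A t0]]])
    then have lim: "(\<lambda>N. (cmod (\<Sum>k<N. theta_term w a A t x k))\<^sup>2) \<longlonglongrightarrow> (cmod (suminf (theta_term w a A t x)))\<^sup>2"
      by (intro tendsto_intros)
    have "(cmod (\<Sum>k<N. theta_term w a A t x k))\<^sup>2 \<le> C * real d * (2 ^ j + (\<Sum>l. (1/4) ^ l * v l))" for N
    proof -
      have "(\<Sum>l\<le>N. (1/4) ^ l * kernel_sum (2 ^ (j + l)) (2 * w * A\<^sup>2 * x)) \<le> (\<Sum>l\<le>N. real d * ((1/4) ^ l * v l))"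
      proof (rule sum_mono)
        fix l
        have "kernel_sum (2 ^ (j + l)) (2 * w * A\<^sup>2 * x) \<le> real d * kernel_sum (2 ^ (j + l)) (c * x)"
          using kernel_sum_mult_le[OF d, of "2 ^ (j + l)" "2 * w * A\<^sup>2 * x"] by (simp add: c mult_ac)
        also have "\<dots> \<le> real d * v l" using v by (intro mult_left_mono) auto
        finally have "(1/4) ^ l * kernel_sum (2 ^ (j + l)) (2 * w * A\<^sup>2 * x) \<le> (1/4) ^ l * (real d * v l)"
          by (rule mult_left_mono) simp
        then show "(1/4) ^ l * kernel_sum (2 ^ (j + l)) (2 * w * A\<^sup>2 * x) \<le> real d * ((1/4) ^ l * v l)"
          by (simp add: mult_ac)
      qed
      also have "\<dots> = real d * (\<Sum>l\<le>N. (1/4) ^ l * v l)" by (simp add: sum_distrib_left)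
      also have "\<dots> \<le> real d * (\<Sum>l. (1/4) ^ l * v l)"
        using sm v0 by (intro mult_left_mono sum_le_suminf) auto
      finally have s: "(\<Sum>l\<le>N. (1/4) ^ l * kernel_sum (2 ^ (j + l)) (2 * w * A\<^sup>2 * x)) \<le> real d * (\<Sum>l. (1/4) ^ l * v l)" .
      have "1 * 2 ^ j \<le> real d * 2 ^ j" using d by (intro mult_right_mono) auto
      then have "2 ^ j + (\<Sum>l\<le>N. (1/4) ^ l * kernel_sum (2 ^ (j + l)) (2 * w * A\<^sup>2 * x))
          \<le> real d * (2 ^ j + (\<Sum>l. (1/4) ^ l * v l))"
        unfolding distrib_left using s by linarith
      then have "C * (2 ^ j + (\<Sum>l\<le>N. (1/4) ^ l * kernel_sum (2 ^ (j + l)) (2 * w * A\<^sup>2 * x)))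
          \<le> C * (real d * (2 ^ j + (\<Sum>l. (1/4) ^ l * v l)))"
        using C(1) by (intro mult_left_mono) auto
      then show ?thesis using C(2)[OF a A t, where N = N and x = x] by (simp add: mult.assoc)
    qed
    then show ?thesis by (intro LIMSEQ_le_const2[OF lim]) auto
  qed
  show ?thesis by (rule that[OF C(1) main])
qed

definition progression_term :: "real \<Rightarrow> int \<Rightarrow> nat \<Rightarrow> real \<Rightarrow> real \<Rightarrow> int \<Rightarrow> complex" where
  "progression_term w a A t x m = exp (- of_real (w * (of_int (a + int A * m))\<^sup>2) * Complex t (2 * pi * x))"

text \<open>The two-sided sum over the residue class of \<open>a\<close>, folded at 0: for
  \<open>0 <= a <= A\<close> both halves start at a nonnegative point, which makes the moduli
  decreasing as Weyl differencing requires.\<close>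

definition progression_theta :: "real \<Rightarrow> int \<Rightarrow> nat \<Rightarrow> real \<Rightarrow> real \<Rightarrow> complex" where
  "progression_theta w a A t x = suminf (theta_term w (of_int a) (real A) t x)
     + suminf (theta_term w (of_int (int A - a)) (real A) t x)"

lemma progression_has_sum:
  assumes w: "w > 0" and a: "0 \<le> a" "a \<le> int A" and A: "A \<ge> 1" and t: "t > 0"
  shows "(\<lambda>m. norm (progression_term w a A t x m)) summable_on UNIV"
    "(progression_term w a A t x has_sum progression_theta w a A t x) UNIV"
proof -
  \<comment> \<open>The index \<open>m = - k - 1\<close> gives \<open>- (A - a + A * k)\<close>, and
    the sign disappears in the square.\<close>
  have sq: "(of_int (a + int A * (- int k - 1)))\<^sup>2 = (of_int (int A - a) + real A * real k)\<^sup>2" for k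
    by (simp add: power2_eq_square algebra_simps)
  have f1: "progression_term w a A t x (int k) = theta_term w (of_int a) (real A) t x k" for k
    by (simp add: progression_term_def theta_term_def)
  have f2: "progression_term w a A t x (- int k - 1) = theta_term w (of_int (int A - a)) (real A) t x k" for k
    unfolding progression_term_def theta_term_def sq ..
  have i1: "inj int" and i2: "inj (\<lambda>k. - int k - 1)" by (auto simp: inj_on_def)
  have un: "range int \<union> range (\<lambda>k. - int k - 1) = UNIV"
  proof -
    have "m \<in> range int \<union> range (\<lambda>k. - int k - 1)" for m :: int
    proof (cases "m \<ge> 0")
      case True
      then show ?thesis by (metis UnI1 nat_0_le rangeI)
    next
      case False
      then have "m = - int (nat (- m - 1)) - 1" by simp
      then show ?thesis by blast
    qed
    then show ?thesis by blast
  qed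
  have dis: "range int \<inter> range (\<lambda>k. - int k - 1) = {}" by auto
  have sm: "summable (\<lambda>k. cmod (theta_term w (of_int b) (real A) t x k))" if "b \<ge> 0" for b :: int
    by (rule summable_norm_theta_term) (use that w A t in auto)
  have hs: "(theta_term w (of_int b) (real A) t x has_sum suminf (theta_term w (of_int b) (real A) t x)) UNIV"
    if "b \<ge> 0" for b :: int
    by (intro norm_summable_imp_has_sum sm that summable_sums summable_norm_cancel[OF sm])
  have ab: "(\<lambda>k. cmod (theta_term w (of_int b) (real A) t x k)) summable_on UNIV" if "b \<ge> 0" for b :: int
    by (intro summable_nonneg_imp_summable_on sm that) auto
  have "(progression_term w a A t x has_sum suminf (theta_term w (of_int a) (real A) t x)) (range int)"
    unfolding has_sum_reindex[OF i1] o_def f1 using a by (intro hs) auto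
  moreover have "(progression_term w a A t x has_sum suminf (theta_term w (of_int (int A - a)) (real A) t x))
      (range (\<lambda>k. - int k - 1))"
    unfolding has_sum_reindex[OF i2] o_def f2 using a by (intro hs) auto
  ultimately show "(progression_term w a A t x has_sum progression_theta w a A t x) UNIV"
    unfolding progression_theta_def un[symmetric] by (rule has_sum_Un_disjoint[OF _ _ dis])
  have "(\<lambda>m. cmod (progression_term w a A t x m)) summable_on (range int)"
    unfolding summable_on_reindex[OF i1] o_def f1 using a by (intro ab) auto
  moreover have "(\<lambda>m. cmod (progression_term w a A t x m)) summable_on (range (\<lambda>k. - int k - 1))"
    unfolding summable_on_reindex[OF i2] o_def f2 using a by (intro ab) auto
  ultimately show "(\<lambda>m. norm (progression_term w a A t x m)) summable_on UNIV"
    unfolding un[symmetric] by (rule summable_on_Un_disjoint[OF _ _ dis])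
qed

lemma progression_theta_bound:
  fixes w :: real
  assumes w: "w > 0"
  obtains C where "C > 0" "\<And>a A j t x d c v. 0 \<le> a \<Longrightarrow> a \<le> int A \<Longrightarrow> A \<ge> 1 \<Longrightarrow> t \<ge> (1/4) ^ j \<Longrightarrow> d > 0 \<Longrightarrow>
    c = 2 * w * (real A)\<^sup>2 * real d \<Longrightarrow>
    (\<And>l. kernel_sum (2 ^ (j + l)) (c * x) \<le> v l) \<Longrightarrow> summable (\<lambda>l. (1/4) ^ l * v l) \<Longrightarrow>
    (cmod (progression_theta w a A t x))\<^sup>2 \<le> C * real d * (2 ^ j + (\<Sum>l. (1/4) ^ l * v l))"
proof -
  obtain C where C: "C > 0" "\<And>a A j t x d c v. a \<ge> 0 \<Longrightarrow> A \<ge> 1 \<Longrightarrow> t \<ge> (1/4) ^ j \<Longrightarrow> d > 0 \<Longrightarrow>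
    c = 2 * w * A\<^sup>2 * real d \<Longrightarrow>
    (\<And>l. kernel_sum (2 ^ (j + l)) (c * x) \<le> v l) \<Longrightarrow> summable (\<lambda>l. (1/4) ^ l * v l) \<Longrightarrow>
    (cmod (suminf (theta_term w a A t x)))\<^sup>2 \<le> C * real d * (2 ^ j + (\<Sum>l. (1/4) ^ l * v l))"
    by (rule theta_suminf_bound[OF w]) (blast intro: that)
  show ?thesis
  proof (rule that[of "4 * C"])
    show "4 * C > 0" using C by simp
    fix a :: int and A j d :: nat and t x c :: real and v :: "nat \<Rightarrow> real"
    assume a: "0 \<le> a" "a \<le> int A" and A: "A \<ge> 1" and *: "t \<ge> (1/4) ^ j" "d > 0" "c = 2 * w * (real A)\<^sup>2 * real d"
      "\<And>l. kernel_sum (2 ^ (j + l)) (c * x) \<le> v l" "summable (\<lambda>l. (1/4) ^ l * v l)"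
    let ?T1 = "suminf (theta_term w (of_int a) (real A) t x)"
    let ?T2 = "suminf (theta_term w (of_int (int A - a)) (real A) t x)"
    have "(cmod (?T1 + ?T2))\<^sup>2 \<le> (cmod ?T1 + cmod ?T2)\<^sup>2"
      by (intro power_mono norm_triangle_ineq) auto
    also have "\<dots> \<le> 2 * (cmod ?T1)\<^sup>2 + 2 * (cmod ?T2)\<^sup>2"
      using sum_squares_bound[of "cmod ?T1" "cmod ?T2"] by (simp add: power2_sum)
    also have "(cmod ?T1)\<^sup>2 \<le> C * real d * (2 ^ j + (\<Sum>l. (1/4) ^ l * v l))"
      by (rule C(2)) (use a A * in auto)
    also have "(cmod ?T2)\<^sup>2 \<le> C * real d * (2 ^ j + (\<Sum>l. (1/4) ^ l * v l))"
      by (rule C(2)) (use a A * in auto)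
    finally show "(cmod (progression_theta w a A t x))\<^sup>2 \<le> 4 * C * real d * (2 ^ j + (\<Sum>l. (1/4) ^ l * v l))"
      by (simp add: progression_theta_def)
  qed
qed

section \<open>The multiplier lattice and the theta function of the ideals\<close>

context imag_quad_order
begin

text \<open>The point \<open>(u + v sqrt D) / 2\<close>. In these coordinates the norm is the
  diagonal form \<open>(u^2 - D v^2) / 4\<close>, so theta sums over residue classes split into
  products; the basis \<open>1\<close>, \<omega> would leave a mixed term.\<close>

definition half_lattice :: "int \<times> int \<Rightarrow> complex" where
  "half_lattice = (\<lambda>(u, v). Complex (of_int u / 2) (of_int v * sqrt (of_int (- D)) / 2))"

lemma inj_half_lattice: "inj half_lattice"
  using D_neg by (auto simp: inj_on_def half_lattice_def)

lemma half_lattice_add: "half_lattice (u + u', v + v') = half_lattice (u, v) + half_lattice (u', v')"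
  by (simp add: half_lattice_def complex_eq_iff add_divide_distrib distrib_right)

lemma norm_half_lattice: "(cmod (half_lattice (u, v)))\<^sup>2 = ((of_int u)\<^sup>2 + of_int (- D) * (of_int v)\<^sup>2) / 4"
  using D_neg by (simp add: half_lattice_def cmod_power2 power_divide power_mult_distrib add_divide_distrib)

lemma OK_half_lattice:
  assumes "z \<in> OK"
  shows "z \<in> range half_lattice"
proof -
  obtain a b where z: "z = of_int a + of_int b * \<omega>" using assms unfolding OK_iff by blast
  have "z = half_lattice (2 * a + b * D, b)"
    by (rule complex_eqI) (simp_all add: z half_lattice_def Re_\<omega> Im_\<omega> field_simps)
  then show ?thesis by blast
qed

lemma half_lattice_even: "half_lattice (2 * n * p, 2 * n * q) = of_int n * (of_int (p - q * D) + of_int (2 * q) * \<omega>)"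
  by (rule complex_eqI) (simp_all add: half_lattice_def Re_\<omega> Im_\<omega> field_simps)

text \<open>The factors 2 and \<open>denom\<close> put the period lattice inside the multipliers.
  The index cancels the denominators of \<open>weight1\<close> and \<open>weight2\<close>, which
  makes the frequencies \<open>2 * w * A^2\<close> integers.\<close>

definition period :: "complex set \<Rightarrow> nat" where
  "period L = 2 * denom * add_index L OK"

definition residue_pairs :: "complex set \<Rightarrow> (int \<times> int) set" where
  "residue_pairs L = {p \<in> {0..<int (period L)} \<times> {0..<int (period L)}. half_lattice p \<in> multipliers L}"

lemma finite_residue_pairs: "finite (residue_pairs L)"
  unfolding residue_pairs_def by simp

lemma period_pos: "L \<in> overmodules \<Longrightarrow> period L > 0"
  by (simp add: period_def overmodules_def)

lemma half_lattice_periodic: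
  assumes L: "L \<in> overmodules" and uv: "half_lattice (u, v) \<in> multipliers L"
  shows "half_lattice (u + int (period L) * p, v + int (period L) * q) \<in> multipliers L"
proof -
  let ?k = "int (add_index L OK)"
  have "half_lattice (int (period L) * p, int (period L) * q) = of_nat denom * (of_int (?k * p - ?k * q * D) + of_int (2 * (?k * q)) * \<omega>)"
    using half_lattice_even[of "int denom" "?k * p" "?k * q"] by (simp add: period_def mult_ac)
  also have "\<dots> \<in> multipliers L" by (rule denom_multiplier[OF L OK_I])
  finally show ?thesis unfolding half_lattice_add using uv by (intro multipliers_add)
qed

lemma bij_betw_multipliers:
  assumes L: "L \<in> overmodules"
  defines "A \<equiv> int (period L)"
  shows "bij_betw (\<lambda>((a, b), (m, m')). half_lattice (a + A * m, b + A * m'))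
     (residue_pairs L \<times> UNIV) (multipliers L)"
proof (rule bij_betw_imageI)
  have A: "A > 0" using period_pos[OF L] by (simp add: A_def)
  show "inj_on (\<lambda>((a, b), (m, m')). half_lattice (a + A * m, b + A * m')) (residue_pairs L \<times> UNIV)"
  proof (rule inj_onI)
    fix p p'
    assume p: "p \<in> residue_pairs L \<times> UNIV" "p' \<in> residue_pairs L \<times> UNIV"
      and eq': "(\<lambda>((a, b), (m, m')). half_lattice (a + A * m, b + A * m')) p = (\<lambda>((a, b), (m, m')). half_lattice (a + A * m, b + A * m')) p'"
    obtain a b m m' a' b' n n' where pp: "p = ((a, b), (m, m'))" "p' = ((a', b'), (n, n'))"
      by (metis surj_pair)
    have ab: "(a, b) \<in> residue_pairs L" "(a', b') \<in> residue_pairs L"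
      and eq: "half_lattice (a + A * m, b + A * m') = half_lattice (a' + A * n, b' + A * n')"
      using p eq' by (simp_all add: pp)
    have eqs: "a + A * m = a' + A * n" "b + A * m' = b' + A * n'"
      using eq inj_half_lattice by (auto simp: inj_eq)
    have r: "0 \<le> a" "a < A" "0 \<le> b" "b < A" "0 \<le> a'" "a' < A" "0 \<le> b'" "b' < A"
      using ab by (auto simp: residue_pairs_def A_def)
    have "a = a'" using arg_cong[OF eqs(1), of "\<lambda>i. i mod A"] r by simp
    moreover have "b = b'" using arg_cong[OF eqs(2), of "\<lambda>i. i mod A"] r by simp
    ultimately show "p = p'" using eqs A by (simp add: pp)
  qed
  show "(\<lambda>((a, b), (m, m')). half_lattice (a + A * m, b + A * m')) ` (residue_pairs L \<times> UNIV) = multipliers L"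
  proof (intro equalityI subsetI)
    fix z assume "z \<in> (\<lambda>((a, b), (m, m')). half_lattice (a + A * m, b + A * m')) ` (residue_pairs L \<times> UNIV)"
    then obtain a b m m' where "(a, b) \<in> residue_pairs L" "z = half_lattice (a + A * m, b + A * m')"
      by (auto simp: image_iff)
    then show "z \<in> multipliers L" using half_lattice_periodic[OF L] by (auto simp: residue_pairs_def A_def)
  next
    fix z assume z: "z \<in> multipliers L"
    then have "z \<in> range half_lattice" using multipliers_subset_OK[OF L] OK_half_lattice by blast
    then obtain u v where uv: "z = half_lattice (u, v)" by auto
    have "half_lattice (u + A * (- (u div A)), v + A * (- (v div A))) \<in> multipliers L"
      unfolding A_def by (rule half_lattice_periodic[OF L]) (use z uv in simp)
    then have "half_lattice (u mod A, v mod A) \<in> multipliers L"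
      by (simp add: minus_mult_div_eq_mod)
    then have "(u mod A, v mod A) \<in> residue_pairs L" using A by (simp add: residue_pairs_def A_def)
    then have "((u mod A, v mod A), (u div A, v div A)) \<in> residue_pairs L \<times> UNIV" by simp
    moreover have "z = (\<lambda>((a, b), (m, m')). half_lattice (a + A * m, b + A * m')) ((u mod A, v mod A), (u div A, v div A))"
      by (simp add: uv)
    ultimately show "z \<in> (\<lambda>((a, b), (m, m')). half_lattice (a + A * m, b + A * m')) ` (residue_pairs L \<times> UNIV)"
      by (rule rev_image_eqI)
  qed
qed

text \<open>The norm of the ideal \<alpha> L is the squared modulus of \<alpha> divided by
  \<open>add_index L OK\<close>; the two weights are the coefficients of this quotient in the
  coordinates of \<open>half_lattice\<close>.\<close>

definition weight1 :: "complex set \<Rightarrow> real" where "weight1 L = 1 / (4 * real (add_index L OK))"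
definition weight2 :: "complex set \<Rightarrow> real" where "weight2 L = real (nat (- D)) / (4 * real (add_index L OK))"

definition multiplier_theta :: "complex set \<Rightarrow> real \<Rightarrow> real \<Rightarrow> complex" where
  "multiplier_theta L t x = (\<Sum>(a, b)\<in>residue_pairs L.
     progression_theta (weight1 L) a (period L) t x * progression_theta (weight2 L) b (period L) t x)"

lemma weights_pos: "L \<in> overmodules \<Longrightarrow> weight1 L > 0" "L \<in> overmodules \<Longrightarrow> weight2 L > 0"
  using D_neg by (auto simp: weight1_def weight2_def overmodules_def divide_neg_pos)

text \<open>The multipliers are a finite union of translates of a product lattice, and on each
  translate the diagonal form makes the exponential a product. Absolute summability justifies the
  rearrangement.\<close>

lemma multiplier_theta_has_sum:
  assumes L: "L \<in> overmodules" and t: "t > 0"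
  shows "((\<lambda>\<alpha>. exp (- of_real ((cmod \<alpha>)\<^sup>2 / real (add_index L OK)) * Complex t (2 * pi * x)))
      has_sum multiplier_theta L t x) (multipliers L)"
proof -
  let ?A = "period L" and ?z = "Complex t (2 * pi * x)" and ?k = "real (add_index L OK)"
  let ?P = "\<lambda>a m. progression_term (weight1 L) a ?A t x m" and ?Q = "\<lambda>b m. progression_term (weight2 L) b ?A t x m"
  let ?f = "\<lambda>\<alpha>. exp (- of_real ((cmod \<alpha>)\<^sup>2 / ?k) * ?z)"
  let ?g = "\<lambda>((a, b), (m, m')). half_lattice (a + int ?A * m, b + int ?A * m')"
  have A: "?A \<ge> 1" using period_pos[OF L] by simp
  have fg: "?f (?g ((a, b), (m, m'))) = ?P a m * ?Q b m'" for a b m m'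
  proof -
    have "(cmod (half_lattice (a + int ?A * m, b + int ?A * m')))\<^sup>2 / ?k
        = weight1 L * (of_int (a + int ?A * m))\<^sup>2 + weight2 L * (of_int (b + int ?A * m'))\<^sup>2"
      unfolding norm_half_lattice weight1_def weight2_def using D_neg
      by (simp add: add_divide_distrib diff_divide_distrib)
    moreover have "exp (- of_real (y + y') * ?z) = exp (- of_real y * ?z) * exp (- of_real y' * ?z)" for y y'
      by (simp add: exp_add[symmetric] algebra_simps)
    ultimately show ?thesis
      unfolding progression_term_def prod.case by (simp only:)
  qed
  have hs: "((\<lambda>(m, m'). ?P a m * ?Q b m') has_sum (progression_theta (weight1 L) a ?A t x * progression_theta (weight2 L) b ?A t x)) UNIV"
    and ab: "(\<lambda>p. norm (case p of (m, m') \<Rightarrow> ?P a m * ?Q b m')) summable_on UNIV" if "(a, b) \<in> residue_pairs L" for a b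
  proof -
    have r: "0 \<le> a" "a \<le> int ?A" "0 \<le> b" "b \<le> int ?A" using that by (auto simp: residue_pairs_def)
    note p1 = progression_has_sum[OF weights_pos(1)[OF L] r(1,2) A t, of x]
    note p2 = progression_has_sum[OF weights_pos(2)[OF L] r(3,4) A t, of x]
    show "((\<lambda>(m, m'). ?P a m * ?Q b m') has_sum (progression_theta (weight1 L) a ?A t x * progression_theta (weight2 L) b ?A t x)) UNIV"
      "(\<lambda>p. norm (case p of (m, m') \<Rightarrow> ?P a m * ?Q b m')) summable_on UNIV"
      using has_sum_product_complex[OF p1 p2] by (simp_all only: UNIV_Times_UNIV)
  qed
  have "((\<lambda>y. ?f (?g y)) has_sum multiplier_theta L t x) (residue_pairs L \<times> UNIV)"
  proof (rule has_sum_SigmaI[where g = "\<lambda>(a, b). progression_theta (weight1 L) a ?A t x * progression_theta (weight2 L) b ?A t x"])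
    fix p assume p: "p \<in> residue_pairs L"
    obtain a b where ab: "p = (a, b)" by force
    have "?f (?g (p, y)) = (case y of (m, m') \<Rightarrow> ?P a m * ?Q b m')" for y
      using fg[of a b "fst y" "snd y"] by (simp only: ab prod.case_eq_if fst_conv snd_conv)
    then show "((\<lambda>y. ?f (?g (p, y))) has_sum (case p of (a, b) \<Rightarrow> progression_theta (weight1 L) a ?A t x * progression_theta (weight2 L) b ?A t x)) UNIV"
      using hs[of a b] p by (simp only: ab prod.case)
  next
    show "((\<lambda>(a, b). progression_theta (weight1 L) a ?A t x * progression_theta (weight2 L) b ?A t x) has_sum multiplier_theta L t x) (residue_pairs L)"
      unfolding multiplier_theta_def using finite_residue_pairs by (rule has_sum_finite)
  next
    have "(\<lambda>y. norm (?f (?g y))) summable_on (residue_pairs L \<times> UNIV)"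
      unfolding Infinite_Sum.abs_summable_on_Sigma_iff
    proof (intro conjI ballI)
      fix p assume p: "p \<in> residue_pairs L"
      obtain a b where abp: "p = (a, b)" by force
      have "?f (?g (p, y)) = (case y of (m, m') \<Rightarrow> ?P a m * ?Q b m')" for y
        using fg[of a b "fst y" "snd y"] by (simp only: abp prod.case_eq_if fst_conv snd_conv)
      then show "(\<lambda>y. norm (?f (?g (p, y)))) summable_on UNIV"
        using ab[of a b] p by (simp only: abp)
    qed (use finite_residue_pairs in \<open>auto intro: summable_on_finite\<close>)
    then show "(\<lambda>y. ?f (?g y)) summable_on (residue_pairs L \<times> UNIV)"
      by (rule abs_summable_summable)
  qed
  then show ?thesis
    using has_sum_reindex_bij_betw[OF bij_betw_multipliers[OF L], of ?f] by simp
qed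

lemma multiplier_norm_nat:
  assumes L: "L \<in> overmodules" and \<alpha>: "\<alpha> \<in> multipliers L"
  obtains n where "(cmod \<alpha>)\<^sup>2 = real (add_index L OK * n)"
proof (cases "\<alpha> = 0")
  case True
  then show ?thesis by (intro that[of 0]) simp
next
  case False
  then show ?thesis
    using ideal_scale_multiplier(3)[OF L \<alpha> False] by (intro that[of "ideal_norm D ((*) \<alpha> ` L)"]) (simp add: mult.commute)
qed

definition norm_shell :: "complex set \<Rightarrow> nat \<Rightarrow> complex set" where
  "norm_shell L n = {\<alpha> \<in> multipliers L. (cmod \<alpha>)\<^sup>2 = real (add_index L OK * n)}"

lemma norm_shell_has_sum:
  assumes L: "L \<in> overmodules" and t: "t > 0"
  shows "((\<lambda>n. of_nat (card (norm_shell L n)) * exp (- of_nat n * Complex t (2 * pi * x)))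
      has_sum multiplier_theta L t x) UNIV"
proof -
  let ?z = "Complex t (2 * pi * x)" and ?k = "real (add_index L OK)"
  let ?f = "\<lambda>\<alpha>. exp (- of_real ((cmod \<alpha>)\<^sup>2 / ?k) * ?z)"
  have k: "add_index L OK > 0" using L by (simp add: overmodules_def)
  have bij: "bij_betw snd (Sigma UNIV (norm_shell L)) (multipliers L)"
  proof (rule bij_betw_imageI)
    show "inj_on snd (Sigma UNIV (norm_shell L))"
      using k by (auto simp: inj_on_def norm_shell_def)
    show "snd ` Sigma UNIV (norm_shell L) = multipliers L"
    proof (intro equalityI subsetI)
      fix \<alpha> assume \<alpha>: "\<alpha> \<in> multipliers L"
      obtain n where "(cmod \<alpha>)\<^sup>2 = real (add_index L OK * n)" using multiplier_norm_nat[OF L \<alpha>] .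
      then have "(n, \<alpha>) \<in> Sigma UNIV (norm_shell L)" using \<alpha> by (simp add: norm_shell_def)
      then show "\<alpha> \<in> snd ` Sigma UNIV (norm_shell L)" by (metis imageI snd_conv)
    qed (auto simp: norm_shell_def)
  qed
  have "((\<lambda>p. ?f (snd p)) has_sum multiplier_theta L t x) (Sigma UNIV (norm_shell L))"
    by (rule iffD2[OF has_sum_reindex_bij_betw[OF bij, where f = ?f] multiplier_theta_has_sum[OF L t]])
  then show ?thesis
  proof (rule has_sum_Sigma')
    fix n :: nat
    have fin: "finite (norm_shell L n)" unfolding norm_shell_def by (rule finite_multipliers_norm[OF L])
    have "?f \<alpha> = exp (- of_nat n * ?z)" if "\<alpha> \<in> norm_shell L n" for \<alpha>
      using that k by (simp add: norm_shell_def)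
    then have "of_nat (card (norm_shell L n)) * exp (- of_nat n * ?z) = sum ?f (norm_shell L n)"
      by simp
    then show "((\<lambda>y. ?f (snd (n, y))) has_sum of_nat (card (norm_shell L n)) * exp (- of_nat n * ?z)) (norm_shell L n)"
      using fin by (simp only: snd_conv has_sum_finite)
  qed
qed

lemma norm_shell_0:
  assumes L: "L \<in> overmodules"
  shows "norm_shell L 0 = {0}"
proof -
  have "0 \<in> multipliers L" using denom_multiplier[OF L OK_0] by simp
  then show ?thesis by (auto simp: norm_shell_def)
qed

lemma ideal_count_0: "ideal_count D 0 = 0"
  using ideal_norm_pos unfolding ideal_count_def by (metis (mono_tags, lifting) card.empty empty_Collect_eq less_numeral_extra(3))

text \<open>Subtracting 1 discards the zero multiplier, which alone makes up the shell of norm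
  0.\<close>

definition ideal_theta :: "real \<Rightarrow> real \<Rightarrow> complex" where
  "ideal_theta t x = (\<Sum>L\<in>class_reps. (multiplier_theta L t x - 1) / of_nat (unit_count L))"

lemma ideal_theta_sums:
  assumes t: "t > 0"
  shows "(\<lambda>n. of_nat (ideal_count D n) * exp (- of_nat n * Complex t (2 * pi * x))) sums ideal_theta t x"
proof -
  let ?e = "\<lambda>n. exp (- of_nat n * Complex t (2 * pi * x))"
  have one: "(\<lambda>n. (of_nat (card (norm_shell L n)) * ?e n - (if n = 0 then 1 else 0)) / of_nat (unit_count L))
      sums ((multiplier_theta L t x - 1) / of_nat (unit_count L))" if "L \<in> class_reps" for L
    by (intro sums_divide sums_diff has_sum_imp_sums norm_shell_has_sum class_reps_overmodules that t sums_single)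
  have "(\<lambda>n. \<Sum>L\<in>class_reps. (of_nat (card (norm_shell L n)) * ?e n - (if n = 0 then 1 else 0)) / of_nat (unit_count L))
      sums ideal_theta t x"
    unfolding ideal_theta_def by (intro sums_sum one)
  moreover have "(\<Sum>L\<in>class_reps. (of_nat (card (norm_shell L n)) * ?e n - (if n = 0 then 1 else 0)) / of_nat (unit_count L))
      = of_nat (ideal_count D n) * ?e n" for n
  proof (cases "n = 0")
    case True
    then show ?thesis by (auto simp: ideal_count_0 norm_shell_0 class_reps_overmodules intro!: sum.neutral)
  next
    case False
    have "complex_of_real (real (ideal_count D n)) = (\<Sum>L\<in>class_reps. of_nat (card (norm_shell L n)) / of_nat (unit_count L))"
      unfolding ideal_count_eq[OF False[unfolded neq0_conv]] norm_shell_def by simp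
    then show ?thesis using False by (simp add: sum_distrib_right)
  qed
  ultimately show ?thesis by simp
qed

lemma summable_ideal_count_exp:
  assumes t: "t > 0"
  shows "summable (\<lambda>n. real (ideal_count D n) * exp (- real n * t))"
proof -
  have "summable (\<lambda>n. of_nat (ideal_count D n) * exp (- of_nat n * Complex t (2 * pi * 0)))"
    using ideal_theta_sums[OF t, of 0] by (rule sums_summable)
  then have "summable (\<lambda>n. Re (of_nat (ideal_count D n) * exp (- of_nat n * Complex t (2 * pi * 0))))"
    by (rule summable_Re)
  moreover have "Complex t (2 * pi * 0) = of_real t" by (simp add: complex_eq_iff)
  moreover have "Re (of_nat m * exp (- of_nat n * complex_of_real t)) = real m * exp (- real n * t)" for m n
  proof -
    have "of_nat m * exp (- of_nat n * complex_of_real t) = of_real (real m * exp (- real n * t))"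
      by (simp add: exp_of_real[symmetric])
    then show ?thesis by (simp only: Re_complex_of_real)
  qed
  ultimately show ?thesis by (simp only:)
qed

text \<open>A common multiple of the frequencies that arise from all the progressions.\<close>
definition kernel_modulus :: nat where
  "kernel_modulus = 2 * denom\<^sup>2 * fact index_bound * nat (- D)"

lemma kernel_modulus_pos: "kernel_modulus > 0"
  using D_neg by (simp add: kernel_modulus_def)

text \<open>Each theta factor is controlled through its square. As
  \<open>2 * u * v <= u^2 + v^2\<close>, the product of two factors is bounded by the first power of
  the same expression.\<close>

lemma multiplier_theta_bound:
  assumes L: "L \<in> overmodules"
  obtains C where "C > 0" "\<And>j t x v. t \<ge> (1/4) ^ j \<Longrightarrow>
    (\<And>l. kernel_sum (2 ^ (j + l)) (real kernel_modulus * x) \<le> v l) \<Longrightarrow> summable (\<lambda>l. (1/4) ^ l * v l) \<Longrightarrow>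
    cmod (multiplier_theta L t x) \<le> C * (2 ^ j + (\<Sum>l. (1/4) ^ l * v l))"
proof -
  let ?A = "period L" and ?k = "add_index L OK"
  have k: "0 < ?k" "?k \<le> index_bound" using L by (auto simp: overmodules_def)
  have A: "?A \<ge> 1" using period_pos[OF L] by simp
  have "?k dvd fact index_bound" using k by (intro dvd_fact) auto
  then obtain e where e: "fact index_bound = ?k * e" by (auto elim: dvdE)
  have e0: "e > 0" using e by (metis fact_nonzero gr0I mult_0_right)
  \<comment> \<open>Both diagonal coefficients are completed to the same modulus, the first with
    \<open>d = nat (- D) * e\<close> and the second with \<open>d = e\<close>. Hence one family of
    kernel sums controls both theta factors.\<close>
  have c1: "real kernel_modulus = 2 * weight1 L * (real ?A)\<^sup>2 * real (nat (- D) * e)"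
    using k e by (simp add: kernel_modulus_def weight1_def period_def power2_eq_square field_simps)
  have c2: "real kernel_modulus = 2 * weight2 L * (real ?A)\<^sup>2 * real e"
    using k e by (simp add: kernel_modulus_def weight2_def period_def power2_eq_square field_simps)
  obtain C1 where C1: "C1 > 0" "\<And>a A j t x d c v. 0 \<le> a \<Longrightarrow> a \<le> int A \<Longrightarrow> A \<ge> 1 \<Longrightarrow> t \<ge> (1/4) ^ j \<Longrightarrow> d > 0 \<Longrightarrow>
    c = 2 * weight1 L * (real A)\<^sup>2 * real d \<Longrightarrow>
    (\<And>l. kernel_sum (2 ^ (j + l)) (c * x) \<le> v l) \<Longrightarrow> summable (\<lambda>l. (1/4) ^ l * v l) \<Longrightarrow>
    (cmod (progression_theta (weight1 L) a A t x))\<^sup>2 \<le> C1 * real d * (2 ^ j + (\<Sum>l. (1/4) ^ l * v l))"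
    by (rule progression_theta_bound[OF weights_pos(1)[OF L]]) (blast intro: that)
  obtain C2 where C2: "C2 > 0" "\<And>a A j t x d c v. 0 \<le> a \<Longrightarrow> a \<le> int A \<Longrightarrow> A \<ge> 1 \<Longrightarrow> t \<ge> (1/4) ^ j \<Longrightarrow> d > 0 \<Longrightarrow>
    c = 2 * weight2 L * (real A)\<^sup>2 * real d \<Longrightarrow>
    (\<And>l. kernel_sum (2 ^ (j + l)) (c * x) \<le> v l) \<Longrightarrow> summable (\<lambda>l. (1/4) ^ l * v l) \<Longrightarrow>
    (cmod (progression_theta (weight2 L) a A t x))\<^sup>2 \<le> C2 * real d * (2 ^ j + (\<Sum>l. (1/4) ^ l * v l))"
    by (rule progression_theta_bound[OF weights_pos(2)[OF L]]) (blast intro: that)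
  define B where "B = C1 * real (nat (- D) * e) + C2 * real e"
  have "nat (- D) * e > 0" using e0 D_neg by simp
  then have B: "B > 0" unfolding B_def using C1(1) C2(1) e0
    by (intro add_pos_pos mult_pos_pos) (simp_all only: of_nat_0_less_iff)
  define C where "C = (1 + real (card (residue_pairs L))) * B"
  have main: "cmod (multiplier_theta L t x) \<le> C * (2 ^ j + (\<Sum>l. (1/4) ^ l * v l))"
    if t: "t \<ge> (1/4) ^ j" and v: "\<And>l. kernel_sum (2 ^ (j + l)) (real kernel_modulus * x) \<le> v l"
      and sm: "summable (\<lambda>l. (1/4) ^ l * v l)" for j t x v
  proof -
    let ?V = "2 ^ j + (\<Sum>l. (1/4) ^ l * v l)"
    have v0: "v l \<ge> 0" for l using v[of l] kernel_sum_nonneg[of "2 ^ (j + l)" "real kernel_modulus * x"] by linarith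
    have V: "?V \<ge> 0" using sm v0 by (intro add_nonneg_nonneg suminf_nonneg) auto
    have "cmod (case p of (a, b) \<Rightarrow> progression_theta (weight1 L) a ?A t x * progression_theta (weight2 L) b ?A t x) \<le> B * ?V"
      if "p \<in> residue_pairs L" for p
    proof -
      obtain a b where p: "p = (a, b)" by force
      have r: "0 \<le> a" "a \<le> int ?A" "0 \<le> b" "b \<le> int ?A" using that by (auto simp: residue_pairs_def p)
      let ?T1 = "progression_theta (weight1 L) a ?A t x" and ?T2 = "progression_theta (weight2 L) b ?A t x"
      have "(cmod ?T1)\<^sup>2 \<le> C1 * real (nat (- D) * e) * ?V"
        by (rule C1(2)[OF r(1,2) A t _ c1 v sm]) (use e0 D_neg in auto)
      moreover have "(cmod ?T2)\<^sup>2 \<le> C2 * real e * ?V"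
        by (rule C2(2)[OF r(3,4) A t _ c2 v sm]) (use e0 in auto)
      ultimately have "(cmod ?T1)\<^sup>2 + (cmod ?T2)\<^sup>2 \<le> B * ?V"
        unfolding B_def by (simp only: distrib_right)
      moreover have "2 * (cmod ?T1 * cmod ?T2) \<le> (cmod ?T1)\<^sup>2 + (cmod ?T2)\<^sup>2"
        using sum_squares_bound[of "cmod ?T1" "cmod ?T2"] by simp
      moreover have "0 \<le> cmod ?T1 * cmod ?T2" by simp
      ultimately have "cmod ?T1 * cmod ?T2 \<le> B * ?V" by linarith
      then show ?thesis by (simp add: p norm_mult)
    qed
    then have "cmod (multiplier_theta L t x) \<le> (\<Sum>p\<in>residue_pairs L. B * ?V)"
      unfolding multiplier_theta_def by (rule sum_norm_le)
    also have "\<dots> = real (card (residue_pairs L)) * (B * ?V)" by simp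
    also have "\<dots> \<le> (1 + real (card (residue_pairs L))) * (B * ?V)"
      using B V by (intro mult_right_mono mult_nonneg_nonneg) auto
    finally show ?thesis by (simp add: C_def mult.assoc)
  qed
  have "C > 0" using B by (simp add: C_def add_pos_nonneg)
  then show ?thesis using that main by blast
qed

theorem ideal_theta_bound:
  obtains C where "C > 0" "\<And>j t x v. t \<ge> (1/4) ^ j \<Longrightarrow>
    (\<And>l. kernel_sum (2 ^ (j + l)) (real kernel_modulus * x) \<le> v l) \<Longrightarrow> summable (\<lambda>l. (1/4) ^ l * v l) \<Longrightarrow>
    cmod (ideal_theta t x) \<le> C * (2 ^ j + (\<Sum>l. (1/4) ^ l * v l))"
proof -
  have "\<forall>L\<in>class_reps. \<exists>C>0. \<forall>j t x v. t \<ge> (1/4) ^ j \<longrightarrow>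
    (\<forall>l. kernel_sum (2 ^ (j + l)) (real kernel_modulus * x) \<le> v l) \<longrightarrow> summable (\<lambda>l. (1/4) ^ l * v l) \<longrightarrow>
    cmod (multiplier_theta L t x) \<le> C * (2 ^ j + (\<Sum>l. (1/4) ^ l * v l))"
  proof
    fix L assume "L \<in> class_reps"
    then have L: "L \<in> overmodules" by (rule class_reps_overmodules)
    show "\<exists>C>0. \<forall>j t x v. t \<ge> (1/4) ^ j \<longrightarrow>
      (\<forall>l. kernel_sum (2 ^ (j + l)) (real kernel_modulus * x) \<le> v l) \<longrightarrow> summable (\<lambda>l. (1/4) ^ l * v l) \<longrightarrow>
      cmod (multiplier_theta L t x) \<le> C * (2 ^ j + (\<Sum>l. (1/4) ^ l * v l))"
      by (rule multiplier_theta_bound[OF L]) blast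
  qed
  from bchoice[OF this] obtain C where C_all: "\<forall>L\<in>class_reps. C L > 0 \<and> (\<forall>j t x v. t \<ge> (1/4) ^ j \<longrightarrow>
    (\<forall>l. kernel_sum (2 ^ (j + l)) (real kernel_modulus * x) \<le> v l) \<longrightarrow> summable (\<lambda>l. (1/4) ^ l * v l) \<longrightarrow>
    cmod (multiplier_theta L t x) \<le> C L * (2 ^ j + (\<Sum>l. (1/4) ^ l * v l)))" ..
  have C: "C L > 0" "\<And>j t x v. t \<ge> (1/4) ^ j \<Longrightarrow>
    (\<And>l. kernel_sum (2 ^ (j + l)) (real kernel_modulus * x) \<le> v l) \<Longrightarrow> summable (\<lambda>l. (1/4) ^ l * v l) \<Longrightarrow>
    cmod (multiplier_theta L t x) \<le> C L * (2 ^ j + (\<Sum>l. (1/4) ^ l * v l))" if "L \<in> class_reps" for L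
    using bspec[OF C_all that] by simp_all
  \<comment> \<open>The 1 inside the sum pays for the term subtracted in \<open>ideal_theta\<close>;
    the outer 1 makes the constant positive whatever the set of classes.\<close>
  define C' where "C' = 1 + (\<Sum>L\<in>class_reps. C L + 1)"
  have C0: "(\<Sum>L\<in>class_reps. C L + 1) \<ge> 0" using C(1) by (intro sum_nonneg) (simp add: add_nonneg_nonneg less_imp_le)
  have main: "cmod (ideal_theta t x) \<le> C' * (2 ^ j + (\<Sum>l. (1/4) ^ l * v l))"
    if t: "t \<ge> (1/4) ^ j" and v: "\<And>l. kernel_sum (2 ^ (j + l)) (real kernel_modulus * x) \<le> v l"
      and sm: "summable (\<lambda>l. (1/4) ^ l * v l)" for j t x v
  proof -
    let ?V = "2 ^ j + (\<Sum>l. (1/4) ^ l * v l)"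
    have v0: "v l \<ge> 0" for l using v[of l] kernel_sum_nonneg[of "2 ^ (j + l)" "real kernel_modulus * x"] by linarith
    have "(\<Sum>l. (1/4) ^ l * v l) \<ge> 0" using sm v0 by (intro suminf_nonneg) auto
    moreover have "(1::real) \<le> 2 ^ j" by simp
    ultimately have V: "?V \<ge> 1" by linarith
    have "cmod ((multiplier_theta L t x - 1) / of_nat (unit_count L)) \<le> (C L + 1) * ?V" if L: "L \<in> class_reps" for L
    proof -
      have "real (unit_count L) \<ge> 1" using unit_count_pos[OF class_reps_overmodules[OF L]] by simp
      then have "cmod ((multiplier_theta L t x - 1) / of_nat (unit_count L)) \<le> cmod (multiplier_theta L t x - 1) / 1"
        unfolding norm_divide by (intro divide_left_mono) auto
      also have "\<dots> \<le> cmod (multiplier_theta L t x) + 1" using norm_triangle_ineq4[of "multiplier_theta L t x" 1] by simp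
      also have "\<dots> \<le> C L * ?V + 1 * ?V" unfolding mult_1 by (rule add_mono[OF C(2)[OF L t v sm] V])
      finally show ?thesis by (simp only: distrib_right)
    qed
    then have "cmod (ideal_theta t x) \<le> (\<Sum>L\<in>class_reps. (C L + 1) * ?V)"
      unfolding ideal_theta_def by (rule sum_norm_le)
    also have "\<dots> = (\<Sum>L\<in>class_reps. C L + 1) * ?V" by (simp only: sum_distrib_right)
    also have "\<dots> \<le> C' * ?V" using V by (intro mult_right_mono) (auto simp: C'_def)
    finally show ?thesis .
  qed
  have "C' > 0" using C0 by (simp add: C'_def)
  then show ?thesis using that main by blast
qed

end

section \<open>Trigonometric series on the unit interval\<close>

definition character :: "nat \<Rightarrow> real \<Rightarrow> complex" where
  "character n x = exp (- 2 * of_real pi * \<i> * of_real x * of_nat n)"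

lemma norm_character [simp]: "cmod (character n x) = 1"
  by (simp add: character_def)

definition trig_sum :: "nat set \<Rightarrow> (nat \<Rightarrow> real) \<Rightarrow> real \<Rightarrow> complex" where
  "trig_sum A a x = (\<Sum>n\<in>A. of_real (a n) * character n x)"

lemma continuous_trig_sum: "continuous_on S (trig_sum A a)"
  unfolding trig_sum_def character_def by (intro continuous_intros)

lemma borel_measurable_trig_sum [measurable]: "trig_sum A a \<in> borel_measurable borel"
  by (rule borel_measurable_continuous_onI[OF continuous_trig_sum])

lemma character_orthogonal:
  "((\<lambda>x. character n x * cnj (character m x)) has_integral (if n = m then 1 else 0)) {0..1}"
proof (cases "n = m")
  case True
  have "character n x * cnj (character n x) = 1" for x
    by (simp add: complex_norm_square[symmetric])
  then show ?thesis using True has_integral_const_real[of "1::complex" 0 1] by simp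
next
  case False
  define w where "w = 2 * of_real pi * \<i> * of_int (int m - int n)"
  have w: "w \<noteq> 0" using False by (simp add: w_def)
  have eq: "character n x * cnj (character m x) = exp (w * of_real x)" for x
    by (simp add: character_def exp_cnj w_def flip: exp_add) (simp add: algebra_simps)
  have "exp w = 1"
    unfolding w_def using exp_integer_2pi[of "of_int (int m - int n)"] by (simp add: mult_ac)
  have "((\<lambda>x. exp (w * of_real x)) has_integral (exp (w * of_real 1) / w - exp (w * of_real 0) / w)) {0..1}"
  proof (rule fundamental_theorem_of_calculus)
    fix x :: real
    have "((\<lambda>z. exp (w * z) / w) has_field_derivative exp (w * of_real x)) (at (of_real x))"
      using w by (auto intro!: derivative_eq_intros)
    then have "((\<lambda>x. exp (w * of_real x) / w) has_vector_derivative exp (w * of_real x)) (at x)"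
      by (rule has_vector_derivative_real_field)
    then show "((\<lambda>x. exp (w * of_real x) / w) has_vector_derivative exp (w * of_real x)) (at x within {0..1})"
      by (rule has_vector_derivative_at_within)
  qed simp
  then show ?thesis using \<open>exp w = 1\<close> False by (simp add: eq)
qed

abbreviation unit_measure :: "real measure" where
  "unit_measure \<equiv> restrict_space lborel {0..1}"

lemma LINT_unit_measure: "(LINT x:{0..1}|lborel. h x) = integral\<^sup>L unit_measure h"
  for h :: "real \<Rightarrow> real"
  unfolding set_lebesgue_integral_def by (subst integral_restrict_space) auto

lemma set_integrable_unit_measure: "set_integrable lborel {0..1} h \<longleftrightarrow> integrable unit_measure h"
  for h :: "real \<Rightarrow> real"
  unfolding set_integrable_def by (subst integrable_restrict_space) auto

lemma measure_unit_measure: "A \<subseteq> {0..1} \<Longrightarrow> measure unit_measure A = measure lborel A"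
  by (rule measure_restrict_space) auto

interpretation unit_measure: finite_measure unit_measure
  by (rule finite_measureI) (simp add: emeasure_restrict_space space_restrict_space)

lemma measurable_unit_measure: "f \<in> borel_measurable borel \<Longrightarrow> f \<in> borel_measurable unit_measure"
  by (intro measurable_restrict_space1) simp

lemma measure_unit_measure_space: "measure unit_measure (space unit_measure) = 1"
  by (simp add: measure_restrict_space space_restrict_space)

lemma trig_sum_norm_le: "cmod (trig_sum A a x) \<le> (\<Sum>n\<in>A. \<bar>a n\<bar>)"
  unfolding trig_sum_def by (rule sum_norm_le) (simp add: norm_mult)

lemma integrable_trig_sum_square: "integrable unit_measure (\<lambda>x. (cmod (trig_sum A a x))\<^sup>2)"
proof (rule unit_measure.integrable_const_bound[of _ "(\<Sum>n\<in>A. \<bar>a n\<bar>)\<^sup>2"])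
  show "AE x in unit_measure. norm ((cmod (trig_sum A a x))\<^sup>2) \<le> (\<Sum>n\<in>A. \<bar>a n\<bar>)\<^sup>2"
    using trig_sum_norm_le by (auto intro!: AE_I2 power_mono)
  show "(\<lambda>x. (cmod (trig_sum A a x))\<^sup>2) \<in> borel_measurable unit_measure"
    by (rule measurable_unit_measure) measurable
qed

lemma parseval_trig_sum:
  assumes A: "finite A"
  shows "(\<integral>x. (cmod (trig_sum A a x))\<^sup>2 \<partial>unit_measure) = (\<Sum>n\<in>A. (a n)\<^sup>2)"
proof -
  have eq: "of_real ((cmod (trig_sum A a x))\<^sup>2)
      = (\<Sum>n\<in>A. \<Sum>m\<in>A. of_real (a n * a m) * (character n x * cnj (character m x)))" for x
    unfolding complex_norm_square trig_sum_def
    by (simp add: sum_product mult_ac)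
  have "((\<lambda>x. \<Sum>n\<in>A. \<Sum>m\<in>A. of_real (a n * a m) * (character n x * cnj (character m x)))
      has_integral (\<Sum>n\<in>A. \<Sum>m\<in>A. of_real (a n * a m) * (if n = m then 1 else 0))) {0..1}"
    using A by (intro has_integral_sum has_integral_mult_right character_orthogonal)
  also have "(\<Sum>n\<in>A. \<Sum>m\<in>A. complex_of_real (a n * a m) * (if n = m then 1 else 0)) = of_real (\<Sum>n\<in>A. (a n)\<^sup>2)"
    using A by (simp add: power2_eq_square if_distrib cong: if_cong)
  finally have "((\<lambda>x. complex_of_real ((cmod (trig_sum A a x))\<^sup>2)) has_integral of_real (\<Sum>n\<in>A. (a n)\<^sup>2)) {0..1}"
    by (simp only: eq)
  from has_integral_linear[OF this bounded_linear_Re]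
  have hi: "((\<lambda>x. (cmod (trig_sum A a x))\<^sup>2) has_integral (\<Sum>n\<in>A. (a n)\<^sup>2)) {0..1}"
    by (simp add: o_def)
  have "set_integrable lborel {0..1} (\<lambda>x. (cmod (trig_sum A a x))\<^sup>2)"
    unfolding set_integrable_unit_measure by (rule integrable_trig_sum_square)
  from set_borel_integral_eq_integral(2)[OF this] show ?thesis
    unfolding LINT_unit_measure using integral_unique[OF hi] by simp
qed

text \<open>A single polynomial over the union of both index sets, so that Parseval applies to
  differences.\<close>

lemma trig_sum_diff:
  assumes "finite A" "finite B"
  shows "trig_sum A a x - trig_sum B b x
    = trig_sum (A \<union> B) (\<lambda>n. (if n \<in> A then a n else 0) - (if n \<in> B then b n else 0)) x"
proof -
  have "trig_sum A a x = trig_sum (A \<union> B) (\<lambda>n. if n \<in> A then a n else 0) x"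
    unfolding trig_sum_def using assms by (intro sum.mono_neutral_cong_left) auto
  moreover have "trig_sum B b x = trig_sum (A \<union> B) (\<lambda>n. if n \<in> B then b n else 0) x"
    unfolding trig_sum_def using assms by (intro sum.mono_neutral_cong_left) auto
  ultimately show ?thesis
    by (simp add: trig_sum_def sum_subtractf left_diff_distrib)
qed

section \<open>Partial sums of a series with square-summable coefficients\<close>

locale square_summable =
  fixes c :: "nat \<Rightarrow> real"
  assumes c_summable: "summable (\<lambda>n. (c n)\<^sup>2)"
begin

abbreviation P :: "nat \<Rightarrow> real \<Rightarrow> complex" where "P N \<equiv> trig_sum {1..N} c"

definition tail :: "nat \<Rightarrow> real" where "tail N = (\<Sum>n. (c n)\<^sup>2) - (\<Sum>n<Suc N. (c n)\<^sup>2)"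

lemma tail_nonneg: "tail N \<ge> 0"
  unfolding tail_def using sum_le_suminf[OF c_summable, of "{..<Suc N}"] by simp

lemma tail_tendsto: "tail \<longlonglongrightarrow> 0"
proof -
  have "(\<lambda>N. (\<Sum>n. (c n)\<^sup>2) - (\<Sum>n<Suc N. (c n)\<^sup>2)) \<longlonglongrightarrow> (\<Sum>n. (c n)\<^sup>2) - (\<Sum>n. (c n)\<^sup>2)"
    by (intro tendsto_diff tendsto_const LIMSEQ_Suc[OF summable_LIMSEQ[OF c_summable]])
  then show ?thesis by (simp add: tail_def[abs_def])
qed

lemma sum_le_tail:
  assumes "finite A" "A \<subseteq> {N<..}"
  shows "(\<Sum>n\<in>A. (c n)\<^sup>2) \<le> tail N"
proof -
  have "(\<Sum>n\<in>A. (c n)\<^sup>2) + (\<Sum>n<Suc N. (c n)\<^sup>2) = (\<Sum>n\<in>A \<union> {..<Suc N}. (c n)\<^sup>2)"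
    using assms by (subst sum.union_disjoint) auto
  also have "\<dots> \<le> (\<Sum>n. (c n)\<^sup>2)" using assms by (intro sum_le_suminf c_summable) auto
  finally show ?thesis by (simp add: tail_def)
qed

lemma P_diff: "N \<le> N' \<Longrightarrow> P N' x - P N x = trig_sum {N<..N'} c x"
proof -
  assume N: "N \<le> N'"
  have "{1..N'} = {1..N} \<union> {N<..N'}" using N by auto
  then have "P N' x = P N x + trig_sum {N<..N'} c x"
    unfolding trig_sum_def by (simp only:) (rule sum.union_disjoint, auto)
  then show ?thesis by simp
qed

lemma P_diff_square:
  assumes "N \<le> N'"
  shows "(\<integral>x. (cmod (P N' x - P N x))\<^sup>2 \<partial>unit_measure) \<le> tail N"
proof -
  have "(\<integral>x. (cmod (P N' x - P N x))\<^sup>2 \<partial>unit_measure) = (\<Sum>n\<in>{N<..N'}. (c n)\<^sup>2)"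
    unfolding P_diff[OF assms] by (rule parseval_trig_sum) simp
  also have "\<dots> \<le> tail N" by (rule sum_le_tail) auto
  finally show ?thesis .
qed

text \<open>Riesz-Fischer: along a subsequence with \<open>tail\<close> at most
  \<open>4^(-k)\<close> the consecutive differences have mean at most \<open>2^(-k)\<close>, so they
  sum absolutely almost everywhere. Fatou's lemma then bounds the \<open>L^2\<close> distance of the
  whole sequence from this pointwise limit by \<open>tail\<close>.\<close>

lemma exists_L2_limit:
  obtains g :: "real \<Rightarrow> complex" where "g \<in> borel_measurable borel"
    "integrable unit_measure (\<lambda>x. (cmod (g x))\<^sup>2)"
    "(\<lambda>N. \<integral>x. (cmod (P N x - g x))\<^sup>2 \<partial>unit_measure) \<longlonglongrightarrow> 0"
proof -
  have "\<exists>N. tail N \<le> (1/4) ^ k \<and> N \<ge> k" for k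
  proof -
    have "\<forall>\<^sub>F N in sequentially. tail N < (1/4) ^ k"
      by (rule order_tendstoD(2)[OF tail_tendsto]) simp
    then obtain N1 where "\<And>n. n \<ge> N1 \<Longrightarrow> tail n < (1/4) ^ k"
      unfolding eventually_sequentially by blast
    then have "tail (max N1 k) < (1/4) ^ k" by simp
    then show ?thesis by (intro exI[of _ "max N1 k"]) auto
  qed
  then obtain N0 where N0: "\<And>k. tail (N0 k) \<le> (1/4) ^ k" "\<And>k. N0 k \<ge> k" using choice[of "\<lambda>k N. tail N \<le> (1/4) ^ k \<and> N \<ge> k"] by blast
  have tail_mono: "tail N' \<le> tail N" if "N \<le> N'" for N N'
    unfolding tail_def using that by (intro diff_left_mono sum_mono2) auto
  \<comment> \<open>Summing the indices makes the subsequence monotone and keeps it above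
    \<open>N0 k\<close>.\<close>
  define N where "N k = (\<Sum>i\<le>k. N0 i)" for k
  have N_ge: "N k \<ge> N0 k" for k unfolding N_def by (rule member_le_sum) auto
  have N: "tail (N k) \<le> (1/4) ^ k" "N k \<ge> k" "N k \<le> N (Suc k)" for k
    using tail_mono[OF N_ge[of k]] N0[of k] N_ge[of k] by (auto simp: N_def)
  define f where "f k = P (N k)" for k
  have fm [measurable]: "f k \<in> borel_measurable borel" for k unfolding f_def by measurable
  have fmU [measurable]: "f k \<in> borel_measurable unit_measure" for k by (rule measurable_unit_measure) measurable
  define h where "h k x = cmod (f (Suc k) x - f k x)" for k x
  have hm [measurable]: "h k \<in> borel_measurable borel" for k unfolding h_def by measurable
  have hmU [measurable]: "h k \<in> borel_measurable unit_measure" for k by (rule measurable_unit_measure) measurable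
  have hint: "(\<integral>\<^sup>+x. ennreal (h k x) \<partial>unit_measure) \<le> ennreal ((1/2) ^ k)" for k
  proof -
    have i2: "integrable unit_measure (\<lambda>x. (h k x)\<^sup>2)"
      unfolding h_def f_def P_diff[OF N(3)] by (rule integrable_trig_sum_square)
    \<comment> \<open>A weighted arithmetic-geometric mean takes the place of the Cauchy-Schwarz
      inequality; the weight \<open>2 ^ k\<close> balances a mean square of size
      \<open>4^(-k)\<close>.\<close>
    have ineq: "h k x \<le> (2 ^ k * (h k x)\<^sup>2 + (1/2) ^ k) / 2" for x
    proof -
      have "0 \<le> (1/2) ^ k * (2 ^ k * h k x - 1)\<^sup>2" by simp
      also have "\<dots> = 2 ^ k * (h k x)\<^sup>2 + (1/2) ^ k - 2 * h k x"
        by (simp add: power2_eq_square power_one_over field_simps)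
      finally show ?thesis by simp
    qed
    have "(\<integral>\<^sup>+x. ennreal (h k x) \<partial>unit_measure) \<le> (\<integral>\<^sup>+x. ennreal ((2 ^ k * (h k x)\<^sup>2 + (1/2) ^ k) / 2) \<partial>unit_measure)"
      by (intro nn_integral_mono ennreal_leI ineq)
    also have "\<dots> = ennreal (\<integral>x. (2 ^ k * (h k x)\<^sup>2 + (1/2) ^ k) / 2 \<partial>unit_measure)"
      by (intro nn_integral_eq_integral AE_I2) (use i2 in auto)
    also have "(\<integral>x. (2 ^ k * (h k x)\<^sup>2 + (1/2) ^ k) / 2 \<partial>unit_measure)
        = (2 ^ k * (\<integral>x. (h k x)\<^sup>2 \<partial>unit_measure) + (1/2) ^ k) / 2"
      using i2 measure_unit_measure_space by simp
    also have "\<dots> \<le> (2 ^ k * (1/4) ^ k + (1/2) ^ k) / 2"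
    proof (intro divide_right_mono add_right_mono mult_left_mono)
      show "(\<integral>x. (h k x)\<^sup>2 \<partial>unit_measure) \<le> (1/4) ^ k"
        using P_diff_square[OF N(3)[of k]] N(1)[of k] unfolding h_def f_def by linarith
    qed auto
    also have "\<dots> = (1/2) ^ k"
    proof -
      have "(2::real) ^ k * (1/4) ^ k = (1/2) ^ k" by (simp flip: power_mult_distrib)
      then show ?thesis by simp
    qed
    finally show ?thesis by (simp add: ennreal_leI)
  qed
  have "(\<integral>\<^sup>+x. (\<Sum>k. ennreal (h k x)) \<partial>unit_measure) = (\<Sum>k. \<integral>\<^sup>+x. ennreal (h k x) \<partial>unit_measure)"
    by (rule nn_integral_suminf) measurable
  also have "\<dots> \<le> (\<Sum>k. ennreal ((1/2) ^ k))" by (intro suminf_le hint) auto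
  also have "\<dots> = ennreal (\<Sum>k. (1/2) ^ k)" by (rule suminf_ennreal2) (auto intro!: summable_geometric)
  also have "\<dots> < \<infinity>" by simp
  finally have "AE x in unit_measure. (\<Sum>k. ennreal (h k x)) \<noteq> \<infinity>"
    by (intro nn_integral_PInf_AE) auto
  then have conv: "AE x in unit_measure. convergent (\<lambda>k. f k x)"
  proof (rule AE_mp, intro AE_I2 impI)
    fix x assume "(\<Sum>k. ennreal (h k x)) \<noteq> \<infinity>"
    then have "summable (\<lambda>k. h k x)" by (intro summable_suminf_not_top) (auto simp: h_def)
    then have "summable (\<lambda>k. f (Suc k) x - f k x)" unfolding h_def by (rule summable_norm_cancel)
    then have "convergent (\<lambda>n. \<Sum>k<n. f (Suc k) x - f k x)" by (simp add: summable_iff_convergent)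
    then have "convergent (\<lambda>n. f n x - f 0 x)"
      by (subst (asm) sum_lessThan_telescope[of "\<lambda>k. f k x"])
    then have "convergent (\<lambda>n. (f n x - f 0 x) + f 0 x)" by (intro convergent_add convergent_const)
    then show "convergent (\<lambda>n. f n x)" by simp
  qed
  define g where "g x = lim (\<lambda>k. f k x)" for x
  have gm [measurable]: "g \<in> borel_measurable borel" unfolding g_def by measurable
  have gmU [measurable]: "g \<in> borel_measurable unit_measure" by (rule measurable_unit_measure) (rule gm)
  have PU [measurable]: "P n \<in> borel_measurable unit_measure" for n by (rule measurable_unit_measure) measurable
  have fatou: "(\<integral>\<^sup>+x. ennreal ((cmod (P n x - g x))\<^sup>2) \<partial>unit_measure) \<le> ennreal (tail n)" for n
  proof -
    have "(\<integral>\<^sup>+x. ennreal ((cmod (P n x - g x))\<^sup>2) \<partial>unit_measure)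
        = (\<integral>\<^sup>+x. liminf (\<lambda>k. ennreal ((cmod (P n x - f k x))\<^sup>2)) \<partial>unit_measure)"
    proof (rule nn_integral_cong_AE, rule AE_mp[OF conv], intro AE_I2 impI)
      fix x assume "convergent (\<lambda>k. f k x)"
      then have "(\<lambda>k. f k x) \<longlonglongrightarrow> g x" unfolding g_def by (rule convergent_LIMSEQ_iff[THEN iffD1])
      then have "(\<lambda>k. ennreal ((cmod (P n x - f k x))\<^sup>2)) \<longlonglongrightarrow> ennreal ((cmod (P n x - g x))\<^sup>2)"
        by (intro tendsto_intros)
      then show "ennreal ((cmod (P n x - g x))\<^sup>2) = liminf (\<lambda>k. ennreal ((cmod (P n x - f k x))\<^sup>2))"
        by (metis lim_imp_Liminf trivial_limit_sequentially)
    qed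
    also have "\<dots> \<le> liminf (\<lambda>k. \<integral>\<^sup>+x. ennreal ((cmod (P n x - f k x))\<^sup>2) \<partial>unit_measure)"
      by (rule nn_integral_liminf) measurable
    also have "\<dots> \<le> ennreal (tail n)"
    proof -
      have "\<forall>\<^sub>F k in sequentially. (\<integral>\<^sup>+x. ennreal ((cmod (P n x - f k x))\<^sup>2) \<partial>unit_measure) \<le> ennreal (tail n)"
      proof (rule eventually_sequentiallyI[of n])
        fix k assume "n \<le> k"
        then have nk: "n \<le> N k" using N(2)[of k] by linarith
        have eq: "(cmod (P n x - f k x))\<^sup>2 = (cmod (P (N k) x - P n x))\<^sup>2" for x
          by (simp add: f_def norm_minus_commute)
        have "integrable unit_measure (\<lambda>x. (cmod (P (N k) x - P n x))\<^sup>2)"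
          unfolding P_diff[OF nk] by (rule integrable_trig_sum_square)
        then have "(\<integral>\<^sup>+x. ennreal ((cmod (P n x - f k x))\<^sup>2) \<partial>unit_measure)
            = ennreal (\<integral>x. (cmod (P (N k) x - P n x))\<^sup>2 \<partial>unit_measure)"
          unfolding eq by (rule nn_integral_eq_integral) auto
        then show "(\<integral>\<^sup>+x. ennreal ((cmod (P n x - f k x))\<^sup>2) \<partial>unit_measure) \<le> ennreal (tail n)"
          using P_diff_square[OF nk] by (simp add: ennreal_leI)
      qed
      from Liminf_mono[OF this] show ?thesis by (simp add: Liminf_const)
    qed
    finally show ?thesis .
  qed
  have int_diff: "integrable unit_measure (\<lambda>x. (cmod (P n x - g x))\<^sup>2)" for n
  proof (rule integrableI_bounded)
    have "(\<integral>\<^sup>+x. ennreal (norm ((cmod (P n x - g x))\<^sup>2)) \<partial>unit_measure) \<le> ennreal (tail n)"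
      using fatou[of n] by simp
    also have "\<dots> < \<infinity>" by simp
    finally show "(\<integral>\<^sup>+x. ennreal (norm ((cmod (P n x - g x))\<^sup>2)) \<partial>unit_measure) < \<infinity>" .
  qed measurable
  have le: "(\<integral>x. (cmod (P n x - g x))\<^sup>2 \<partial>unit_measure) \<le> tail n" for n
  proof -
    have "ennreal (\<integral>x. (cmod (P n x - g x))\<^sup>2 \<partial>unit_measure) \<le> ennreal (tail n)"
      using fatou[of n] nn_integral_eq_integral[OF int_diff[of n]] by simp
    then show ?thesis using tail_nonneg[of n] by simp
  qed
  have "integrable unit_measure (\<lambda>x. (cmod (g x))\<^sup>2)"
  proof (rule Bochner_Integration.integrable_bound)
    show "integrable unit_measure (\<lambda>x. 2 * (cmod (P 0 x - g x))\<^sup>2 + 2 * (cmod (P 0 x))\<^sup>2)"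
      using int_diff[of 0] integrable_trig_sum_square[of "{1..0}" c] by auto
    show "AE x in unit_measure. norm ((cmod (g x))\<^sup>2) \<le> norm (2 * (cmod (P 0 x - g x))\<^sup>2 + 2 * (cmod (P 0 x))\<^sup>2)"
      by (intro AE_I2) (simp add: trig_sum_def)
  qed measurable
  moreover have "(\<lambda>N. \<integral>x. (cmod (P N x - g x))\<^sup>2 \<partial>unit_measure) \<longlonglongrightarrow> 0"
    by (rule tendsto_sandwich[OF _ _ tendsto_const tail_tendsto]) (use le in \<open>auto intro!: always_eventually integral_nonneg_AE\<close>)
  ultimately show ?thesis using that gm by blast
qed

end

section \<open>From a uniform weak-type bound to the limit\<close>

text \<open>The \<open>f J\<close> will be normalised coefficients of truncated Mellin integrals,
  the \<open>c\<close> those of the series. Measure \<open>4^(-I)\<close> at level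
  \<open>Q^I\<close> is the weak-type bound on a geometric scale, and \<open>Q < 2\<close> says that
  its exponent exceeds 2.\<close>

locale weak_approximation =
  fixes c :: "nat \<Rightarrow> real" and f :: "nat \<Rightarrow> nat \<Rightarrow> real" and M :: "nat \<Rightarrow> nat" and K Q :: real
  assumes f_nonneg: "\<And>J n. 0 \<le> f J n" and f_le: "\<And>J n. n \<ge> 1 \<Longrightarrow> f J n \<le> c n"
    and f_tendsto: "\<And>n. n \<ge> 1 \<Longrightarrow> (\<lambda>J. f J n) \<longlonglongrightarrow> c n" and M_ge: "\<And>J. M J \<ge> J"
    and K_pos: "K > 0" and Q_gt_1: "Q > 1" and Q_less_2: "Q < 2"
    and weak_bound: "\<And>J I. measure lborel {x \<in> {0..1}. cmod (trig_sum {1..M J} (f J) x) > K * Q ^ I} \<le> K * (1/4) ^ I"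
begin

abbreviation F :: "nat \<Rightarrow> real \<Rightarrow> complex" where "F J \<equiv> trig_sum {1..M J} (f J)"

lemma superlevel_sets:
  assumes "g \<in> borel_measurable borel"
  shows "{x \<in> {0..1}. cmod (g x) > a} \<in> sets unit_measure"
proof -
  have "g \<in> borel_measurable unit_measure" using assms by (rule measurable_unit_measure)
  then have "{x \<in> space unit_measure. cmod (g x) > a} \<in> sets unit_measure" by measurable
  then show ?thesis by (simp add: space_restrict_space)
qed

text \<open>A layer-cake sum: \<open>K^2\<close> for the part below the first level, then
  \<open>(K * Q^(I+1))^2\<close> times the measure bound \<open>K * 4^(-I)\<close> for each layer.
  The series is geometric because \<open>Q^2 < 4\<close>.\<close>

definition L2_bound :: real where "L2_bound = K\<^sup>2 + K ^ 3 * Q\<^sup>2 * (1 / (1 - Q\<^sup>2 / 4))"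

lemma F_square_le: "(\<integral>x. (cmod (F J x))\<^sup>2 \<partial>unit_measure) \<le> L2_bound"
proof -
  define A where "A I = {x \<in> {0..1}. cmod (F J x) > K * Q ^ I}" for I
  have A [measurable]: "A I \<in> sets unit_measure" for I
    unfolding A_def by (rule superlevel_sets) measurable
  have Am: "measure unit_measure (A I) \<le> K * (1/4) ^ I" for I
    using weak_bound[where J = J and I = I] by (subst measure_unit_measure) (auto simp: A_def)
  define T where "T = (\<Sum>n\<in>{1..M J}. \<bar>f J n\<bar>)"
  \<comment> \<open>A trigonometric polynomial is bounded, so finitely many layers exhaust it; their
    number may depend on \<open>J\<close>, as the geometric sum does not see it.\<close>
  obtain N where N: "T / K < Q ^ N" using real_arch_pow[OF Q_gt_1] by blast
  have trunc: "(min (cmod (F J x)) (K * Q ^ N))\<^sup>2 \<le> K\<^sup>2 + (\<Sum>I<N. K\<^sup>2 * Q\<^sup>2 * (Q\<^sup>2) ^ I * indicator (A I) x)"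
    if x: "x \<in> {0..1}" for x N
  proof (induction N)
    case 0
    then show ?case using K_pos by (auto intro!: power_mono)
  next
    case (Suc N)
    have "(min (cmod (F J x)) (K * Q ^ Suc N))\<^sup>2
        \<le> (min (cmod (F J x)) (K * Q ^ N))\<^sup>2 + K\<^sup>2 * Q\<^sup>2 * (Q\<^sup>2) ^ N * indicator (A N) x"
    proof (cases "cmod (F J x) \<le> K * Q ^ N")
      case True
      then have "min (cmod (F J x)) (K * Q ^ Suc N) \<le> min (cmod (F J x)) (K * Q ^ N)" by simp
      then have "(min (cmod (F J x)) (K * Q ^ Suc N))\<^sup>2 \<le> (min (cmod (F J x)) (K * Q ^ N))\<^sup>2"
        using K_pos Q_gt_1 by (intro power_mono) auto
      moreover have "indicator (A N) x = (0::real)" using True by (simp add: A_def)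
      ultimately show ?thesis by simp
    next
      case False
      then have "indicator (A N) x = (1::real)" using x by (simp add: A_def)
      moreover have "(min (cmod (F J x)) (K * Q ^ Suc N))\<^sup>2 \<le> (K * Q ^ Suc N)\<^sup>2"
        using K_pos Q_gt_1 by (intro power_mono) auto
      moreover have "(K * Q ^ Suc N)\<^sup>2 = K\<^sup>2 * Q\<^sup>2 * (Q\<^sup>2) ^ N"
        by (simp add: power_mult_distrib power_mult[symmetric] mult.commute)
      ultimately show ?thesis using zero_le_power2[of "min (cmod (F J x)) (K * Q ^ N)"]
        by (simp only: mult_1_right)
    qed
    then show ?case using Suc by simp
  qed
  have point: "(cmod (F J x))\<^sup>2 \<le> K\<^sup>2 + (\<Sum>I<N. K\<^sup>2 * Q\<^sup>2 * (Q\<^sup>2) ^ I * indicator (A I) x)" if x: "x \<in> {0..1}" for x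
  proof -
    have "cmod (F J x) \<le> T" unfolding T_def by (rule trig_sum_norm_le)
    also have "T \<le> K * Q ^ N" using N K_pos by (simp add: field_simps)
    finally show ?thesis using trunc[OF x, of N] by simp
  qed
  have int: "integrable unit_measure (\<lambda>x. K\<^sup>2 * Q\<^sup>2 * (Q\<^sup>2) ^ I * indicator (A I) x)" for I
    by (intro integrable_mult_right integrable_real_indicator A)
       (use unit_measure.emeasure_finite in \<open>auto simp: less_top[symmetric]\<close>)
  have "(\<integral>x. (cmod (F J x))\<^sup>2 \<partial>unit_measure) \<le> (\<integral>x. K\<^sup>2 + (\<Sum>I<N. K\<^sup>2 * Q\<^sup>2 * (Q\<^sup>2) ^ I * indicator (A I) x) \<partial>unit_measure)"
  proof (rule integral_mono)
    show "integrable unit_measure (\<lambda>x. K\<^sup>2 + (\<Sum>I<N. K\<^sup>2 * Q\<^sup>2 * (Q\<^sup>2) ^ I * indicator (A I) x))"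
      by (intro Bochner_Integration.integrable_add Bochner_Integration.integrable_sum int) simp
    show "(cmod (F J x))\<^sup>2 \<le> K\<^sup>2 + (\<Sum>I<N. K\<^sup>2 * Q\<^sup>2 * (Q\<^sup>2) ^ I * indicator (A I) x)" if "x \<in> space unit_measure" for x
      using that by (intro point) (simp add: space_restrict_space)
  qed (rule integrable_trig_sum_square)
  also have "\<dots> = K\<^sup>2 + (\<Sum>I<N. K\<^sup>2 * Q\<^sup>2 * (Q\<^sup>2) ^ I * measure unit_measure (A I))"
  proof -
    have ind: "(\<integral>x. K\<^sup>2 * Q\<^sup>2 * (Q\<^sup>2) ^ I * indicator (A I) x \<partial>unit_measure)
        = K\<^sup>2 * Q\<^sup>2 * (Q\<^sup>2) ^ I * measure unit_measure (A I)" for I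
      using sets.sets_into_space[OF A[of I]] by (simp add: Int_absorb2)
    have "(\<integral>x. K\<^sup>2 + (\<Sum>I<N. K\<^sup>2 * Q\<^sup>2 * (Q\<^sup>2) ^ I * indicator (A I) x) \<partial>unit_measure)
        = (\<integral>x. K\<^sup>2 \<partial>unit_measure) + (\<integral>x. (\<Sum>I<N. K\<^sup>2 * Q\<^sup>2 * (Q\<^sup>2) ^ I * indicator (A I) x) \<partial>unit_measure)"
      by (intro Bochner_Integration.integral_add Bochner_Integration.integrable_sum int) simp
    also have "(\<integral>x. (\<Sum>I<N. K\<^sup>2 * Q\<^sup>2 * (Q\<^sup>2) ^ I * indicator (A I) x) \<partial>unit_measure)
        = (\<Sum>I<N. \<integral>x. K\<^sup>2 * Q\<^sup>2 * (Q\<^sup>2) ^ I * indicator (A I) x \<partial>unit_measure)"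
      by (intro Bochner_Integration.integral_sum int)
    also have "\<dots> = (\<Sum>I<N. K\<^sup>2 * Q\<^sup>2 * (Q\<^sup>2) ^ I * measure unit_measure (A I))"
      by (simp only: ind)
    also have "(\<integral>x. K\<^sup>2 \<partial>unit_measure) = K\<^sup>2" using measure_unit_measure_space by simp
    finally show ?thesis .
  qed
  also have "\<dots> \<le> K\<^sup>2 + (\<Sum>I<N. K\<^sup>2 * Q\<^sup>2 * (Q\<^sup>2) ^ I * (K * (1/4) ^ I))"
    using Q_gt_1 by (intro add_left_mono sum_mono mult_left_mono Am) auto
  also have "(\<Sum>I<N. K\<^sup>2 * Q\<^sup>2 * (Q\<^sup>2) ^ I * (K * (1/4) ^ I)) = K ^ 3 * Q\<^sup>2 * (\<Sum>I<N. (Q\<^sup>2 / 4) ^ I)"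
    by (simp add: sum_distrib_left power_divide power2_eq_square power3_eq_cube mult_ac)
  also have "\<dots> \<le> K ^ 3 * Q\<^sup>2 * (1 / (1 - Q\<^sup>2 / 4))"
  proof (rule mult_left_mono)
    have "Q\<^sup>2 < 2\<^sup>2" using Q_gt_1 Q_less_2 by (intro power_strict_mono) auto
    then have q: "norm (Q\<^sup>2 / 4) < 1" by simp
    have "(\<Sum>I<N. (Q\<^sup>2 / 4) ^ I) \<le> (\<Sum>I. (Q\<^sup>2 / 4) ^ I)"
      by (intro sum_le_suminf summable_geometric q) auto
    then show "(\<Sum>I<N. (Q\<^sup>2 / 4) ^ I) \<le> 1 / (1 - Q\<^sup>2 / 4)" using suminf_geometric[OF q] by simp
  qed (use K_pos in auto)
  finally show ?thesis by (simp add: L2_bound_def)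
qed

text \<open>For \<open>J >= N\<close> Parseval bounds the first \<open>N\<close> squared
  coefficients of \<open>F J\<close> by a constant independent of \<open>J\<close>; then
  \<open>J\<close> tends to infinity in this finite sum.\<close>

lemma sum_c_square_le: "(\<Sum>n=1..N. (c n)\<^sup>2) \<le> L2_bound"
proof (rule LIMSEQ_le_const2)
  show "(\<lambda>J. \<Sum>n=1..N. (f J n)\<^sup>2) \<longlonglongrightarrow> (\<Sum>n=1..N. (c n)\<^sup>2)"
    by (intro tendsto_sum tendsto_power f_tendsto) auto
  have "(\<Sum>n=1..N. (f J n)\<^sup>2) \<le> L2_bound" if J: "J \<ge> N" for J
  proof -
    have "(\<Sum>n=1..N. (f J n)\<^sup>2) \<le> (\<Sum>n=1..M J. (f J n)\<^sup>2)"
      using J M_ge[of J] by (intro sum_mono2) auto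
    also have "\<dots> = (\<integral>x. (cmod (F J x))\<^sup>2 \<partial>unit_measure)" by (rule parseval_trig_sum[symmetric]) simp
    also have "\<dots> \<le> L2_bound" by (rule F_square_le)
    finally show ?thesis .
  qed
  then show "\<exists>N'. \<forall>J\<ge>N'. (\<Sum>n=1..N. (f J n)\<^sup>2) \<le> L2_bound" by blast
qed

sublocale square_summable c
proof
  show "summable (\<lambda>n. (c n)\<^sup>2)"
  proof (rule bounded_imp_summable)
    fix n
    have "(\<Sum>k\<le>n. (c k)\<^sup>2) = (c 0)\<^sup>2 + (\<Sum>k=1..n. (c k)\<^sup>2)"
      by (simp add: atMost_atLeast0 sum.atLeast_Suc_atMost)
    also have "\<dots> \<le> (c 0)\<^sup>2 + L2_bound" using sum_c_square_le[of n] by simp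
    finally show "(\<Sum>k\<le>n. (c k)\<^sup>2) \<le> (c 0)\<^sup>2 + L2_bound" .
  qed simp
qed

text \<open>Up to \<open>N0\<close> both polynomials contain every index. Beyond it,
  \<open>0 <= f J n <= c n\<close> keeps the difference of coefficients within \<open>c n\<close>,
  whichever of the two sums contains the index.\<close>

lemma F_diff_P_square_le:
  assumes "N0 \<le> J" "N0 \<le> N"
  shows "(\<integral>x. (cmod (F J x - P N x))\<^sup>2 \<partial>unit_measure) \<le> (\<Sum>n=1..N0. (f J n - c n)\<^sup>2) + tail N0"
proof -
  define d where "d n = (if n \<in> {1..M J} then f J n else 0) - (if n \<in> {1..N} then c n else 0)" for n
  let ?A = "{1..M J} \<union> {1..N}"
  have "(\<integral>x. (cmod (F J x - P N x))\<^sup>2 \<partial>unit_measure) = (\<integral>x. (cmod (trig_sum ?A d x))\<^sup>2 \<partial>unit_measure)"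
    unfolding d_def by (subst trig_sum_diff) auto
  also have "\<dots> = (\<Sum>n\<in>?A. (d n)\<^sup>2)" by (rule parseval_trig_sum) simp
  also have "\<dots> = (\<Sum>n\<in>{1..N0}. (d n)\<^sup>2) + (\<Sum>n\<in>?A - {1..N0}. (d n)\<^sup>2)"
    using assms by (subst sum.subset_diff[of "{1..N0}"]) auto
  also have "(\<Sum>n\<in>{1..N0}. (d n)\<^sup>2) = (\<Sum>n=1..N0. (f J n - c n)\<^sup>2)"
    using assms M_ge[of J] by (intro sum.cong) (auto simp: d_def)
  also have "(\<Sum>n\<in>?A - {1..N0}. (d n)\<^sup>2) \<le> (\<Sum>n\<in>?A - {1..N0}. (c n)\<^sup>2)"
  proof (rule sum_mono)
    fix n assume "n \<in> ?A - {1..N0}"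
    then have "n \<ge> 1" by auto
    then have "\<bar>d n\<bar> \<le> \<bar>c n\<bar>" using f_nonneg[of J n] f_le[of n J] by (auto simp: d_def)
    then show "(d n)\<^sup>2 \<le> (c n)\<^sup>2" by (simp only: abs_le_square_iff)
  qed
  also have "\<dots> \<le> tail N0" by (rule sum_le_tail) auto
  finally show ?thesis by simp
qed

lemma square_norm_add_le: "(cmod (u - w))\<^sup>2 \<le> 2 * (cmod (u - v))\<^sup>2 + 2 * (cmod (v - w))\<^sup>2"
proof -
  have "cmod (u - w) \<le> cmod (u - v) + cmod (v - w)" using norm_triangle_ineq[of "u - v" "v - w"] by simp
  then have "(cmod (u - w))\<^sup>2 \<le> (cmod (u - v) + cmod (v - w))\<^sup>2" by (rule power_mono) simp
  also have "\<dots> \<le> 2 * (cmod (u - v))\<^sup>2 + 2 * (cmod (v - w))\<^sup>2"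
    using sum_squares_bound[of "cmod (u - v)" "cmod (v - w)"] by (simp add: power2_sum)
  finally show ?thesis .
qed

section \<open>Transfer of the bound to an arbitrary \<open>L^2\<close> limit\<close>

context
  fixes g :: "real \<Rightarrow> complex"
  assumes g_measurable: "g \<in> borel_measurable borel"
    and g_square: "integrable unit_measure (\<lambda>x. (cmod (g x))\<^sup>2)"
    and g_limit: "(\<lambda>N. \<integral>x. (cmod (P N x - g x))\<^sup>2 \<partial>unit_measure) \<longlonglongrightarrow> 0"
begin

lemma integrable_trig_sum_diff: "integrable unit_measure (\<lambda>x. (cmod (trig_sum A a x - g x))\<^sup>2)"
proof (rule Bochner_Integration.integrable_bound)
  show "integrable unit_measure (\<lambda>x. 2 * (cmod (trig_sum A a x))\<^sup>2 + 2 * (cmod (g x))\<^sup>2)"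
    using g_square integrable_trig_sum_square by auto
  have "(\<lambda>x. (cmod (trig_sum A a x - g x))\<^sup>2) \<in> borel_measurable borel" using g_measurable by measurable
  then show "(\<lambda>x. (cmod (trig_sum A a x - g x))\<^sup>2) \<in> borel_measurable unit_measure" by (rule measurable_unit_measure)
  show "AE x in unit_measure. norm ((cmod (trig_sum A a x - g x))\<^sup>2) \<le> norm (2 * (cmod (trig_sum A a x))\<^sup>2 + 2 * (cmod (g x))\<^sup>2)"
    using square_norm_add_le[of "trig_sum A a x" "g x" 0 for x] by (intro AE_I2) (simp add: norm_minus_commute)
qed

text \<open>A partial sum \<open>P N\<close> serves as intermediary. With tail and coefficient
  errors below \<open>e / 8\<close> each and the distance of \<open>P N\<close> from
  \<open>g\<close> below \<open>e / 4\<close>, the budget is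
  \<open>2 * (e / 8 + e / 8) + 2 * (e / 4) = e\<close>.\<close>

lemma F_close:
  assumes e: "e > 0"
  obtains J where "(\<integral>x. (cmod (F J x - g x))\<^sup>2 \<partial>unit_measure) \<le> e"
proof -
  have "\<forall>\<^sub>F N in sequentially. tail N < e / 8" by (rule order_tendstoD(2)[OF tail_tendsto]) (use e in simp)
  then obtain N0 where N0: "tail N0 < e / 8" unfolding eventually_sequentially by blast
  have "(\<lambda>J. \<Sum>n=1..N0. (f J n - c n)\<^sup>2) \<longlonglongrightarrow> (\<Sum>n=1..N0. (c n - c n)\<^sup>2)"
    by (intro tendsto_sum tendsto_power tendsto_diff f_tendsto tendsto_const) auto
  then have "\<forall>\<^sub>F J in sequentially. (\<Sum>n=1..N0. (f J n - c n)\<^sup>2) < e / 8"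
    by (rule order_tendstoD(2)) (use e in simp)
  then obtain J1 where J1: "\<And>J. J \<ge> J1 \<Longrightarrow> (\<Sum>n=1..N0. (f J n - c n)\<^sup>2) < e / 8"
    unfolding eventually_sequentially by blast
  define J where "J = max J1 N0"
  have "\<forall>\<^sub>F N in sequentially. (\<integral>x. (cmod (P N x - g x))\<^sup>2 \<partial>unit_measure) < e / 4"
    by (rule order_tendstoD(2)[OF g_limit]) (use e in simp)
  then obtain N1 where N1: "\<And>N. N \<ge> N1 \<Longrightarrow> (\<integral>x. (cmod (P N x - g x))\<^sup>2 \<partial>unit_measure) < e / 4"
    unfolding eventually_sequentially by blast
  define N where "N = max N1 N0"
  have FP: "integrable unit_measure (\<lambda>x. (cmod (F J x - P N x))\<^sup>2)"
    by (subst trig_sum_diff) (auto intro: integrable_trig_sum_square)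
  have "(\<integral>x. (cmod (F J x - g x))\<^sup>2 \<partial>unit_measure)
      \<le> (\<integral>x. 2 * (cmod (F J x - P N x))\<^sup>2 + 2 * (cmod (P N x - g x))\<^sup>2 \<partial>unit_measure)"
    using FP by (intro integral_mono integrable_trig_sum_diff Bochner_Integration.integrable_add integrable_mult_right square_norm_add_le)
  also have "\<dots> = 2 * (\<integral>x. (cmod (F J x - P N x))\<^sup>2 \<partial>unit_measure) + 2 * (\<integral>x. (cmod (P N x - g x))\<^sup>2 \<partial>unit_measure)"
    using FP integrable_trig_sum_diff by simp
  also have "(\<integral>x. (cmod (F J x - P N x))\<^sup>2 \<partial>unit_measure) \<le> (\<Sum>n=1..N0. (f J n - c n)\<^sup>2) + tail N0"
    by (rule F_diff_P_square_le) (auto simp: J_def N_def)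
  also have "(\<integral>x. (cmod (P N x - g x))\<^sup>2 \<partial>unit_measure) \<le> e / 4"
    using N1[of N] by (simp add: N_def)
  finally have "(\<integral>x. (cmod (F J x - g x))\<^sup>2 \<partial>unit_measure) \<le> e"
    using J1[of J] N0 by (simp add: J_def)
  then show ?thesis by (rule that)
qed

text \<open>Where \<open>g\<close> exceeds twice the level, either \<open>F J\<close> or its
  distance from \<open>g\<close> exceeds the level. The second set is small by Chebyshev's
  inequality, and the bound for the first is the same for every \<open>J\<close>.\<close>

lemma limit_weak_bound: "measure unit_measure {x \<in> {0..1}. cmod (g x) > 2 * K * Q ^ I} \<le> K * (1/4) ^ I"
proof (rule field_le_epsilon)
  fix e :: real assume e: "e > 0"
  let ?a = "K * Q ^ I"
  have a: "?a > 0" using K_pos Q_gt_1 by simp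
  obtain J where J: "(\<integral>x. (cmod (F J x - g x))\<^sup>2 \<partial>unit_measure) \<le> e * ?a\<^sup>2"
    using F_close[of "e * ?a\<^sup>2"] e a by (metis mult_pos_pos zero_less_power)
  let ?A = "{x \<in> {0..1}. cmod (F J x) > ?a}" and ?B = "{x \<in> {0..1}. cmod (F J x - g x) > ?a}"
  have [measurable]: "g \<in> borel_measurable borel" by (rule g_measurable)
  have A: "?A \<in> sets unit_measure" by (rule superlevel_sets) measurable
  have B: "?B \<in> sets unit_measure" by (rule superlevel_sets) measurable
  have "{x \<in> {0..1}. cmod (g x) > 2 * K * Q ^ I} \<subseteq> ?A \<union> ?B"
  proof
    fix x assume x: "x \<in> {x \<in> {0..1}. cmod (g x) > 2 * K * Q ^ I}"
    have "cmod (g x) \<le> cmod (F J x) + cmod (F J x - g x)" by (metis norm_minus_commute norm_triangle_sub)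
    then have "cmod (F J x) > ?a \<or> cmod (F J x - g x) > ?a" using x by auto
    then show "x \<in> ?A \<union> ?B" using x by auto
  qed
  then have "measure unit_measure {x \<in> {0..1}. cmod (g x) > 2 * K * Q ^ I} \<le> measure unit_measure (?A \<union> ?B)"
    using A B by (intro unit_measure.finite_measure_mono) auto
  also have "\<dots> \<le> measure unit_measure ?A + measure unit_measure ?B"
    using A B by (intro measure_subadditive) (auto simp: unit_measure.emeasure_finite)
  also have "measure unit_measure ?A \<le> K * (1/4) ^ I"
    using weak_bound[where J = J and I = I] by (subst measure_unit_measure) auto
  also have "measure unit_measure ?B \<le> measure unit_measure {x \<in> space unit_measure. (cmod (F J x - g x))\<^sup>2 \<ge> ?a\<^sup>2}"
  proof (rule unit_measure.finite_measure_mono)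
    show "?B \<subseteq> {x \<in> space unit_measure. (cmod (F J x - g x))\<^sup>2 \<ge> ?a\<^sup>2}"
      using a by (auto simp: space_restrict_space intro!: power_mono)
    have "(\<lambda>x. (cmod (F J x - g x))\<^sup>2) \<in> borel_measurable unit_measure"
      using integrable_trig_sum_diff by (rule borel_measurable_integrable)
    then show "{x \<in> space unit_measure. (cmod (F J x - g x))\<^sup>2 \<ge> ?a\<^sup>2} \<in> sets unit_measure" by measurable
  qed
  also have "\<dots> \<le> (\<integral>x. (cmod (F J x - g x))\<^sup>2 \<partial>unit_measure) / ?a\<^sup>2"
    by (rule integral_Markov_inequality_measure[OF integrable_trig_sum_diff A]) (use a Q_gt_1 in auto)
  also have "\<dots> \<le> e * ?a\<^sup>2 / ?a\<^sup>2" using J by (rule divide_right_mono) simp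
  also have "\<dots> = e" using a K_pos Q_gt_1 by simp
  finally show "measure unit_measure {x \<in> {0..1}. cmod (g x) > 2 * K * Q ^ I} \<le> K * (1/4) ^ I + e" by simp
qed

text \<open>Between consecutive levels \<open>2 * K * Q^I\<close> the right-hand side changes by the
  factor \<open>Q powr p = 4\<close>, whence \<open>4 * K\<close>. Below \<open>2 * K\<close> the
  measure of the unit interval suffices, whence the added 1.\<close>

lemma limit_weak_type:
  assumes Qp: "Q powr p = 4" and p: "p > 0" and \<alpha>: "\<alpha> > 0"
  shows "measure lborel {x \<in> {0..1}. cmod (g x) > \<alpha>} \<le> (4 * K + 1) * (2 * K) powr p * \<alpha> powr (- p)"
proof -
  have eq: "measure lborel {x \<in> {0..1}. cmod (g x) > \<alpha>} = measure unit_measure {x \<in> {0..1}. cmod (g x) > \<alpha>}"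
    by (rule measure_unit_measure[symmetric]) auto
  have scale: "(2 * K) powr p * \<alpha> powr (- p) = (2 * K / \<alpha>) powr p"
    using \<alpha> K_pos by (simp add: powr_divide powr_minus_divide)
  show ?thesis
  proof (cases "\<alpha> < 2 * K")
    case True
    have "measure unit_measure {x \<in> {0..1}. cmod (g x) > \<alpha>} \<le> 1"
      using unit_measure.bounded_measure measure_unit_measure_space by metis
    also have "1 \<le> (2 * K / \<alpha>) powr p" using True \<alpha> p by (intro ge_one_powr_ge_zero) auto
    also have "\<dots> \<le> (4 * K + 1) * (2 * K / \<alpha>) powr p"
      using K_pos mult_right_mono[of 1 "4 * K + 1" "(2 * K / \<alpha>) powr p"] by simp
    finally show ?thesis by (simp only: eq scale mult.assoc)
  next
    case False
    define I where "I = nat \<lfloor>log Q (\<alpha> / (2 * K))\<rfloor>"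
    let ?y = "\<alpha> / (2 * K)"
    have y: "?y \<ge> 1" using False K_pos by simp
    then have l: "log Q ?y \<ge> 0" using Q_gt_1 by simp
    have I: "real I \<le> log Q ?y" "log Q ?y < real I + 1" unfolding I_def using l by linarith+
    have "Q powr real I \<le> ?y" using I(1) y Q_gt_1 by (simp add: le_log_iff)
    then have le: "2 * K * Q ^ I \<le> \<alpha>" using Q_gt_1 K_pos by (simp add: powr_realpow field_simps)
    have "?y < Q powr (real I + 1)" using I(2) y Q_gt_1 by (simp add: log_less_iff)
    then have "?y powr p \<le> (Q powr (real I + 1)) powr p" using y p by (intro powr_mono2) auto
    also have "\<dots> = (Q powr p) powr (real I + 1)" by (simp add: powr_powr mult.commute)
    also have "\<dots> = 4 ^ Suc I" unfolding Qp using powr_realpow[of 4 "Suc I"] by (simp add: add.commute)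
    finally have yp: "?y powr p \<le> 4 * 4 ^ I" by simp
    have ypos: "?y powr p > 0" using \<alpha> K_pos by simp
    have "measure unit_measure {x \<in> {0..1}. cmod (g x) > \<alpha>} \<le> measure unit_measure {x \<in> {0..1}. cmod (g x) > 2 * K * Q ^ I}"
      using le superlevel_sets[OF g_measurable] by (intro unit_measure.finite_measure_mono) auto
    also have "\<dots> \<le> K * (1/4) ^ I" by (rule limit_weak_bound)
    also have "\<dots> \<le> K * (4 / ?y powr p)"
    proof (intro mult_left_mono)
      show "(1/4) ^ I \<le> 4 / ?y powr p" using yp ypos by (simp add: power_one_over field_simps)
    qed (use K_pos in auto)
    also have "\<dots> = 4 * K * (2 * K / \<alpha>) powr p"
      using \<alpha> K_pos by (simp add: powr_divide)
    also have "\<dots> \<le> (4 * K + 1) * (2 * K / \<alpha>) powr p" by (intro mult_right_mono) auto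
    finally show ?thesis by (simp only: eq scale mult.assoc)
  qed
qed

end

end

section \<open>The exceptional set\<close>

lemma sum_geometric_le:
  fixes \<rho> :: real
  assumes "0 \<le> \<rho>" "\<rho> < 1" "finite S"
  shows "(\<Sum>k\<in>S. \<rho> ^ k) \<le> 1 / (1 - \<rho>)"
proof -
  have "(\<Sum>k\<in>S. \<rho> ^ k) \<le> suminf (\<lambda>k. \<rho> ^ k)"
    using assms by (intro sum_le_suminf summable_geometric) auto
  then show ?thesis using assms by (simp add: suminf_geometric)
qed

text \<open>On natural numbers \<open>(i - I) + (I - i)\<close> is the distance of \<open>i\<close>
  and \<open>I\<close>, since truncated subtraction makes one summand 0. Each side contributes one
  geometric series.\<close>

lemma sum_power_dist_le:
  fixes \<rho> :: real
  assumes \<rho>: "0 \<le> \<rho>" "\<rho> < 1" and S: "finite S"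
  shows "(\<Sum>i\<in>S. \<rho> ^ ((i - I) + (I - i))) \<le> 2 / (1 - \<rho>)"
proof -
  have "(\<Sum>i\<in>S. \<rho> ^ ((i - I) + (I - i))) = (\<Sum>i\<in>S \<inter> {..I}. \<rho> ^ ((i - I) + (I - i))) + (\<Sum>i\<in>S - {..I}. \<rho> ^ ((i - I) + (I - i)))"
    using S by (subst sum.Int_Diff[of S _ "{..I}"]) auto
  also have "(\<Sum>i\<in>S \<inter> {..I}. \<rho> ^ ((i - I) + (I - i))) = (\<Sum>k\<in>(\<lambda>i. I - i) ` (S \<inter> {..I}). \<rho> ^ k)"
    by (subst sum.reindex) (auto simp: inj_on_def)
  also have "\<dots> \<le> 1 / (1 - \<rho>)" using \<rho> S by (intro sum_geometric_le) auto
  also have "(\<Sum>i\<in>S - {..I}. \<rho> ^ ((i - I) + (I - i))) = (\<Sum>k\<in>(\<lambda>i. i - I) ` (S - {..I}). \<rho> ^ k)"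
    by (subst sum.reindex) (auto simp: inj_on_def)
  also have "\<dots> \<le> 1 / (1 - \<rho>)" using \<rho> S by (intro sum_geometric_le) auto
  finally show ?thesis by simp
qed

locale ideal_series = imag_quad_order +
  fixes s :: real
  assumes s_gt: "1/2 < s" and s_lt: "s < 1"
begin

text \<open>The kernel sum with \<open>H = 2 ^ i\<close> enters the Mellin integral with weight \<open>S ^ (- i)\<close>, and the target size is
  \<open>Q ^ I\<close>. The thresholds \<open>level I i\<close> below, divided by \<open>S ^ i\<close>, decay geometrically with ratio \<open>\<rho>\<close> on both sides
  of \<open>i = I\<close>, so that they add up to \<open>O(Q ^ I)\<close>; \<open>\<kappa>\<close> is so small that the measures of the corresponding
  superlevel sets remain summable. The factor \<open>B\<close> lifts the thresholds above \<open>24 H (1 + ln H)\<close>.\<close>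
definition \<kappa> :: real where "\<kappa> = min ((s - 1/2) / 2) (1 - s)"
definition S :: real where "S = 4 powr s"
definition Q :: real where "Q = 4 powr (1 - s)"
definition \<rho> :: real where "\<rho> = 4 powr (- \<kappa>)"
definition B :: real where "B = 24 / ((2 * (s - \<kappa>) - 1) * ln 2)"

lemma \<kappa>_pos: "\<kappa> > 0" using s_gt s_lt by (simp add: \<kappa>_def)
text \<open>The first bound yields \<open>Q * \<rho> >= 1\<close>, so thresholds below scale
  \<open>I\<close> stay above the trivial bound. The second yields \<open>S * \<rho> > 2\<close>, so
  the measures above scale \<open>I\<close> are summable.\<close>

lemma \<kappa>_le: "\<kappa> \<le> 1 - s" "\<kappa> \<le> (s - 1/2) / 2" unfolding \<kappa>_def by (rule min.cobounded2, rule min.cobounded1)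
lemma S_pos: "S > 0" by (simp add: S_def)
lemma S_gt_2: "S > 2"
proof -
  have "(4::real) powr (1/2) < 4 powr s" using s_gt by (intro powr_less_mono) auto
  then show ?thesis by (simp add: S_def powr_half_sqrt)
qed
lemma Q_gt_1: "Q > 1" using s_lt by (simp add: Q_def)
lemma S_mult_Q: "S * Q = 4" by (simp add: S_def Q_def flip: powr_add)
lemma \<rho>_pos: "\<rho> > 0" by (simp add: \<rho>_def)
lemma \<rho>_less_1: "\<rho> < 1" using \<kappa>_pos by (simp add: \<rho>_def powr_less_one)
lemma one_le_Q_mult_\<rho>: "1 \<le> Q * \<rho>"
  using \<kappa>_le(1) by (simp add: Q_def \<rho>_def ge_one_powr_ge_zero flip: powr_add)
lemma S_mult_\<rho>: "S * \<rho> = 4 powr (s - \<kappa>)" by (simp add: S_def \<rho>_def flip: powr_add)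
lemma S_mult_\<rho>_gt_2: "S * \<rho> > 2"
proof -
  have "1/2 < s - \<kappa>" using \<kappa>_le(2) s_gt by simp
  then have "(4::real) powr (1/2) < 4 powr (s - \<kappa>)" by (intro powr_less_mono) auto
  then show ?thesis by (simp add: S_mult_\<rho> powr_half_sqrt)
qed

text \<open>Here \<open>S * \<rho> = 2 * exp \<delta>\<close> with a positive
  \<open>\<delta> <= 1\<close>. The inequality \<open>exp (i * \<delta>) >= 1 + i * \<delta>\<close>
  and the choice \<open>B = 24 / \<delta>\<close> produce the linear factor that stands for the
  logarithm of \<open>2 ^ i\<close>.\<close>

lemma B_ge: "B * (S * \<rho>) ^ i \<ge> 24 * 2 ^ i * (1 + real i)" and B_ge_1: "B \<ge> 1"
proof -
  define \<delta> where "\<delta> = (2 * (s - \<kappa>) - 1) * ln 2"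
  have B: "B = 24 / \<delta>" by (simp add: B_def \<delta>_def)
  have g: "2 * (s - \<kappa>) - 1 > 0" "2 * (s - \<kappa>) - 1 < 1" using \<kappa>_le(2) \<kappa>_pos s_gt s_lt by auto
  have \<delta>: "\<delta> > 0" using g by (simp add: \<delta>_def)
  have "\<delta> \<le> 1 * 1" unfolding \<delta>_def using g ln_2_less_1 by (intro mult_mono) auto
  then have \<delta>1: "\<delta> \<le> 1" by simp
  then show "B \<ge> 1" using \<delta> by (simp add: B)
  have "(S * \<rho>) ^ i = 2 ^ i * exp (real i * \<delta>)"
  proof -
    have "S * \<rho> = exp ((s - \<kappa>) * ln 4)" by (simp add: S_mult_\<rho> powr_def)
    also have "ln (4::real) = 2 * ln 2" using ln_realpow[of 2 2] by simp
    also have "(s - \<kappa>) * (2 * ln 2) = ln 2 + \<delta>" by (simp add: \<delta>_def algebra_simps)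
    finally have "S * \<rho> = 2 * exp \<delta>" by (simp add: exp_add)
    then show ?thesis by (simp add: power_mult_distrib exp_of_nat_mult)
  qed
  also have "2 ^ i * exp (real i * \<delta>) \<ge> 2 ^ i * (1 + real i * \<delta>)"
    by (intro mult_left_mono) (auto simp: exp_ge_add_one_self)
  finally have "B * (2 ^ i * (1 + real i * \<delta>)) \<le> B * (S * \<rho>) ^ i"
    using \<delta> by (intro mult_left_mono) (auto simp: B)
  moreover have "24 * (1 + real i) \<le> B * (1 + real i * \<delta>)"
    using \<delta> \<delta>1 by (simp add: B field_simps)
  then have "2 ^ i * (24 * (1 + real i)) \<le> 2 ^ i * (B * (1 + real i * \<delta>))"
    by (intro mult_left_mono) auto
  ultimately have "2 ^ i * (24 * (1 + real i)) \<le> B * (S * \<rho>) ^ i"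
    by (simp only: mult.left_commute[of "2 ^ i" B] order_trans)
  then show "B * (S * \<rho>) ^ i \<ge> 24 * 2 ^ i * (1 + real i)"
    by (simp only: mult.assoc mult.left_commute)
qed

definition level :: "nat \<Rightarrow> nat \<Rightarrow> real" where
  "level I i = B * S ^ i * Q ^ I * \<rho> ^ ((i - I) + (I - i))"

lemma level_nonneg: "0 \<le> level I i"
  using B_ge_1 S_pos Q_gt_1 \<rho>_pos by (simp add: level_def)

text \<open>Kernel sums at scale \<open>i\<close> never exceed \<open>4 ^ i\<close>, so the scales
  up to \<open>I\<close> have no exceptional set; this is why \<open>bad_set\<close> starts at
  \<open>I + 1\<close>.\<close>

lemma level_trivial:
  assumes "i \<le> I"
  shows "(4::real) ^ i \<le> level I i"
proof -
  obtain d where d: "I = i + d" using assms le_Suc_ex by blast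
  have "1 * 1 \<le> B * (Q * \<rho>) ^ d" using B_ge_1 one_le_Q_mult_\<rho> by (intro mult_mono one_le_power) auto
  then have "1 * 4 ^ i \<le> B * (Q * \<rho>) ^ d * 4 ^ i" by (intro mult_right_mono) auto
  also have "\<dots> = level I i"
    unfolding S_mult_Q[symmetric] level_def by (simp add: d power_add power_mult_distrib)
  finally show ?thesis by simp
qed

text \<open>Above \<open>I\<close> the thresholds satisfy the hypothesis of
  \<open>measure_kernel_sum_gt_le\<close>. The bound by \<open>(S * \<rho>) ^ i\<close> suffices, as
  \<rho> is below 1 and \<open>Q\<close> above it.\<close>

lemma level_large:
  assumes "i > I"
  shows "24 * real (2 ^ i) * (1 + ln (real (2 ^ i))) \<le> level I i"
proof -
  obtain d where d: "i = I + d" using assms less_imp_le le_Suc_ex by blast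
  have "ln (real (2 ^ i)) = real i * ln 2" by (simp add: ln_realpow)
  also have "\<dots> \<le> real i * 1" using ln_2_less_1 by (intro mult_left_mono) auto
  finally have "24 * 2 ^ i * (1 + ln (real (2 ^ i))) \<le> 24 * 2 ^ i * (1 + real i)" by (intro mult_left_mono) auto
  also have "\<dots> \<le> B * (S * \<rho>) ^ i" by (rule B_ge)
  also have "\<dots> = B * S ^ i * \<rho> ^ d * \<rho> ^ I" by (simp add: d power_add power_mult_distrib)
  also have "\<dots> \<le> B * S ^ i * \<rho> ^ d * Q ^ I"
    using B_ge_1 S_pos \<rho>_pos \<rho>_less_1 Q_gt_1 by (intro mult_left_mono power_mono mult_nonneg_nonneg) auto
  also have "\<dots> = level I i" by (simp add: level_def d)
  finally show ?thesis by simp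
qed

definition bad_set :: "nat \<Rightarrow> real set" where
  "bad_set I = (\<Union>d. {x \<in> {0..1}. kernel_sum (2 ^ (I + Suc d)) (real kernel_modulus * x) > level I (I + Suc d)})"

definition bad_const :: real where "bad_const = 200 / (B\<^sup>2 * (1 - 4 / (S * \<rho>)\<^sup>2))"

lemma kernel_superlevel_sets: "{x \<in> {0..1}. kernel_sum H (real c * x) > L} \<in> sets lborel"
  by (intro fmeasurableD superlevel_fmeasurable continuous_kernel_sum)

lemma bad_set_fmeasurable: "bad_set I \<in> fmeasurable lborel"
proof (rule fmeasurableI2)
  show "{0..1::real} \<in> fmeasurable lborel" by (auto intro!: fmeasurable_compact)
  show "bad_set I \<subseteq> {0..1}" by (auto simp: bad_set_def)
  show "bad_set I \<in> sets lborel" unfolding bad_set_def by (intro sets.countable_UN) (use kernel_superlevel_sets in auto)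
qed

text \<open>At \<open>i = I + Suc d\<close> the identity \<open>S * Q = 4\<close> turns the ratio of
  \<open>4 ^ i\<close> to the squared threshold into \<open>4^(-I)\<close> times a geometric term
  with ratio \<open>4 / (S * \<rho>)^2 < 1\<close>, up to \<open>B^2\<close>.\<close>

lemma measure_bad_set: "measure lborel (bad_set I) \<le> bad_const * (1/4) ^ I"
proof -
  define A where "A d = {x \<in> {0..1}. kernel_sum (2 ^ (I + Suc d)) (real kernel_modulus * x) > level I (I + Suc d)}" for d
  define \<tau> where "\<tau> = 4 / (S * \<rho>)\<^sup>2"
  have "2\<^sup>2 < (S * \<rho>)\<^sup>2" using S_mult_\<rho>_gt_2 by (intro power_strict_mono) auto
  then have "4 < (S * \<rho>)\<^sup>2" by simp
  then have \<tau>: "0 < \<tau>" "\<tau> < 1" using S_pos \<rho>_pos by (auto simp: \<tau>_def simp del: power_mult_distrib)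
  have le: "measure lborel (A d) \<le> 200 / B\<^sup>2 * (1/4) ^ I * \<tau> ^ d" for d
  proof -
    let ?i = "I + Suc d"
    have "measure lborel (A d) \<le> 200 * (real (2 ^ ?i))\<^sup>2 / (level I ?i)\<^sup>2"
      unfolding A_def by (rule measure_kernel_sum_gt_le) (use kernel_modulus_pos level_large[of I ?i] in auto)
    also have "(real (2 ^ ?i))\<^sup>2 = 4 ^ I * 4 ^ Suc d"
    proof -
      have "(real (2 ^ ?i))\<^sup>2 = 4 ^ ?i" by (simp add: power2_eq_square flip: power_mult_distrib)
      then show ?thesis by (simp only: power_add)
    qed
    also have "level I ?i = B * 4 ^ I * (S * \<rho>) ^ Suc d"
      unfolding S_mult_Q[symmetric] level_def by (simp add: power_add power_mult_distrib)
    also have "200 * (4 ^ I * 4 ^ Suc d) / (B * 4 ^ I * (S * \<rho>) ^ Suc d)\<^sup>2 = 200 / B\<^sup>2 * (1/4) ^ I * \<tau> ^ Suc d"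
      using B_ge_1 S_pos \<rho>_pos
      by (simp add: \<tau>_def power_divide power_mult_distrib power_one_over field_simps power2_eq_square)
    also have "\<dots> \<le> 200 / B\<^sup>2 * (1/4) ^ I * \<tau> ^ d"
      using \<tau> B_ge_1 by (intro mult_left_mono power_decreasing) auto
    finally show ?thesis .
  qed
  have sm: "summable (\<lambda>d. 200 / B\<^sup>2 * (1/4) ^ I * \<tau> ^ d)" using \<tau> by (intro summable_mult summable_geometric) auto
  have smA: "summable (\<lambda>d. measure lborel (A d))"
    by (rule summable_comparison_test[OF _ sm]) (use le in auto)
  have Aset: "A d \<in> sets lborel" for d unfolding A_def by (rule kernel_superlevel_sets)
  have Afin: "emeasure lborel (A d) \<noteq> top" for d
  proof -
    have "A d \<in> fmeasurable lborel"
      by (rule fmeasurableI2[of "{0..1}"]) (use Aset in \<open>auto intro!: fmeasurable_compact simp: A_def\<close>)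
    then show ?thesis by (simp add: fmeasurable_def less_top)
  qed
  have "bad_set I = (\<Union>d. A d)" by (simp add: bad_set_def A_def)
  also have "measure lborel (\<Union>d. A d) \<le> (\<Sum>d. measure lborel (A d))"
  proof -
    have "emeasure lborel (\<Union>d. A d) \<le> (\<Sum>d. emeasure lborel (A d))"
      by (rule emeasure_subadditive_countably) (use Aset in auto)
    also have "\<dots> = (\<Sum>d. ennreal (measure lborel (A d)))"
      by (intro suminf_cong emeasure_eq_ennreal_measure Afin)
    also have "\<dots> = ennreal (\<Sum>d. measure lborel (A d))"
      using smA by (intro suminf_ennreal2) auto
    finally have "emeasure lborel (\<Union>d. A d) \<le> ennreal (\<Sum>d. measure lborel (A d))" .
    then have "enn2real (emeasure lborel (\<Union>d. A d)) \<le> (\<Sum>d. measure lborel (A d))"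
      by (intro enn2real_leI suminf_nonneg smA) auto
    then show ?thesis by (subst measure_def)
  qed
  also have "\<dots> \<le> (\<Sum>d. 200 / B\<^sup>2 * (1/4) ^ I * \<tau> ^ d)"
    by (intro suminf_le le smA sm)
  also have "\<dots> = 200 / B\<^sup>2 * (1/4) ^ I * (1 / (1 - \<tau>))"
    using \<tau> by (subst suminf_mult) (auto intro!: summable_geometric simp: suminf_geometric)
  also have "\<dots> = bad_const * (1/4) ^ I" by (simp add: bad_const_def \<tau>_def)
  finally show ?thesis .
qed

lemma kernel_sum_le_level:
  assumes "x \<in> {0..1}" "x \<notin> bad_set I"
  shows "kernel_sum (2 ^ i) (real kernel_modulus * x) \<le> level I i"
proof (cases "i \<le> I")
  case True
  have "kernel_sum (2 ^ i) (real kernel_modulus * x) \<le> (real (2 ^ i))\<^sup>2" by (rule kernel_sum_le)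
  also have "\<dots> = 4 ^ i" by (simp add: power2_eq_square flip: power_mult_distrib)
  also have "\<dots> \<le> level I i" by (rule level_trivial[OF True])
  finally show ?thesis .
next
  case False
  then obtain d where "i = I + Suc d" by (metis less_imp_Suc_add not_le add_Suc_right)
  then show ?thesis using assms by (auto simp: bad_set_def not_less)
qed

definition level_sum :: "nat \<Rightarrow> nat \<Rightarrow> real" where
  "level_sum I j = (\<Sum>l. (1/4) ^ l * level I (j + l))"

text \<open>As \<open>S / 4 = 1 / Q\<close>, the factor \<open>(1/4) ^ l\<close> more than offsets
  the growth of the thresholds, leaving the decay \<open>Q^(-l)\<close>.\<close>

lemma level_term: "(1/4) ^ l * level I (j + l) = B * Q ^ I * S ^ j * ((1 / Q) ^ l * \<rho> ^ (((j + l) - I) + (I - (j + l))))"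
proof -
  have "S ^ l = (4 / Q) ^ l" using Q_gt_1 S_mult_Q by (metis less_numeral_extra(3) nonzero_mult_div_cancel_right not_one_less_zero)
  also have "\<dots> = 4 ^ l * (1 / Q) ^ l" by (simp add: power_divide)
  finally show ?thesis by (simp add: level_def power_add power_one_over field_simps)
qed

lemma summable_level_aux: "summable (\<lambda>l. (1 / Q) ^ l * \<rho> ^ (((j + l) - I) + (I - (j + l))))"
proof (rule summable_comparison_test)
  show "summable (\<lambda>l. (1 / Q) ^ l)" using Q_gt_1 by (intro summable_geometric) auto
  have "\<rho> ^ m \<le> 1" for m using \<rho>_pos \<rho>_less_1 by (simp add: power_le_one)
  then show "\<exists>N. \<forall>l\<ge>N. norm ((1 / Q) ^ l * \<rho> ^ (((j + l) - I) + (I - (j + l)))) \<le> (1 / Q) ^ l"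
    using \<rho>_pos Q_gt_1 by (auto simp: abs_mult mult_left_le simp del: power_one_over intro!: mult_left_le)
qed

lemma summable_level: "summable (\<lambda>l. (1/4) ^ l * level I (j + l))"
  unfolding level_term by (rule summable_mult[OF summable_level_aux])

text \<open>After exchanging the summations, the sum over \<open>j\<close> for fixed
  \<open>l\<close> consists of powers of \<rho> in the distance from \<open>I\<close>, bounded
  independently of \<open>l\<close>, \<open>I\<close> and \<open>J\<close>; then
  \<open>Q^(-l)\<close> is summed. The terms \<open>2 ^ j\<close> form a geometric series because
  \<open>S > 2\<close>.\<close>

lemma sum_level_le:
  "(\<Sum>j=1..J. (1 / S) ^ j * (2 ^ j + level_sum I j)) \<le> (1 / (1 - 2 / S) + B * (2 / (1 - \<rho>)) * (1 / (1 - 1 / Q))) * Q ^ I"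
proof -
  let ?a = "\<lambda>j l. (1 / Q) ^ l * \<rho> ^ (((j + l) - I) + (I - (j + l)))"
  have "(1 / S) ^ j * level_sum I j = B * Q ^ I * (\<Sum>l. ?a j l)" for j
  proof -
    have "level_sum I j = B * Q ^ I * S ^ j * (\<Sum>l. ?a j l)"
      unfolding level_sum_def level_term by (rule suminf_mult[OF summable_level_aux])
    then show ?thesis using S_pos by (simp add: power_one_over)
  qed
  then have "(\<Sum>j=1..J. (1 / S) ^ j * (2 ^ j + level_sum I j)) = (\<Sum>j=1..J. (2 / S) ^ j) + B * Q ^ I * (\<Sum>j=1..J. \<Sum>l. ?a j l)"
    by (simp add: distrib_left sum.distrib sum_distrib_left power_divide)
  also have "(\<Sum>j=1..J. \<Sum>l. ?a j l) = (\<Sum>l. \<Sum>j=1..J. ?a j l)"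
    by (rule suminf_sum[symmetric, OF summable_level_aux])
  also have "\<dots> \<le> (\<Sum>l. (1 / Q) ^ l * (2 / (1 - \<rho>)))"
  proof (rule suminf_le)
    fix l
    have "(\<Sum>j=1..J. ?a j l) = (1 / Q) ^ l * (\<Sum>j=1..J. \<rho> ^ (((j + l) - I) + (I - (j + l))))"
      by (simp only: sum_distrib_left)
    also have "(\<Sum>j=1..J. \<rho> ^ (((j + l) - I) + (I - (j + l)))) = (\<Sum>i\<in>(\<lambda>j. j + l) ` {1..J}. \<rho> ^ ((i - I) + (I - i)))"
      by (subst sum.reindex) (auto simp: inj_on_def)
    also have "(1 / Q) ^ l * \<dots> \<le> (1 / Q) ^ l * (2 / (1 - \<rho>))"
      using \<rho>_pos \<rho>_less_1 Q_gt_1 by (intro mult_left_mono sum_power_dist_le) auto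
    finally show "(\<Sum>j=1..J. ?a j l) \<le> (1 / Q) ^ l * (2 / (1 - \<rho>))" .
  next
    show "summable (\<lambda>l. \<Sum>j=1..J. ?a j l)" by (intro summable_sum summable_level_aux)
    show "summable (\<lambda>l. (1 / Q) ^ l * (2 / (1 - \<rho>)))"
      using Q_gt_1 by (intro summable_mult2 summable_geometric) auto
  qed
  also have "\<dots> = 1 / (1 - 1 / Q) * (2 / (1 - \<rho>))"
    using Q_gt_1 by (subst suminf_mult2[symmetric]) (auto intro!: summable_geometric simp: suminf_geometric)
  also have "(\<Sum>j=1..J. (2 / S) ^ j) \<le> 1 / (1 - 2 / S) * Q ^ I"
  proof -
    have "(\<Sum>j=1..J. (2 / S) ^ j) \<le> 1 / (1 - 2 / S)" using S_gt_2 by (intro sum_geometric_le) auto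
    also have "\<dots> \<le> 1 / (1 - 2 / S) * Q ^ I"
      using S_gt_2 Q_gt_1 mult_left_mono[of 1 "Q ^ I" "1 / (1 - 2 / S)"] by auto
    finally show ?thesis .
  qed
  finally show ?thesis using B_ge_1 Q_gt_1
    by (simp add: algebra_simps mult_left_mono)
qed

end

section \<open>Truncated Mellin integrals\<close>

context ideal_series
begin

lemma exp_eq_character: "exp (- of_nat n * Complex t (2 * pi * x)) = of_real (exp (- real n * t)) * character n x"
proof -
  have "- of_nat n * Complex t (2 * pi * x) = of_real (- real n * t) + - 2 * of_real pi * \<i> * of_real x * of_nat n"
    by (simp add: complex_eq_iff)
  then show ?thesis by (simp only: exp_add exp_of_real character_def)
qed

definition theta_partial :: "nat \<Rightarrow> real \<Rightarrow> real \<Rightarrow> complex" where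
  "theta_partial M t x = (\<Sum>n=1..M. of_real (real (ideal_count D n) * exp (- real n * t)) * character n x)"

text \<open>The integral for \<open>Gamma s / n powr s\<close>, cut off at both ends. Both cutoffs
  keep the integrand continuous on a compact interval.\<close>

definition mollifier :: "nat \<Rightarrow> nat \<Rightarrow> real" where
  "mollifier J n = integral {(1/4) ^ J..4 ^ J} (\<lambda>t. t powr (s - 1) * exp (- real n * t))"

definition approximant :: "nat \<Rightarrow> nat \<Rightarrow> real \<Rightarrow> complex" where
  "approximant J M x = (\<Sum>n=1..M. of_real (real (ideal_count D n) * mollifier J n) * character n x)"

definition integrand :: "nat \<Rightarrow> real \<Rightarrow> real \<Rightarrow> complex" where
  "integrand M x t = of_real (t powr (s - 1)) * theta_partial M t x"

lemma continuous_integrand: "a > 0 \<Longrightarrow> continuous_on {a..b} (integrand M x)"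
  unfolding integrand_def theta_partial_def by (intro continuous_intros) auto

lemma quarter_power_pos: "\<not> (1/4::real) ^ J \<le> 0"
  unfolding not_le by (rule zero_less_power) simp

lemma approximant_eq_integral: "approximant J M x = integral {(1/4) ^ J..4 ^ J} (integrand M x)"
proof -
  let ?I = "{(1/4::real) ^ J..4 ^ J}"
  have int: "(\<lambda>t. t powr (s - 1) * exp (- real n * t)) integrable_on ?I" for n
    by (intro integrable_continuous_interval continuous_intros) (auto simp: quarter_power_pos)
  have eq: "integrand M x = (\<lambda>t. \<Sum>n=1..M. of_real (t powr (s - 1) * exp (- real n * t)) * (of_nat (ideal_count D n) * character n x))"
    unfolding integrand_def theta_partial_def by (rule ext) (simp add: sum_distrib_left mult_ac)
  have "integral ?I (integrand M x) = (\<Sum>n=1..M. integral ?I (\<lambda>t. of_real (t powr (s - 1) * exp (- real n * t)) * (of_nat (ideal_count D n) * character n x)))"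
    unfolding eq by (intro integral_sum integrable_continuous_interval continuous_intros) (auto simp: quarter_power_pos)
  also have "\<dots> = (\<Sum>n=1..M. of_real (mollifier J n) * (of_nat (ideal_count D n) * character n x))"
  proof (rule sum.cong[OF refl])
    fix n
    have "((\<lambda>t. complex_of_real (t powr (s - 1) * exp (- real n * t)) * (of_nat (ideal_count D n) * character n x)) has_integral
       of_real (mollifier J n) * (of_nat (ideal_count D n) * character n x)) ?I"
      unfolding mollifier_def
      by (intro has_integral_mult_left has_integral_of_real integrable_integral int)
    then show "integral ?I (\<lambda>t. of_real (t powr (s - 1) * exp (- real n * t)) * (of_nat (ideal_count D n) * character n x))
       = of_real (mollifier J n) * (of_nat (ideal_count D n) * character n x)"
      by (rule integral_unique)
  qed
  finally show ?thesis by (simp add: approximant_def mult_ac)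
qed

text \<open>The terms at the left end \<open>(1/4) ^ J\<close> dominate those at every larger
  \<open>t\<close> and every \<open>x\<close>, so one length \<open>M\<close> serves the whole range
  of integration.\<close>

lemma theta_partial_close:
  obtains M where "M \<ge> J" "\<And>t x. t \<ge> (1/4) ^ J \<Longrightarrow> cmod (ideal_theta t x - theta_partial M t x) \<le> 1"
proof -
  define a where "a n = real (ideal_count D n) * exp (- real n * (1/4) ^ J)" for n
  have sm: "summable a" unfolding a_def by (rule summable_ideal_count_exp) simp
  have a0: "a n \<ge> 0" for n by (simp add: a_def)
  have "(\<lambda>N. suminf a - sum a {..<N}) \<longlonglongrightarrow> suminf a - suminf a"
    by (intro tendsto_diff tendsto_const summable_LIMSEQ sm)
  then have "\<forall>\<^sub>F N in sequentially. suminf a - sum a {..<N} < 1"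
    by (rule order_tendstoD(2)) simp
  then obtain N where N: "\<And>n. n \<ge> N \<Longrightarrow> suminf a - sum a {..<n} < 1"
    unfolding eventually_sequentially by blast
  define M where "M = max J N"
  have "cmod (ideal_theta t x - theta_partial M t x) \<le> 1" if t: "t \<ge> (1/4) ^ J" for t x
  proof -
    define f where "f n = of_nat (ideal_count D n) * exp (- of_nat n * Complex t (2 * pi * x))" for n
    have "(0::real) < (1/4) ^ J" by simp
    then have t0: "t > 0" using t by linarith
    have sums: "f sums ideal_theta t x" unfolding f_def by (rule ideal_theta_sums[OF t0])
    have "theta_partial M t x = (\<Sum>n\<in>{1..M}. f n)"
      unfolding theta_partial_def f_def exp_eq_character by (simp add: mult.assoc)
    also have "\<dots> = (\<Sum>n<Suc M. f n)"
      by (rule sum.mono_neutral_left) (auto simp: f_def ideal_count_0 not_less_eq_eq)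
    finally have "ideal_theta t x - theta_partial M t x = (\<Sum>n. f (n + Suc M))"
      using suminf_minus_initial_segment[OF sums_summable[OF sums], of "Suc M"] sums_unique[OF sums] by simp
    also have "cmod \<dots> \<le> (\<Sum>n. a (n + Suc M))"
    proof (rule norm_suminf_le)
      fix n
      let ?m = "n + Suc M"
      have "real ?m * (1/4) ^ J \<le> real ?m * t" using t by (intro mult_left_mono) auto
      then show "cmod (f ?m) \<le> a ?m"
        unfolding f_def exp_eq_character a_def by (simp add: norm_mult mult_left_mono)
      show "summable (\<lambda>n. a (n + Suc M))" using sm by (rule summable_ignore_initial_segment)
    qed
    also have "\<dots> = suminf a - sum a {..<Suc M}" by (rule suminf_minus_initial_segment[OF sm])
    also have "\<dots> \<le> 1"
    proof -
      have "N \<le> Suc M" by (simp add: M_def)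
      from N[OF this] show ?thesis by simp
    qed
    finally show ?thesis .
  qed
  then show ?thesis by (intro that[of M]) (auto simp: M_def)
qed

definition theta_one :: real where "theta_one = (\<Sum>n. real (ideal_count D n) * exp (- real n))"

text \<open>For \<open>n >= 1\<close> and \<open>t >= 1\<close> one has
  \<open>n * t >= n + (t - 1)\<close>, which separates a factor decaying in \<open>t\<close> from a
  convergent series.\<close>

lemma theta_partial_large:
  assumes t: "t \<ge> 1"
  shows "cmod (theta_partial M t x) \<le> theta_one * exp (1 - t)"
proof -
  have sm: "summable (\<lambda>n. real (ideal_count D n) * exp (- real n))"
    using summable_ideal_count_exp[of 1] by simp
  have "cmod (theta_partial M t x) \<le> (\<Sum>n=1..M. real (ideal_count D n) * exp (- real n) * exp (1 - t))"
    unfolding theta_partial_def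
  proof (rule sum_norm_le)
    fix n assume n: "n \<in> {1..M}"
    have "1 * (t - 1) \<le> real n * (t - 1)" using n t by (intro mult_right_mono) auto
    then have "- (real n * t) \<le> - real n + (1 - t)" by (simp add: algebra_simps)
    then have "exp (- (real n * t)) \<le> exp (- real n) * exp (1 - t)" by (simp flip: exp_add)
    then have "real (ideal_count D n) * exp (- (real n * t)) \<le> real (ideal_count D n) * (exp (- real n) * exp (1 - t))"
      by (rule mult_left_mono) simp
    then show "cmod (of_real (real (ideal_count D n) * exp (- real n * t)) * character n x) \<le> real (ideal_count D n) * exp (- real n) * exp (1 - t)"
      by (simp add: norm_mult mult.assoc)
  qed
  also have "\<dots> = (\<Sum>n=1..M. real (ideal_count D n) * exp (- real n)) * exp (1 - t)"
    by (simp only: sum_distrib_right)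
  also have "\<dots> \<le> theta_one * exp (1 - t)"
    unfolding theta_one_def using sm by (intro mult_right_mono sum_le_suminf) auto
  finally show ?thesis .
qed

lemma theta_one_nonneg: "theta_one \<ge> 0"
  unfolding theta_one_def using summable_ideal_count_exp[of 1] by (intro suminf_nonneg) auto

lemma integral_large_le:
  "cmod (integral {1..4 ^ J} (integrand M x)) \<le> theta_one"
proof -
  have J: "(1::real) \<le> 4 ^ J" by simp
  have hi: "((\<lambda>t. theta_one * exp (1 - t)) has_integral (- (theta_one * exp (1 - 4 ^ J)) - (- (theta_one * exp (1 - 1))))) {1..4 ^ J}"
    by (rule fundamental_theorem_of_calculus[OF J])
       (auto intro!: derivative_eq_intros simp flip: has_real_derivative_iff_has_vector_derivative)
  have "cmod (integral {1..4 ^ J} (integrand M x)) \<le> integral {1..4 ^ J} (\<lambda>t. theta_one * exp (1 - t))"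
  proof (rule Henstock_Kurzweil_Integration.integral_norm_bound_integral)
    show "integrand M x integrable_on {1..4 ^ J}"
      by (intro integrable_continuous_interval continuous_integrand) simp
    show "(\<lambda>t. theta_one * exp (1 - t)) integrable_on {1..4 ^ J}" using hi by blast
    fix t :: real assume t: "t \<in> {1..4 ^ J}"
    have "t powr (s - 1) \<le> t powr 0" using t s_lt by (intro powr_mono) auto
    then have "t powr (s - 1) \<le> 1" using t by simp
    then have "cmod (integrand M x t) \<le> 1 * cmod (theta_partial M t x)"
      unfolding integrand_def norm_mult by (intro mult_right_mono) auto
    then show "cmod (integrand M x t) \<le> theta_one * exp (1 - t)"
      using theta_partial_large[of t M x] t by simp
  qed
  also have "\<dots> = theta_one - theta_one * exp (1 - 4 ^ J)"
    using integral_unique[OF hi] by simp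
  also have "\<dots> \<le> theta_one" using theta_one_nonneg by simp
  finally show ?thesis .
qed

lemma quarter_powr: "((1/4) ^ k) powr (s - 1) = Q ^ k"
proof -
  have "((1/4::real) ^ k) powr (s - 1) = (4 powr (- real k)) powr (s - 1)"
    by (simp add: powr_minus powr_realpow power_one_over inverse_eq_divide)
  also have "\<dots> = 4 powr ((1 - s) * real k)"
    unfolding powr_powr by (rule arg_cong[of _ _ "(powr) 4"]) (simp add: algebra_simps)
  also have "\<dots> = Q ^ k" by (simp add: Q_def powr_powr[symmetric] powr_realpow)
  finally show ?thesis .
qed

lemma integral_dyadic_eq:
  "integral {(1/4) ^ J..1} (integrand M x) = (\<Sum>j=1..J. integral {(1/4) ^ j..(1/4) ^ (j - 1)} (integrand M x))"
proof (induction J)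
  case (Suc J)
  have "integral {(1/4) ^ Suc J..(1/4) ^ J} (integrand M x) + integral {(1/4) ^ J..1} (integrand M x)
      = integral {(1/4) ^ Suc J..1} (integrand M x)"
  proof (rule Henstock_Kurzweil_Integration.integral_combine)
    show "(1/4::real) ^ Suc J \<le> (1/4) ^ J" by (rule power_decreasing) auto
    show "(1/4::real) ^ J \<le> 1" by (simp add: power_le_one)
    show "integrand M x integrable_on {(1/4) ^ Suc J..1}"
      by (intro integrable_continuous_interval continuous_integrand) simp
  qed
  then show ?case using Suc by (simp add: add.commute)
qed simp

text \<open>On the piece from \<open>4^(-j)\<close> to \<open>4^(1-j)\<close>, of length
  \<open>3 * 4^(-j)\<close>, the factor \<open>t powr (s - 1)\<close> is at most \<open>Q^j\<close>;
  as \<open>Q / 4 = 1 / S\<close>, the piece has weight \<open>3 * S^(-j)\<close>. Outside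
  \<open>bad_set I\<close> all kernel sums lie below their thresholds, which
  \<open>sum_level_le\<close> adds up.\<close>

theorem approximant_weak_bound:
  obtains K where "K > 0" "\<And>J. \<exists>M\<ge>J. \<forall>I. measure lborel {x \<in> {0..1}. cmod (approximant J M x) > K * Q ^ I} \<le> K * (1/4) ^ I"
proof -
  obtain C where C: "C > 0" "\<And>j t x v. t \<ge> (1/4) ^ j \<Longrightarrow>
    (\<And>l. kernel_sum (2 ^ (j + l)) (real kernel_modulus * x) \<le> v l) \<Longrightarrow> summable (\<lambda>l. (1/4) ^ l * v l) \<Longrightarrow>
    cmod (ideal_theta t x) \<le> C * (2 ^ j + (\<Sum>l. (1/4) ^ l * v l))"
    by (rule ideal_theta_bound) (blast intro: that)
  define E where "E = 1 / (1 - 2 / S) + B * (2 / (1 - \<rho>)) * (1 / (1 - 1 / Q))"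
  have E: "E \<ge> 0" unfolding E_def using S_gt_2 B_ge_1 \<rho>_less_1 Q_gt_1
    by (intro add_nonneg_nonneg mult_nonneg_nonneg divide_nonneg_nonneg) auto
  \<comment> \<open>The first two terms bound the integrals below and above \<open>t = 1\<close>,
    the third the exceptional set; one constant serves for both level and measure, and the last 1
    makes it positive.\<close>
  define K where "K = 3 * (C + 1) * E + theta_one + bad_const + 1"
  have bad: "bad_const \<ge> 0"
  proof -
    have "0 \<le> measure lborel (bad_set 0)" by simp
    also have "\<dots> \<le> bad_const" using measure_bad_set[of 0] by simp
    finally show ?thesis .
  qed
  have K: "K > 0" unfolding K_def using C(1) E theta_one_nonneg bad by (simp add: add_nonneg_pos)
  have small: "cmod (approximant J M x) \<le> K * Q ^ I"
    if M: "\<And>t x. t \<ge> (1/4) ^ J \<Longrightarrow> cmod (ideal_theta t x - theta_partial M t x) \<le> 1"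
      and x: "x \<in> {0..1}" "x \<notin> bad_set I" for J M I x
  proof -
    have piece: "cmod (integral {(1/4) ^ j..(1/4) ^ (j - 1)} (integrand M x)) \<le> 3 * (C + 1) * ((1 / S) ^ j * (2 ^ j + level_sum I j))"
      if j: "j \<in> {1..J}" for j
    proof -
      let ?V = "2 ^ j + level_sum I j"
      have ls: "0 \<le> level_sum I j" unfolding level_sum_def
        by (intro suminf_nonneg summable_level mult_nonneg_nonneg level_nonneg) auto
      have jJ: "(1/4::real) ^ J \<le> (1/4) ^ j" using j by (intro power_decreasing) auto
      \<comment> \<open>The truncation error 1 is absorbed through \<open>1 <= ?V\<close>, which
        turns \<open>C\<close> into \<open>C + 1\<close>.\<close>
      have th: "cmod (theta_partial M t x) \<le> (C + 1) * ?V" if t: "t \<ge> (1/4) ^ j" for t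
      proof -
        have "cmod (theta_partial M t x) \<le> cmod (ideal_theta t x) + cmod (ideal_theta t x - theta_partial M t x)"
          by (metis norm_minus_commute norm_triangle_sub)
        also have "cmod (ideal_theta t x) \<le> C * ?V"
          unfolding level_sum_def by (rule C(2)[OF t kernel_sum_le_level[OF x] summable_level])
        also have "cmod (ideal_theta t x - theta_partial M t x) \<le> 1" using M[of t x] t jJ by linarith
        also have "1 \<le> ?V"
        proof -
          have "(1::real) \<le> 2 ^ j" by simp
          then show ?thesis using ls by linarith
        qed
        finally show ?thesis by (simp add: algebra_simps)
      qed
      have Vn: "0 \<le> (C + 1) * ?V" using C(1) ls by (intro mult_nonneg_nonneg) auto
      have j': "(1/4::real) ^ (j - 1) = 4 * (1/4) ^ j" using j by (cases j) auto
      have "cmod (integral {(1/4) ^ j..(1/4) ^ (j - 1)} (integrand M x))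
          \<le> integral {(1/4) ^ j..(1/4) ^ (j - 1)} (\<lambda>t::real. Q ^ j * ((C + 1) * ?V))"
      proof (rule Henstock_Kurzweil_Integration.integral_norm_bound_integral)
        show "integrand M x integrable_on {(1/4) ^ j..(1/4) ^ (j - 1)}"
          by (intro integrable_continuous_interval continuous_integrand) simp
        show "(\<lambda>t::real. Q ^ j * ((C + 1) * ?V)) integrable_on {(1/4) ^ j..(1/4) ^ (j - 1) :: real}"
          by (intro integrable_continuous_interval continuous_intros)
        fix t :: real assume t: "t \<in> {(1/4) ^ j..(1/4) ^ (j - 1)}"
        have "t powr (s - 1) \<le> ((1/4) ^ j) powr (s - 1)"
          using t s_lt by (intro powr_mono2') auto
        then show "cmod (integrand M x t) \<le> Q ^ j * ((C + 1) * ?V)"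
          unfolding integrand_def norm_mult quarter_powr using th[of t] t Q_gt_1 Vn
          by (intro mult_mono) auto
      qed
      also have "\<dots> = (4 * (1/4) ^ j - (1/4) ^ j) * (Q ^ j * ((C + 1) * ?V))"
        unfolding j' by simp
      also have "\<dots> = 3 * (C + 1) * (((1/4) * Q) ^ j * ?V)"
        unfolding power_mult_distrib by (simp add: algebra_simps)
      also have "(1/4) * Q = 1 / S" using S_mult_Q S_pos by (simp add: field_simps)
      finally show ?thesis .
    qed
    have "integral {(1/4) ^ J..1} (integrand M x) + integral {1..4 ^ J} (integrand M x) = approximant J M x"
      unfolding approximant_eq_integral
      by (rule Henstock_Kurzweil_Integration.integral_combine)
         (auto simp: power_le_one intro!: integrable_continuous_interval continuous_integrand)
    then have "cmod (approximant J M x) \<le> cmod (integral {(1/4) ^ J..1} (integrand M x)) + cmod (integral {1..4 ^ J} (integrand M x))"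
      by (metis norm_triangle_ineq)
    also have "cmod (integral {(1/4) ^ J..1} (integrand M x)) \<le> (\<Sum>j=1..J. 3 * (C + 1) * ((1 / S) ^ j * (2 ^ j + level_sum I j)))"
      unfolding integral_dyadic_eq by (rule sum_norm_le[OF piece])
    also have "\<dots> = 3 * (C + 1) * (\<Sum>j=1..J. (1 / S) ^ j * (2 ^ j + level_sum I j))"
      by (simp only: sum_distrib_left)
    also have "\<dots> \<le> 3 * (C + 1) * (E * Q ^ I)"
      unfolding E_def using C(1) by (intro mult_left_mono sum_level_le) auto
    also have "cmod (integral {1..4 ^ J} (integrand M x)) \<le> theta_one * Q ^ I"
    proof -
      have "theta_one * 1 \<le> theta_one * Q ^ I" using theta_one_nonneg Q_gt_1 by (intro mult_left_mono) auto
      then show ?thesis using integral_large_le[of J M x] by linarith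
    qed
    also have "3 * (C + 1) * (E * Q ^ I) + theta_one * Q ^ I = (3 * (C + 1) * E + theta_one) * Q ^ I"
      by (simp add: algebra_simps)
    also have "\<dots> \<le> K * Q ^ I" unfolding K_def using bad Q_gt_1 by (intro mult_right_mono) auto
    finally show ?thesis by simp
  qed
  have "\<exists>M\<ge>J. \<forall>I. measure lborel {x \<in> {0..1}. cmod (approximant J M x) > K * Q ^ I} \<le> K * (1/4) ^ I" for J
  proof -
    obtain M where M: "M \<ge> J" "\<And>t x. t \<ge> (1/4) ^ J \<Longrightarrow> cmod (ideal_theta t x - theta_partial M t x) \<le> 1"
      by (rule theta_partial_close[of J]) (blast intro: that)
    have "measure lborel {x \<in> {0..1}. cmod (approximant J M x) > K * Q ^ I} \<le> K * (1/4) ^ I" for I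
    proof -
      have "{x \<in> {0..1}. cmod (approximant J M x) > K * Q ^ I} \<subseteq> bad_set I"
        using small[OF M(2)] by (force simp: not_less[symmetric])
      moreover have "{x \<in> {0..1}. cmod (approximant J M x) > K * Q ^ I} \<in> sets lborel"
        unfolding approximant_def character_def
        by (intro fmeasurableD superlevel_fmeasurable continuous_intros)
      ultimately have "measure lborel {x \<in> {0..1}. cmod (approximant J M x) > K * Q ^ I} \<le> measure lborel (bad_set I)"
        using bad_set_fmeasurable by (rule measure_mono_fmeasurable)
      also have "\<dots> \<le> bad_const * (1/4) ^ I" by (rule measure_bad_set)
      also have "\<dots> \<le> K * (1/4) ^ I"
        unfolding K_def using C(1) E theta_one_nonneg by (intro mult_right_mono) auto
      finally show ?thesis .
    qed
    then show ?thesis using M(1) by blast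
  qed
  then show ?thesis using that K by blast
qed

end

section \<open>Weak-type bound for the ideal series\<close>

context ideal_series
begin

text \<open>Euler's integral after the substitution \<open>u = n * t\<close>, in the form to which
  monotone convergence applies directly.\<close>

lemma nn_integral_exp_powr:
  assumes n: "n \<ge> 1"
  shows "(\<integral>\<^sup>+t. ennreal (indicator {0..} t * (t powr (s - 1) * exp (- real n * t))) \<partial>lborel)
     = ennreal (Gamma s / real n powr s)" (is "?I = _")
proof -
  define f where "f u = ennreal (indicator {0..} u * u powr (s - 1) / exp u)" for u :: real
  have [measurable]: "f \<in> borel_measurable borel" unfolding f_def by measurable
  have n0: "real n > 0" using n by simp
  have f_scale: "f (0 + real n * t) = ennreal (real n powr (s - 1)) * ennreal (indicator {0..} t * (t powr (s - 1) * exp (- real n * t)))" for t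
  proof (cases "t \<ge> 0")
    case True
    then have "indicator {0..} (real n * t) = (1::real)" using n0 by simp
    then show ?thesis using True n0
      by (simp add: f_def powr_mult exp_minus divide_inverse mult_ac flip: ennreal_mult)
  next
    case False
    then have "indicator {0..} (real n * t) = (0::real)" using n0 by (simp add: mult_less_0_iff not_le)
    then show ?thesis using False by (simp add: f_def)
  qed
  have "ennreal (Gamma s) = (\<integral>\<^sup>+u. f u \<partial>lborel)"
    unfolding f_def using s_gt by (intro Gamma_conv_nn_integral_real) simp
  also have "\<dots> = ennreal \<bar>real n\<bar> * (\<integral>\<^sup>+t. f (0 + real n * t) \<partial>lborel)"
    by (rule nn_integral_real_affine) (use n0 in auto)
  also have "\<dots> = ennreal (real n) * (ennreal (real n powr (s - 1)) * ?I)"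
    unfolding f_scale by (subst nn_integral_cmult) auto
  also have "\<dots> = ennreal (real n powr s) * ?I"
  proof -
    have "real n * real n powr (s - 1) = real n powr s" using n0 by (simp add: powr_diff)
    then show ?thesis by (simp add: mult.assoc[symmetric] flip: ennreal_mult)
  qed
  finally have eq: "ennreal (Gamma s) = ennreal (real n powr s) * ?I" .
  have "?I = ennreal (1 / real n powr s) * (ennreal (real n powr s) * ?I)"
    using n0 by (simp add: mult.assoc[symmetric] flip: ennreal_mult)
  also have "\<dots> = ennreal (Gamma s / real n powr s)"
    unfolding eq[symmetric] using s_gt by (simp add: Gamma_real_nonneg flip: ennreal_mult)
  finally show ?thesis .
qed

lemma mollifier_nn_integral:
  "ennreal (mollifier J n) = (\<integral>\<^sup>+t. ennreal (indicator {(1/4) ^ J..4 ^ J} t * (t powr (s - 1) * exp (- real n * t))) \<partial>lborel)"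
proof -
  have "((\<lambda>t. t powr (s - 1) * exp (- real n * t)) has_integral mollifier J n) {(1/4) ^ J..4 ^ J}"
    unfolding mollifier_def
    by (intro integrable_integral integrable_continuous_interval continuous_intros) (auto simp: quarter_power_pos)
  then show ?thesis by (intro nn_integral_has_integral_lebesgue[symmetric]) auto
qed

lemma mollifier_nonneg: "0 \<le> mollifier J n"
  unfolding mollifier_def
  by (intro Henstock_Kurzweil_Integration.integral_nonneg integrable_continuous_interval continuous_intros)
     (auto simp: quarter_power_pos)

lemma mollifier_le:
  assumes n: "n \<ge> 1"
  shows "mollifier J n \<le> Gamma s / real n powr s"
proof -
  have "ennreal (mollifier J n) \<le> ennreal (Gamma s / real n powr s)"
    unfolding mollifier_nn_integral nn_integral_exp_powr[OF n, symmetric]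
  proof (intro nn_integral_mono ennreal_leI mult_right_mono)
    fix t :: real
    show "indicator {(1/4) ^ J..4 ^ J} t \<le> (indicator {0..} t :: real)"
      by (auto simp: indicator_def intro: order_trans[rotated])
  qed auto
  moreover have "0 \<le> Gamma s / real n powr s" using s_gt by (simp add: Gamma_real_nonneg)
  ultimately show ?thesis by simp
qed

text \<open>Monotone convergence: the intervals from \<open>4^(-J)\<close> to \<open>4^J\<close>
  increase to the positive half line.\<close>

lemma mollifier_tendsto:
  assumes n: "n \<ge> 1"
  shows "(\<lambda>J. mollifier J n) \<longlonglongrightarrow> Gamma s / real n powr s"
proof -
  let ?h = "\<lambda>t. t powr (s - 1) * exp (- real n * t)"
  have "(\<lambda>J. \<integral>\<^sup>+t. ennreal (indicator {(1/4) ^ J..4 ^ J} t * ?h t) \<partial>lborel)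
     \<longlonglongrightarrow> (\<integral>\<^sup>+t. ennreal (indicator {0..} t * ?h t) \<partial>lborel)"
  proof (rule nn_integral_LIMSEQ)
    show "incseq (\<lambda>J t. ennreal (indicator {(1/4) ^ J..4 ^ J} t * ?h t))"
    proof (intro incseq_SucI le_funI ennreal_leI mult_right_mono)
      fix J and t :: real
      have "(1/4::real) ^ Suc J \<le> (1/4) ^ J" by (rule power_decreasing) auto
      moreover have "(4::real) ^ J \<le> 4 ^ Suc J" by (rule power_increasing) auto
      ultimately have "{(1/4::real) ^ J..4 ^ J} \<subseteq> {(1/4) ^ Suc J..4 ^ Suc J}"
        by (intro atLeastatMost_subset_iff[THEN iffD2] disjI2 conjI)
      then show "indicator {(1/4) ^ J..4 ^ J} t \<le> (indicator {(1/4) ^ Suc J..4 ^ Suc J} t :: real)"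
        by (intro indicator_leI) (rule subsetD)
    qed auto
    show "(\<lambda>J. ennreal (indicator {(1/4) ^ J..4 ^ J} t * ?h t)) \<longlonglongrightarrow> ennreal (indicator {0..} t * ?h t)" for t
    proof (cases "t > 0")
      case True
      obtain J1 where J1: "(1/4) ^ J1 < t" using real_arch_pow_inv[OF True, of "1/4"] by auto
      obtain J2 where J2: "t < 4 ^ J2" using real_arch_pow[of 4 t] by auto
      have "indicator {(1/4) ^ J..4 ^ J} t = (1::real)" if "J \<ge> max J1 J2" for J
      proof -
        have "(1/4::real) ^ J \<le> (1/4) ^ J1" using that by (intro power_decreasing) auto
        moreover have "(4::real) ^ J2 \<le> 4 ^ J" using that by (intro power_increasing) auto
        ultimately have "t \<in> {(1/4) ^ J..4 ^ J}" using J1 J2 by (simp only: atLeastAtMost_iff) linarith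
        then show ?thesis by simp
      qed
      then have "\<forall>\<^sub>F J in sequentially. ennreal (indicator {(1/4) ^ J..4 ^ J} t * ?h t) = ennreal (indicator {0..} t * ?h t)"
        using True by (intro eventually_sequentiallyI[of "max J1 J2"]) simp
      then show ?thesis by (rule tendsto_eventually)
    next
      case False
      have "indicator {(1/4) ^ J..4 ^ J} t * ?h t = indicator {0..} t * ?h t" for J
      \<comment> \<open>At \<open>t = 0\<close> both sides vanish because
        \<open>0 powr (s - 1)\<close> is 0.\<close>
      proof (cases "t = 0")
        case False
        with \<open>\<not> t > 0\<close> have t: "t < 0" by simp
        have "\<not> (1/4) ^ J \<le> t" using t quarter_power_pos[of J] by linarith
        then show ?thesis using t by (simp add: indicator_def)
      qed simp
      then show ?thesis by (simp only: tendsto_const)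
    qed
  qed measurable
  then have "(\<lambda>J. ennreal (mollifier J n)) \<longlonglongrightarrow> ennreal (Gamma s / real n powr s)"
    unfolding mollifier_nn_integral nn_integral_exp_powr[OF n] .
  moreover have "0 \<le> Gamma s / real n powr s" using s_gt by (simp add: Gamma_real_nonneg)
  ultimately show ?thesis by (subst (asm) tendsto_ennreal_iff) (auto simp: mollifier_nonneg)
qed

definition series_coeff :: "nat \<Rightarrow> real" where
  "series_coeff n = real (ideal_count D n) / real n powr s"

lemma m_partial_eq_trig_sum: "m_partial D s N x = trig_sum {1..N} series_coeff x"
  unfolding m_partial_def trig_sum_def series_coeff_def character_def by simp

lemma exists_weak_approximation:
  obtains f M K where "weak_approximation series_coeff f M K Q"
proof -
  have G: "Gamma s > 0" using s_gt by (intro Gamma_real_pos) simp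
  obtain K0 where K0: "K0 > 0" "\<And>J. \<exists>M\<ge>J. \<forall>I. measure lborel {x \<in> {0..1}. cmod (approximant J M x) > K0 * Q ^ I} \<le> K0 * (1/4) ^ I"
    by (rule approximant_weak_bound) (blast intro: that)
  have "\<exists>M. \<forall>J. M J \<ge> J \<and> (\<forall>I. measure lborel {x \<in> {0..1}. cmod (approximant J (M J) x) > K0 * Q ^ I} \<le> K0 * (1/4) ^ I)"
    by (rule choice) (use K0(2) in blast)
  then obtain M where M: "\<And>J. M J \<ge> J"
    "\<And>J I. measure lborel {x \<in> {0..1}. cmod (approximant J (M J) x) > K0 * Q ^ I} \<le> K0 * (1/4) ^ I"
    by blast
  \<comment> \<open>Division by \<open>Gamma s\<close> rescales the levels but not the measures, so
    \<open>K\<close> has to dominate both constants.\<close>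
  define K where "K = max K0 (K0 / Gamma s)"
  define f where "f J n = real (ideal_count D n) * mollifier J n / Gamma s" for J n
  have "weak_approximation series_coeff f M K Q"
  proof
    show "0 \<le> f J n" for J n using G mollifier_nonneg by (simp add: f_def)
    show "f J n \<le> series_coeff n" if "n \<ge> 1" for J n
    proof -
      have "f J n \<le> real (ideal_count D n) * (Gamma s / real n powr s) / Gamma s"
        unfolding f_def using G mollifier_le[OF that] by (intro divide_right_mono mult_left_mono) auto
      then show ?thesis using G by (simp add: series_coeff_def)
    qed
    show "(\<lambda>J. f J n) \<longlonglongrightarrow> series_coeff n" if "n \<ge> 1" for n
    proof -
      have "(\<lambda>J. f J n) \<longlonglongrightarrow> real (ideal_count D n) * (Gamma s / real n powr s) / Gamma s"
        unfolding f_def using G by (intro tendsto_intros mollifier_tendsto that) auto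
      then show ?thesis using G by (simp add: series_coeff_def)
    qed
    show "M J \<ge> J" for J by (rule M)
    show "K > 0" using K0 by (simp add: K_def less_max_iff_disj)
    show "Q > 1" by (rule Q_gt_1)
    have "(4::real) powr (1 - s) < 4 powr (1/2)" using s_gt by (intro powr_less_mono) auto
    then show "Q < 2" by (simp add: Q_def powr_half_sqrt)
    fix J I
    have eq: "trig_sum {1..M J} (f J) x = approximant J (M J) x / of_real (Gamma s)" for x
      unfolding trig_sum_def approximant_def f_def sum_divide_distrib by (intro sum.cong) simp_all
    have "{x \<in> {0..1}. cmod (trig_sum {1..M J} (f J) x) > K * Q ^ I} \<subseteq> {x \<in> {0..1}. cmod (approximant J (M J) x) > K0 * Q ^ I}"
    proof safe
      fix x assume "cmod (trig_sum {1..M J} (f J) x) > K * Q ^ I"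
      moreover have "K0 / Gamma s * Q ^ I \<le> K * Q ^ I" using Q_gt_1 by (intro mult_right_mono) (auto simp: K_def)
      ultimately have "K0 / Gamma s * Q ^ I < cmod (approximant J (M J) x) / Gamma s"
        unfolding eq norm_divide using G by simp
      then show "cmod (approximant J (M J) x) > K0 * Q ^ I" using G by (simp add: divide_less_cancel)
    qed
    moreover have "{x \<in> {0..1}. cmod (trig_sum {1..M J} (f J) x) > K * Q ^ I} \<in> sets lborel"
      by (intro fmeasurableD superlevel_fmeasurable continuous_intros continuous_trig_sum)
    moreover have "{x \<in> {0..1}. cmod (approximant J (M J) x) > K0 * Q ^ I} \<in> fmeasurable lborel"
      unfolding approximant_def character_def by (intro superlevel_fmeasurable continuous_intros)
    ultimately have "measure lborel {x \<in> {0..1}. cmod (trig_sum {1..M J} (f J) x) > K * Q ^ I}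
        \<le> measure lborel {x \<in> {0..1}. cmod (approximant J (M J) x) > K0 * Q ^ I}"
      by (rule measure_mono_fmeasurable)
    also have "\<dots> \<le> K0 * (1/4) ^ I" by (rule M)
    also have "\<dots> \<le> K * (1/4) ^ I" by (intro mult_right_mono) (auto simp: K_def)
    finally show "measure lborel {x \<in> {0..1}. cmod (trig_sum {1..M J} (f J) x) > K * Q ^ I} \<le> K * (1/4) ^ I" .
  qed
  then show ?thesis by (rule that)
qed

end

text \<open>The series determines a function only up to null sets, so the bound is claimed for every
  \<open>L^2\<close> limit of the partial sums; the first conjunct keeps this from being
  vacuous.\<close>

theorem theorem5:
  fixes D :: int and s :: real
  assumes "D < 0" and "fund_disc D" and "1/2 < s" and "s < 1"
  shows "(\<exists>g :: real \<Rightarrow> complex. g \<in> borel_measurable lborel \<and>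
            set_integrable lborel {0..1} (\<lambda>x. (cmod (g x))\<^sup>2) \<and>
            (\<lambda>N. LINT x:{0..1}|lborel. (cmod (m_partial D s N x - g x))\<^sup>2) \<longlonglongrightarrow> 0)
    \<and> (\<forall>g :: real \<Rightarrow> complex.
         g \<in> borel_measurable lborel \<and>
         set_integrable lborel {0..1} (\<lambda>x. (cmod (g x))\<^sup>2) \<and>
         (\<lambda>N. LINT x:{0..1}|lborel. (cmod (m_partial D s N x - g x))\<^sup>2) \<longlonglongrightarrow> 0
         \<longrightarrow> (\<exists>c. \<forall>\<alpha>>0. measure lborel {x \<in> {0..1}. cmod (g x) > \<alpha>}
                          \<le> c * \<alpha> powr (- 1 / (1 - s))))"
proof -
  have "D mod 4 = 0 \<or> D mod 4 = 1" using assms(2) by (auto simp: fund_disc_def)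
  then interpret ideal_series D s using assms by unfold_locales auto
  obtain f M K where "weak_approximation series_coeff f M K Q" using exists_weak_approximation .
  then interpret weak_approximation series_coeff f M K Q .
  have meas: "g \<in> borel_measurable lborel \<longleftrightarrow> g \<in> borel_measurable borel" for g :: "real \<Rightarrow> complex"
    by simp
  show ?thesis
    unfolding set_integrable_unit_measure LINT_unit_measure m_partial_eq_trig_sum meas
  proof (intro conjI allI impI)
    obtain g :: "real \<Rightarrow> complex" where "g \<in> borel_measurable borel"
      "integrable unit_measure (\<lambda>x. (cmod (g x))\<^sup>2)"
      "(\<lambda>N. \<integral>x. (cmod (P N x - g x))\<^sup>2 \<partial>unit_measure) \<longlonglongrightarrow> 0"
      using exists_L2_limit .
    then show "\<exists>g. g \<in> borel_measurable borel \<and> integrable unit_measure (\<lambda>x. (cmod (g x))\<^sup>2) \<and>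
      (\<lambda>N. \<integral>x. (cmod (P N x - g x))\<^sup>2 \<partial>unit_measure) \<longlonglongrightarrow> 0" by blast
  next
    fix g :: "real \<Rightarrow> complex"
    assume g: "g \<in> borel_measurable borel \<and> integrable unit_measure (\<lambda>x. (cmod (g x))\<^sup>2) \<and>
      (\<lambda>N. \<integral>x. (cmod (P N x - g x))\<^sup>2 \<partial>unit_measure) \<longlonglongrightarrow> 0"
    have "Q powr (1 / (1 - s)) = 4" using s_lt by (simp add: Q_def powr_powr)
    then have "measure lborel {x \<in> {0..1}. cmod (g x) > \<alpha>}
        \<le> (4 * K + 1) * (2 * K) powr (1 / (1 - s)) * \<alpha> powr (- (1 / (1 - s)))" if "\<alpha> > 0" for \<alpha>
      using g s_lt that by (intro limit_weak_type) auto
    then show "\<exists>c. \<forall>\<alpha>>0. measure lborel {x \<in> {0..1}. cmod (g x) > \<alpha>} \<le> c * \<alpha> powr (- 1 / (1 - s))"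
      by (intro exI[of _ "(4 * K + 1) * (2 * K) powr (1 / (1 - s))"]) simp
  qed
qed

end
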